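(* Let $n\ge1$, let $\Gamma$ be a lattice in $G=SU(n,1)$, and let $\kappa\ge1$ with $\kappa\in\tfrac12\mathbb Z$ and $(n+1)\kappa\in\mathbb Z$. Let $\gamma_0\in\Gamma$ be loxodromic and let $\tilde f$ be the lift of the cusp form $f\in S_{2(n+1)\kappa}(\Gamma)$ to $G$. Then for any lift $[\gamma_0]_w$ of the closed geodesic $[\gamma_0]$ to $G$ we have $$(f,\Theta_{\gamma_0,\kappa})=e^{-2(n+1)\kappa i\psi}\,\alpha^{-(n+1)\kappa}\,C\int_{[\gamma_0]_w}\tilde f\,dt .$$ Here $w=\begin{pmatrix}u_{n-1}&0&0\\0&e^{-i\psi}&0\\0&0&e^{-i\psi}\end{pmatrix}\in W$ with $\det u_{n-1}=e^{2i\psi}$, $\alpha=-\frac{\langle X,Y\rangle}{2}$, and $$C=\frac{(2(n+1)\kappa-n-1)!}{\big(((n+1)\kappa-1)!\big)^2}\,\pi^n\,2^{2(n+1)(1-\kappa)-1}.$$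
   Context: Hermitian form: on $\mathbb C^{n+1}$, $\langle z,w\rangle=z_1\bar w_1+\dots+z_n\bar w_n-z_{n+1}\bar w_{n+1}$; $SU(n,1)$ is the group of unimodular complex matrices preserving it. $B^n$ is the unit ball in $\mathbb C^n$; points $z$ of the closed ball are identified with $(z_1,\dots,z_n,1)^T$, so $\langle z,w\rangle=z_1\bar w_1+\dots+z_n\bar w_n-1$ for them. A matrix $g=\begin{pmatrix}A&b\\c&d\end{pmatrix}$ ($A$ of size $n\times n$) acts on $B^n$ by $g(z)=(Az+b)/(c\cdot z+d)$, and $j(g,z)=(c\cdot z+d)^{-1}$. The invariant volume form is $dV=4^n(-\langle z,z\rangle)^{-(n+1)}dV_E$, with $dV_E$ the Euclidean volume form on $\mathbb C^n$. Put $(f|\gamma)(z)=f(\gamma(z))\,j(\gamma,z)^{2(n+1)\kappa}$. $S_{2(n+1)\kappa}(\Gamma)$ is the space of cusp forms of weight $2(n+1)\kappa$: holomorphic $f:B^n\to\mathbb C$ with $f|\gamma=f$ for all $\gamma\in\Gamma$ and $|f(z)|(-\langle z,z\rangle)^{(n+1)\kappa}$ bounded on $B^n$. The lift of $f$ to $G$ is $\tilde f(g)=f(g(0))\,j(g,0)^{2(n+1)\kappa}$; it is left $\Gamma$-invariant. The inner product is $(f_1,f_2)=\int_{\Gamma\backslash B^n}f_1\overline{f_2}\,(-\langle z,z\rangle)^{2(n+1)\kappa}\,dV$. Let $a_t=\begin{pmatrix}1_{n-1}&0&0\\0&\cosh t&\sinh t\\0&\sinh t&\cosh t\end{pmatrix}$,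 $A=\{a_t\mid t\in\mathbb R\}$, and let $\mathfrak I=\{a_t(0)\}=\{(0,\dots,0,\tanh t)\}$ be the standard geodesic. $W$ is the subgroup of $S(U(n)\times U(1))$ commuting with $A$; it consists of the matrices $\mathrm{diag}(u_{n-1},e^{-i\psi},e^{-i\psi})$ with $u_{n-1}\in U(n-1)$, $\det u_{n-1}=e^{2i\psi}$. An element of $G$ is loxodromic if it is conjugate to an element of the centralizer $AW$ of $A$ (elliptic elements being excluded); it has two fixed points in $\partial B^n$, $X$ repelling and $Y$ attracting, and its axis is the geodesic in $B^n$ that it fixes, joining them. $[\gamma_0]$ denotes the closed geodesic in $\Gamma\backslash B^n$ that is the image of the axis of $\gamma_0$. Lifts: for a point $z_0$ on the axis of $\gamma_0$ there is $g\in G$ mapping $\mathfrak I$ to the axis of $\gamma_0$ with $g(0)=z_0$; $g$ is determined up to right multiplication by $W$. The lifts of the segment $[z_0,\gamma_0z_0]$ of the axis are the orbit segments $[\gamma_0]_w=\{gwa_t\mid 0\le t\le s\}$, $w\in W$, where $g(a_s(0))=\gamma_0z_0$, and $\int_{[\gamma_0]_w}\tilde f\,dt=\int_0^s\tilde f(gwa_t)\,dt$. For loxodromic $\gamma_0\in\Gamma$ let $\Gamma_0=\langle\gamma_0\rangle$ and $Q_{\gamma_0}(z)=\langle z,X\rangle\langle z,Y\rangle$, which is stated to transform, for every loxodromic $\gamma_0\in\Gamma$, by $Q_{\gamma_0}(\gamma_0z)=j(\gamma_0,z)^2Q_{\gamma_0}(z)$. Let $q(z)=Q_{\gamma_0}(z)^{-(n+1)\kappa}$.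 The relative Poincaré series is $\Theta_{\gamma_0,\kappa}(z)=\sum_{\gamma\in\Gamma_0\backslash\Gamma}(q|\gamma)(z)$, a cusp form in $S_{2(n+1)\kappa}(\Gamma)$.
   Formalization: Added: q|γ₀ = q (else the sum Θ is undefined) and the base lift g normalised so that j(g,(0,…,0,1))^{2(n+1)κ} > 0 (else the phase is wrong; for n=1 this says Y^{2κ}=1). The inner product is divided by the number of scalar matrices in Γ. *)

theory Defs
  imports "HOL-Analysis.Analysis"
begin

text \<open>
  The ball lives in \<open>complex ^ 'n\<close> with \<open>n = CARD('n)\<close>. Vectors of \<open>C^(n+1)\<close> are indexed by
  \<open>'n option\<close>; the index \<open>None\<close> is the negative direction of the Hermitian form. The coordinate
  along which the standard geodesic runs (the \<open>n\<close>-th one) is a parameter \<open>l :: 'n\<close>. All weights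
  are of the form \<open>2 * m\<close>, where \<open>m = (n + 1) * \<kappa>\<close>.
\<close>

type_synonym 'n mtx = "complex ^ ('n option) ^ ('n option)"

definition herm :: "complex ^ ('n::finite option) \<Rightarrow> complex ^ ('n option) \<Rightarrow> complex"
  where "herm z w = (\<Sum>i\<in>UNIV. z $ Some i * cnj (w $ Some i)) - z $ None * cnj (w $ None)"

definition SUn1 :: "('n::finite) mtx set"
  where "SUn1 = {g. det g = 1 \<and> (\<forall>z w. herm (g *v z) (g *v w) = herm z w)}"

definition emb :: "complex ^ 'n::finite \<Rightarrow> complex ^ ('n option)"
  where "emb z = (\<chi> k. case k of None \<Rightarrow> 1 | Some i \<Rightarrow> z $ i)"

definition jfac :: "('n::finite) mtx \<Rightarrow> complex ^ 'n \<Rightarrow> complex"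
  where "jfac g z = inverse ((g *v emb z) $ None)"

definition act :: "('n::finite) mtx \<Rightarrow> complex ^ 'n \<Rightarrow> complex ^ 'n"
  where "act g z = (\<chi> i. (g *v emb z) $ Some i / (g *v emb z) $ None)"

abbreviation uball :: "(complex ^ 'n::finite) set"
  where "uball \<equiv> ball 0 1"

text \<open>The quantity \<open>- \<langle>z, z\<rangle>\<close>, which is real.\<close>

definition hgt :: "complex ^ 'n::finite \<Rightarrow> real"
  where "hgt z = - Re (herm (emb z) (emb z))"

definition inv_vol :: "(complex ^ 'n::finite) measure"
  where "inv_vol =
    density lborel (\<lambda>z. ennreal (indicator uball z * (4 ^ CARD('n) / hgt z ^ (CARD('n) + 1))))"

definition subgroup_SUn1 :: "('n::finite) mtx set \<Rightarrow> bool"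
  where "subgroup_SUn1 H \<longleftrightarrow> H \<subseteq> SUn1 \<and> mat 1 \<in> H \<and>
    (\<forall>a\<in>H. \<forall>b\<in>H. a ** b \<in> H) \<and> (\<forall>a\<in>H. matrix_inv a \<in> H)"

text \<open>
  Lattice: discrete subgroup of finite covolume with respect to a Haar measure \<open>\<mu>\<close> (unique up to a
  factor; the group is unimodular). Finite covolume is expressed by a Borel set of finite measure
  whose translates cover the group.
\<close>

definition haar_SUn1 :: "('n::finite) mtx measure \<Rightarrow> bool"
  where "haar_SUn1 \<mu> \<longleftrightarrow> sets \<mu> = sets (restrict_space borel SUn1) \<and>
    (\<forall>h\<in>SUn1. \<forall>A\<in>sets \<mu>. emeasure \<mu> ((**) h ` A) = emeasure \<mu> A) \<and>
    (\<forall>K. compact K \<and> K \<subseteq> SUn1 \<longrightarrow> emeasure \<mu> K < \<infinity>) \<and>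
    emeasure \<mu> SUn1 > 0"

definition lattice_SUn1 :: "('n::finite) mtx set \<Rightarrow> bool"
  where "lattice_SUn1 \<Gamma> \<longleftrightarrow> subgroup_SUn1 \<Gamma> \<and> discrete \<Gamma> \<and>
    (\<exists>\<mu> D. haar_SUn1 \<mu> \<and> D \<in> sets \<mu> \<and> emeasure \<mu> D < \<infinity> \<and>
       SUn1 = (\<Union>\<gamma>\<in>\<Gamma>. (**) \<gamma> ` D))"

text \<open>Holomorphic in several variables: Frechet differentiable with complex-linear derivative.\<close>

definition holomorphic_Cn :: "(complex ^ 'n::finite \<Rightarrow> complex) \<Rightarrow> (complex ^ 'n) set \<Rightarrow> bool"
  where "holomorphic_Cn f S \<longleftrightarrow>
    (\<forall>z\<in>S. \<exists>D. (f has_derivative D) (at z) \<and> (\<forall>c v. D (c *s v) = c * D v))"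

definition slash ::
  "nat \<Rightarrow> (complex ^ 'n::finite \<Rightarrow> complex) \<Rightarrow> 'n mtx \<Rightarrow> complex ^ 'n \<Rightarrow> complex"
  where "slash m f g z = f (act g z) * jfac g z ^ (2 * m)"

definition cusp_forms :: "nat \<Rightarrow> ('n::finite) mtx set \<Rightarrow> (complex ^ 'n \<Rightarrow> complex) set"
  where "cusp_forms m \<Gamma> = {f. holomorphic_Cn f uball \<and>
    (\<forall>\<gamma>\<in>\<Gamma>. \<forall>z\<in>uball. slash m f \<gamma> z = f z) \<and>
    (\<exists>M. \<forall>z\<in>uball. cmod (f z) * hgt z ^ m \<le> M)}"

definition group_lift :: "nat \<Rightarrow> (complex ^ 'n::finite \<Rightarrow> complex) \<Rightarrow> 'n mtx \<Rightarrow> complex"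
  where "group_lift m f g = f (act g 0) * jfac g 0 ^ (2 * m)"

definition fundamental_set :: "('n::finite) mtx set \<Rightarrow> (complex ^ 'n) set \<Rightarrow> bool"
  where "fundamental_set \<Gamma> F \<longleftrightarrow> F \<in> sets borel \<and> F \<subseteq> uball \<and>
    (AE z in lborel. z \<in> uball \<longrightarrow> (\<exists>!p. p \<in> F \<and> (\<exists>\<gamma>\<in>\<Gamma>. p = act \<gamma> z)))"

text \<open>
  Integration over \<open>\<Gamma> \ B\<close> is with respect to the quotient measure, i.e. the integral of the
  function \<open>\<Sum>\<gamma>\<in>\<Gamma>. \<phi> (\<gamma> z)\<close> over \<open>\<Gamma> \ B\<close> is the integral of \<open>\<phi>\<close> over \<open>B\<close>. A scalar matrix in
  \<open>\<Gamma>\<close> acts trivially on the ball, which gives the factor in front; it is 1 whenever \<open>\<Gamma>\<close> acts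
  effectively.
\<close>

definition pet_inner :: "('n::finite) mtx set \<Rightarrow> (complex ^ 'n) set \<Rightarrow> nat \<Rightarrow>
    (complex ^ 'n \<Rightarrow> complex) \<Rightarrow> (complex ^ 'n \<Rightarrow> complex) \<Rightarrow> complex"
  where "pet_inner \<Gamma> F m f1 f2 =
    (LINT z:F|inv_vol. f1 z * cnj (f2 z) * of_real (hgt z ^ (2 * m)))
      / of_nat (card {\<gamma>\<in>\<Gamma>. \<forall>z\<in>uball. act \<gamma> z = z})"

definition boost :: "'n::finite \<Rightarrow> real \<Rightarrow> 'n mtx"
  where "boost l t = (\<chi> a b.
    if a = b then (if a = None \<or> a = Some l then of_real (cosh t) else 1)
    else if {a, b} = {None, Some l} then of_real (sinh t) else 0)"

definition std_geodesic :: "'n::finite \<Rightarrow> (complex ^ 'n) set"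
  where "std_geodesic l = range (\<lambda>t. act (boost l t) 0)"

text \<open>The matrices in \<open>SUn1\<close> that are block diagonal are exactly those of \<open>S(U(n) \<times> U(1))\<close>.\<close>

definition K_grp :: "('n::finite) mtx set"
  where "K_grp = {g \<in> SUn1. \<forall>i. g $ Some i $ None = 0 \<and> g $ None $ Some i = 0}"

definition W_grp :: "'n::finite \<Rightarrow> 'n mtx set"
  where "W_grp l = {w \<in> K_grp. \<forall>t. w ** boost l t = boost l t ** w}"

text \<open>
  The matrix \<open>diag(u, e^(-i\<psi>), e^(-i\<psi>))\<close>. Only the entries of \<open>u\<close> outside row and column \<open>l\<close>
  matter. For an element of \<open>W_grp l\<close>, unitarity of \<open>u\<close> and \<open>det u = e^(2i\<psi>)\<close> are automatic.
\<close>

definition W_mtx :: "'n::finite \<Rightarrow> complex ^ 'n ^ 'n \<Rightarrow> real \<Rightarrow> 'n mtx"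
  where "W_mtx l u \<psi> = (\<chi> a b.
    if a = b \<and> (a = None \<or> a = Some l) then exp (- \<i> * of_real \<psi>)
    else (case (a, b) of
        (Some i, Some k) \<Rightarrow> if i = l \<or> k = l then 0 else u $ i $ k
      | _ \<Rightarrow> 0))"

definition loxodromic :: "'n::finite \<Rightarrow> 'n mtx \<Rightarrow> bool"
  where "loxodromic l \<gamma> \<longleftrightarrow>
    (\<exists>h\<in>SUn1. \<exists>t. t \<noteq> 0 \<and> (\<exists>w\<in>W_grp l. \<gamma> = h ** (boost l t ** w) ** matrix_inv h))"

definition attracting_fp :: "('n::finite) mtx \<Rightarrow> complex ^ 'n \<Rightarrow> bool"
  where "attracting_fp \<gamma> Y \<longleftrightarrow> norm Y = 1 \<and> act \<gamma> Y = Y \<and>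
    (\<forall>z\<in>uball. (\<lambda>k. (act \<gamma> ^^ k) z) \<longlonglongrightarrow> Y)"

definition repelling_fp :: "('n::finite) mtx \<Rightarrow> complex ^ 'n \<Rightarrow> bool"
  where "repelling_fp \<gamma> X \<longleftrightarrow> attracting_fp (matrix_inv \<gamma>) X"

text \<open>The geodesics joining boundary points are the translates of the standard one.\<close>

definition is_axis :: "'n::finite \<Rightarrow> 'n mtx \<Rightarrow> complex ^ 'n \<Rightarrow> complex ^ 'n \<Rightarrow>
    (complex ^ 'n) set \<Rightarrow> bool"
  where "is_axis l \<gamma> X Y L \<longleftrightarrow> (\<exists>h\<in>SUn1. L = act h ` std_geodesic l) \<and>
    act \<gamma> ` L = L \<and> X \<in> closure L \<and> Y \<in> closure L"

definition Qfun :: "complex ^ 'n::finite \<Rightarrow> complex ^ 'n \<Rightarrow> complex ^ 'n \<Rightarrow> complex"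
  where "Qfun X Y z = herm (emb z) (emb X) * herm (emb z) (emb Y)"

definition qfun :: "nat \<Rightarrow> complex ^ 'n::finite \<Rightarrow> complex ^ 'n \<Rightarrow> complex ^ 'n \<Rightarrow> complex"
  where "qfun m X Y z = Qfun X Y z powi (- int m)"

definition cyclic_SUn1 :: "('n::finite) mtx \<Rightarrow> 'n mtx set"
  where "cyclic_SUn1 \<gamma> = subgroup_SUn1 hull {\<gamma>}"

definition left_quotient :: "('n::finite) mtx set \<Rightarrow> 'n mtx set \<Rightarrow> 'n mtx set set"
  where "left_quotient H \<Gamma> = (\<lambda>\<gamma>. (\<lambda>\<sigma>. \<sigma> ** \<gamma>) ` H) ` \<Gamma>"

text \<open>
  The value does not depend on the chosen representatives if \<open>slash m (qfun m X Y) \<gamma>0\<close> and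
  \<open>qfun m X Y\<close> agree on the ball, and this is the condition for the series to make sense.
\<close>

definition Theta :: "nat \<Rightarrow> ('n::finite) mtx set \<Rightarrow> 'n mtx \<Rightarrow> complex ^ 'n \<Rightarrow> complex ^ 'n \<Rightarrow>
    complex ^ 'n \<Rightarrow> complex"
  where "Theta m \<Gamma> \<gamma>0 X Y z =
    (\<Sum>\<^sub>\<infinity>c\<in>left_quotient (cyclic_SUn1 \<gamma>0) \<Gamma>. slash m (qfun m X Y) (SOME \<gamma>. \<gamma> \<in> c) z)"

text \<open>
  \<open>g\<close> is a base lift of the axis over \<open>z0\<close>, and \<open>s > 0\<close> is the time after which its orbit
  under the flow lies over \<open>\<gamma>0 z0\<close>.
\<close>

definition base_lift :: "'n::finite \<Rightarrow> 'n mtx \<Rightarrow> (complex ^ 'n) set \<Rightarrow> complex ^ 'n \<Rightarrow>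
    'n mtx \<Rightarrow> real \<Rightarrow> bool"
  where "base_lift l \<gamma>0 L z0 g s \<longleftrightarrow> g \<in> SUn1 \<and> z0 \<in> L \<and> act g ` std_geodesic l = L \<and>
    act g 0 = z0 \<and> s > 0 \<and> act g (act (boost l s) 0) = act \<gamma>0 z0"

text \<open>
  All base lifts over \<open>z0\<close> are \<open>g ** w\<close> with \<open>w\<close> in \<open>W_grp l\<close>, and for \<open>w = W_mtx l u \<psi>\<close> one has
  \<open>jfac (g ** w) e = e^(i\<psi>) * jfac g e\<close>, where \<open>e = axis l 1\<close> is the forward endpoint of the
  standard geodesic. So the angle \<open>\<psi>\<close> of a lift only has a meaning relative to a base lift of
  fixed phase; the normalisation makes \<open>jfac g e\<close> positive, up to a \<open>2 * m\<close>-th root of unity.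
\<close>

definition phase_normalised :: "'n::finite \<Rightarrow> nat \<Rightarrow> 'n mtx \<Rightarrow> bool"
  where "phase_normalised l m g \<longleftrightarrow> jfac g (axis l 1) ^ (2 * m) \<in> \<real>\<^sub>\<ge>\<^sub>0"

definition orbit_integral :: "'n::finite \<Rightarrow> nat \<Rightarrow> (complex ^ 'n \<Rightarrow> complex) \<Rightarrow>
    'n mtx \<Rightarrow> real \<Rightarrow> complex"
  where "orbit_integral l m f h s = integral {0..s} (\<lambda>t. group_lift m f (h ** boost l t))"

end

theory Submission
  imports Defs "HOL-Complex_Analysis.Conformal_Mappings"
begin

text \<open>
  Unfolding turns the inner product with \<open>\<Theta>\<close> into the integral of \<open>f (cnj q) (-\<langle>z,z\<rangle>)^(2m)\<close> over a
  fundamental set for the cyclic group of \<open>\<gamma>0\<close>. After transport by \<open>h = g w\<close> the axis is the standard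
  geodesic, \<open>\<gamma>0\<close> becomes \<open>boost l s ** k\<close> with \<open>k\<close> fixing the geodesic pointwise, the fundamental set
  is \<open>1 \<le> |1 + z\<^sub>l| / |1 - z\<^sub>l| < e^(2s)\<close>, and \<open>q\<close> becomes a constant times \<open>(1 - z\<^sub>l^2)^(-m)\<close>. The mean
  value property in the coordinates other than \<open>l\<close> replaces \<open>f | h\<close> by its restriction to the disc
  \<open>(0, \<dots>, 0, \<zeta>)\<close>. Put \<open>\<zeta> = tanh (t + iy)\<close> with \<open>|y| < \<pi>/4\<close>: the integrand becomes \<open>H (t + iy) cos^(2m-2) (2y)\<close>
  with \<open>H\<close> holomorphic and \<open>s\<close>-periodic, so the integral of \<open>H\<close> over a period does not depend on \<open>y\<close> and
  equals the orbit integral at \<open>y = 0\<close>, while the integral over \<open>y\<close> is Wallis' integral.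
\<close>

section \<open>The action of the unitary group of signature (n, 1)\<close>

text \<open>Phases: transport by \<open>h\<close> turns \<open>q\<close> into a multiple of
  \<open>cnj (jm * jp)\<close> to the power \<open>- m\<close>, where \<open>jp\<close> and
  \<open>jm\<close> are the automorphy factors of \<open>h\<close> at the two ends of the geodesic,
  whereas \<open>\<alpha>\<close> is \<open>jm * cnj jp\<close>. The two differ by the phase of
  \<open>jp\<close> alone; the normalisation of \<open>g\<close> fixes it, and this produces the
  exponential factor. Likewise the invariance of \<open>q\<close> under \<open>\<gamma>0\<close>
  makes the \<open>2 * m\<close>-th power of the phase of \<open>k\<close> trivial; otherwise
  \<open>H\<close> would be periodic only up to a factor. Convergence:
  \<open>\<kappa> \<ge> 1\<close> gives m >= n + 1, so 2m - n - 1 >= m, and the cusp form bound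
  makes the windowed integrand bounded on the ball. Unfolding is an identity of measures, which
  carries this integrability over to the sum over \<open>\<Gamma>\<close>. Constant: 4^n comes from
  the volume form, pi^(n-1) (2m-n-1)! / (2m-2)! from integrating out n - 1 coordinates, and (pi/2)
  (2m-2)! / (4^(m-1) ((m-1)!)^2) from Wallis; (2m-2)! cancels.\<close>

lemma sum_UNIV_option: "(\<Sum>k\<in>UNIV. f k) = f None + (\<Sum>i\<in>UNIV. f (Some i))"
  for f :: "'a::finite option \<Rightarrow> 'b::comm_monoid_add"
  by (simp add: UNIV_option_conv sum.reindex)

text \<open>The full unitary group of the form. The reflections that later move points of the ball
  into position lie in it, but need not have determinant 1.\<close>

definition Un1 :: "('n::finite) mtx set"
  where "Un1 = {g. \<forall>z w. herm (g *v z) (g *v w) = herm z w}"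

lemma SUn1_subset_Un1: "SUn1 \<subseteq> Un1"
  by (auto simp: SUn1_def Un1_def)

lemma herm_scale_left: "herm (c *s z) w = c * herm z w"
  by (simp add: herm_def sum_distrib_left algebra_simps)

lemma herm_scale_right: "herm z (c *s w) = cnj c * herm z w"
  by (simp add: herm_def sum_distrib_left algebra_simps)

lemma herm_axis_Some: "herm z (axis (Some i) 1) = z $ Some i"
proof -
  have "(\<Sum>j\<in>UNIV. z $ Some j * cnj (axis (Some i) 1 $ Some j)) = (\<Sum>j\<in>UNIV. if j = i then z $ Some j else 0)"
    by (intro sum.cong) (auto simp: axis_def)
  then show ?thesis by (simp add: herm_def) (simp add: axis_def)
qed

lemma herm_axis_None: "herm z (axis None 1) = - z $ None"
  by (simp add: herm_def axis_def)

lemma herm_nondegenerate: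
  assumes "\<And>w. herm z w = 0"
  shows "z = 0"
proof -
  have "z $ k = 0" for k
    using assms[of "axis k 1"] by (cases k) (auto simp: herm_axis_Some herm_axis_None)
  then show ?thesis by (simp add: vec_eq_iff)
qed

lemma Un1_herm: "g \<in> Un1 \<Longrightarrow> herm (g *v z) (g *v w) = herm z w"
  by (simp add: Un1_def)

lemma Un1_mult_eq_0:
  assumes "g \<in> Un1" "g *v z = 0"
  shows "z = 0"
proof (rule herm_nondegenerate)
  show "herm z w = 0" for w
    using Un1_herm[OF assms(1), of z w] assms(2) by (simp add: herm_def)
qed

lemma Un1_inverse:
  assumes "g \<in> Un1"
  shows "matrix_inv g ** g = mat 1" "g ** matrix_inv g = mat 1"
proof -
  have "inj ((*v) g)"
  proof (rule injI)
    fix x y assume "g *v x = g *v y"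
    then have "g *v (x - y) = 0" by (simp add: matrix_vector_mult_diff_distrib)
    then show "x = y" using Un1_mult_eq_0[OF assms] by fastforce
  qed
  then obtain B where B: "B ** g = mat 1"
    using matrix_left_invertible_injective by blast
  then have "g ** B = mat 1 \<and> B ** g = mat 1"
    by (simp add: matrix_left_right_inverse)
  then have "g ** matrix_inv g = mat 1 \<and> matrix_inv g ** g = mat 1"
    unfolding matrix_inv_def by (rule someI)
  then show "matrix_inv g ** g = mat 1" "g ** matrix_inv g = mat 1" by auto
qed

lemma Un1_mult: "g \<in> Un1 \<Longrightarrow> h \<in> Un1 \<Longrightarrow> g ** h \<in> Un1"
  by (simp add: Un1_def matrix_vector_mul_assoc[symmetric])

lemma Un1_matrix_inv:
  assumes "g \<in> Un1"
  shows "matrix_inv g \<in> Un1"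
proof -
  have *: "g *v (matrix_inv g *v z) = z" for z
    by (simp add: matrix_vector_mul_assoc Un1_inverse[OF assms])
  have "herm (matrix_inv g *v z) (matrix_inv g *v w) = herm z w" for z w
    using Un1_herm[OF assms, of "matrix_inv g *v z" "matrix_inv g *v w"] by (simp only: *)
  then show ?thesis by (simp add: Un1_def)
qed

lemma emb_nth [simp]: "emb z $ None = 1" "emb z $ Some i = z $ i"
  by (simp_all add: emb_def)

lemma norm_vec_square: "(norm z)\<^sup>2 = (\<Sum>i\<in>UNIV. (cmod (z $ i))\<^sup>2)" for z :: "complex ^ 'n::finite"
  by (simp add: norm_vec_def L2_set_def sum_nonneg)

lemma herm_self: "herm v v = of_real ((\<Sum>i\<in>UNIV. (cmod (v $ Some i))\<^sup>2) - (cmod (v $ None))\<^sup>2)"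
  by (simp add: herm_def complex_norm_square[symmetric])

lemma hgt_eq: "hgt z = 1 - (norm z)\<^sup>2"
  by (simp add: hgt_def herm_self norm_vec_square)

lemma hgt_pos: "z \<in> uball \<Longrightarrow> 0 < hgt z"
  by (simp add: hgt_eq power_less_one_iff abs_square_less_1)

lemma hgt_pos_iff: "0 < hgt z \<longleftrightarrow> z \<in> uball"
  by (simp add: hgt_eq abs_square_less_1)

lemma hgt_nonneg: "z \<in> cball 0 1 \<Longrightarrow> 0 \<le> hgt z"
  by (simp add: hgt_eq abs_square_le_1)

lemma herm_emb_self: "herm (emb z) (emb z) = - of_real (hgt z)"
  by (simp add: herm_self hgt_eq norm_vec_square)

text \<open>The form is positive definite on vectors whose \<open>None\<close> coordinate is 0,
  while the image of \<open>emb z\<close> has the value \<open>- hgt z\<close>, which is at most 0;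
  so such an image would vanish. The closed ball is included because the fixed points
  \<open>X\<close> and \<open>Y\<close> lie on its boundary.\<close>

lemma Un1_None_nonzero:
  assumes g: "g \<in> Un1" and z: "z \<in> cball 0 1"
  shows "(g *v emb z) $ None \<noteq> 0"
proof
  let ?v = "g *v emb z"
  assume 0: "?v $ None = 0"
  have "herm ?v ?v = - of_real (hgt z)"
    by (simp add: Un1_herm[OF g] herm_emb_self)
  then have "Re (herm ?v ?v) = - hgt z" by simp
  then have "(\<Sum>i\<in>UNIV. (cmod (?v $ Some i))\<^sup>2) = - hgt z"
    unfolding herm_self 0 by simp
  with hgt_nonneg[OF z] have "(\<Sum>i\<in>UNIV. (cmod (?v $ Some i))\<^sup>2) = 0"
    by (smt (verit) sum_nonneg zero_le_power2)
  then have "?v $ Some i = 0" for i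
    by (simp add: sum_nonneg_eq_0_iff)
  with 0 have "?v = 0" by (simp add: vec_eq_iff split_option_all)
  then have "emb z = 0" using Un1_mult_eq_0[OF g] by blast
  then show False by (metis emb_nth(1) zero_index zero_neq_one)
qed

lemma jfac_nonzero: "g \<in> Un1 \<Longrightarrow> z \<in> cball 0 1 \<Longrightarrow> jfac g z \<noteq> 0"
  using Un1_None_nonzero by (auto simp: jfac_def)

lemma mult_emb:
  assumes "(g *v emb z) $ None \<noteq> 0"
  shows "g *v emb z = inverse (jfac g z) *s emb (act g z)"
  using assms by (auto simp: vec_eq_iff split_option_all jfac_def act_def)

lemma emb_act:
  assumes "g \<in> Un1" "z \<in> cball 0 1"
  shows "emb (act g z) = jfac g z *s (g *v emb z)"
  using Un1_None_nonzero[OF assms] by (auto simp: vec_eq_iff split_option_all jfac_def act_def field_simps)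

lemma herm_act:
  assumes "g \<in> Un1" "z \<in> cball 0 1" "w \<in> cball 0 1"
  shows "herm (emb (act g z)) (emb (act g w)) = jfac g z * cnj (jfac g w) * herm (emb z) (emb w)"
  using assms by (simp add: emb_act herm_scale_left herm_scale_right Un1_herm)

text \<open>Asks only for a nonzero denominator, so that it also applies outside the closed ball: to
  boosts on the cylinder where coordinate \<open>l\<close> lies in the disc, and to the stabilizer
  of the origin on all of C^n.\<close>

lemma hgt_act':
  assumes "g \<in> Un1" "(g *v emb z) $ None \<noteq> 0"
  shows "hgt (act g z) = hgt z * (cmod (jfac g z))\<^sup>2"
proof -
  have j: "jfac g z \<noteq> 0" using assms by (simp add: jfac_def)
  have "herm (emb z) (emb z) = inverse (jfac g z) * cnj (inverse (jfac g z)) * herm (emb (act g z)) (emb (act g z))"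
    using Un1_herm[OF assms(1), of "emb z" "emb z"] unfolding mult_emb[OF assms(2)]
    by (simp add: herm_scale_left herm_scale_right mult_ac)
  then have "complex_of_real (hgt (act g z)) = of_real (hgt z * (cmod (jfac g z))\<^sup>2)"
    using j by (simp add: herm_emb_self complex_norm_square field_simps del: of_real_power)
  then show ?thesis by (simp only: of_real_eq_iff)
qed

lemma hgt_act:
  assumes "g \<in> Un1" "z \<in> cball 0 1"
  shows "hgt (act g z) = hgt z * (cmod (jfac g z))\<^sup>2"
  by (rule hgt_act'[OF assms(1) Un1_None_nonzero[OF assms]])

lemma act_uball: "g \<in> Un1 \<Longrightarrow> z \<in> uball \<Longrightarrow> act g z \<in> uball"
  unfolding hgt_pos_iff[symmetric] by (simp add: hgt_act hgt_pos_iff jfac_nonzero)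

lemma act_cball:
  assumes "g \<in> Un1" "z \<in> cball 0 1"
  shows "act g z \<in> cball 0 1"
proof -
  have "0 \<le> hgt (act g z)" using assms by (simp add: hgt_act hgt_nonneg)
  then show ?thesis by (simp add: hgt_eq abs_square_le_1)
qed

lemma mult_emb_comp:
  assumes "h \<in> Un1" "z \<in> cball 0 1"
  shows "(g ** h) *v emb z = inverse (jfac h z) *s (g *v emb (act h z))"
  using mult_emb[OF Un1_None_nonzero[OF assms]]
  by (metis matrix_vector_mul_assoc vector_scalar_commute)

lemma act_comp:
  assumes "h \<in> Un1" "z \<in> cball 0 1"
  shows "act (g ** h) z = act g (act h z)"
  using jfac_nonzero[OF assms] unfolding act_def[of "g ** h"] act_def[of g]
  by (simp add: mult_emb_comp[OF assms])

lemma jfac_comp: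
  assumes "h \<in> Un1" "z \<in> cball 0 1"
  shows "jfac (g ** h) z = jfac g (act h z) * jfac h z"
  unfolding jfac_def[of "g ** h"] jfac_def[of g]
  by (simp add: mult_emb_comp[OF assms])

lemma act_one [simp]: "act (mat 1) z = z"
  by (simp add: act_def)

lemma jfac_one [simp]: "jfac (mat 1) z = 1"
  by (simp add: jfac_def)

lemma act_inverse:
  assumes "g \<in> Un1" "z \<in> cball 0 1"
  shows "act (matrix_inv g) (act g z) = z" "act g (act (matrix_inv g) z) = z"
  using assms by (metis Un1_inverse(1) act_comp act_one) (metis Un1_inverse(2) Un1_matrix_inv act_comp act_one assms)

lemma slash_comp:
  assumes "h \<in> Un1" "z \<in> cball 0 1"
  shows "slash m f (g ** h) z = slash m (slash m f g) h z"
  by (simp add: slash_def act_comp[OF assms] jfac_comp[OF assms] power_mult_distrib mult.assoc)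

lemma in_uball_cball: "z \<in> uball \<Longrightarrow> z \<in> cball 0 1"
  by simp

section \<open>Boosts and the standard geodesic\<close>

lemma boost_mult:
  "(boost l t *v v) $ None = of_real (cosh t) * v $ None + of_real (sinh t) * v $ Some l"
  "(boost l t *v v) $ Some l = of_real (cosh t) * v $ Some l + of_real (sinh t) * v $ None"
  "i \<noteq> l \<Longrightarrow> (boost l t *v v) $ Some i = v $ Some i"
proof -
  have *: "(\<Sum>j\<in>UNIV. (if j = k then c else 0) * v $ Some j) = c * v $ Some k" for k and c :: complex
    by (simp add: if_distrib[of "\<lambda>x. x * _"] cong: if_cong)
  have "(\<Sum>j\<in>UNIV. boost l t $ None $ Some j * v $ Some j) = (\<Sum>j\<in>UNIV. (if j = l then of_real (sinh t) else 0) * v $ Some j)"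
    by (intro sum.cong) (auto simp: boost_def doubleton_eq_iff)
  then show "(boost l t *v v) $ None = of_real (cosh t) * v $ None + of_real (sinh t) * v $ Some l"
    by (simp add: matrix_vector_mult_def sum_UNIV_option *) (simp add: boost_def)
  have "(\<Sum>j\<in>UNIV. boost l t $ Some l $ Some j * v $ Some j) = (\<Sum>j\<in>UNIV. (if j = l then of_real (cosh t) else 0) * v $ Some j)"
    by (intro sum.cong) (auto simp: boost_def doubleton_eq_iff)
  then show "(boost l t *v v) $ Some l = of_real (cosh t) * v $ Some l + of_real (sinh t) * v $ None"
    by (simp add: matrix_vector_mult_def sum_UNIV_option *) (simp add: boost_def insert_commute)
  assume i: "i \<noteq> l"
  then have "(\<Sum>j\<in>UNIV. boost l t $ Some i $ Some j * v $ Some j) = (\<Sum>j\<in>UNIV. (if j = i then 1 else 0) * v $ Some j)"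
    by (intro sum.cong) (auto simp: boost_def doubleton_eq_iff)
  with i show "(boost l t *v v) $ Some i = v $ Some i"
    by (simp add: matrix_vector_mult_def sum_UNIV_option *) (simp add: boost_def doubleton_eq_iff)
qed

lemma boost_Un1: "boost l t \<in> Un1" for l :: "'n::finite"
proof -
  have "herm (boost l t *v z) (boost l t *v w) = herm z w" for z w :: "complex ^ ('n option)"
  proof -
    let ?c = "complex_of_real (cosh t)" and ?s = "complex_of_real (sinh t)"
    have cs: "?c * ?c = 1 + ?s * ?s"
      using cosh_square_eq[of t] by (metis add.commute of_real_1 of_real_add of_real_mult power2_eq_square)
    have split: "(\<Sum>i\<in>UNIV. f i) = f l + (\<Sum>i\<in>UNIV - {l}. f i)" for f :: "'n \<Rightarrow> complex"
      by (simp add: sum.remove)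
    have "(\<Sum>i\<in>UNIV - {l}. (boost l t *v z) $ Some i * cnj ((boost l t *v w) $ Some i))
        = (\<Sum>i\<in>UNIV - {l}. z $ Some i * cnj (w $ Some i))"
      by (intro sum.cong) (auto simp: boost_mult)
    moreover have key: "(?c * b + ?s * a) * (?c * B + ?s * A) - (?c * a + ?s * b) * (?c * A + ?s * B) = b * B - a * A" for a b A B
      using cs by algebra
    ultimately show ?thesis
      unfolding herm_def split[of "\<lambda>i. _ $ Some i * _ i"] boost_mult
      using key[of "z $ Some l" "z $ None" "cnj (w $ Some l)" "cnj (w $ None)"]
      by (simp add: algebra_simps)
  qed
  then show ?thesis by (simp add: Un1_def)
qed

lemma boost_add: "boost l a ** boost l b = boost l (a + b)" for l :: "'n::finite"
proof -
  have "(boost l a ** boost l b) *v v = boost l (a + b) *v v" for v :: "complex ^ ('n option)"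
  proof -
    have "((boost l a ** boost l b) *v v) $ Some i = (boost l (a + b) *v v) $ Some i" for i
      by (cases "i = l") (simp_all add: matrix_vector_mul_assoc[symmetric] boost_mult cosh_add sinh_add algebra_simps)
    moreover have "((boost l a ** boost l b) *v v) $ None = (boost l (a + b) *v v) $ None"
      by (simp add: matrix_vector_mul_assoc[symmetric] boost_mult cosh_add sinh_add algebra_simps)
    ultimately show ?thesis by (simp add: vec_eq_iff split_option_all)
  qed
  then show ?thesis by (simp add: matrix_eq)
qed

lemma boost_0: "boost l 0 = mat 1"
  by (auto simp: boost_def mat_def vec_eq_iff)

lemma act_boost:
  "act (boost l t) z $ l = (of_real (cosh t) * z $ l + of_real (sinh t)) / (of_real (cosh t) + of_real (sinh t) * z $ l)"
  "i \<noteq> l \<Longrightarrow> act (boost l t) z $ i = z $ i / (of_real (cosh t) + of_real (sinh t) * z $ l)"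
  by (simp_all add: act_def boost_mult)

lemma jfac_boost: "jfac (boost l t) z = inverse (of_real (cosh t) + of_real (sinh t) * z $ l)"
  by (simp add: jfac_def boost_mult)

lemma act_boost_0: "act (boost l t) 0 = axis l (of_real (tanh t))"
proof -
  have "act (boost l t) 0 $ i = axis l (of_real (tanh t)) $ i" for i
    by (cases "i = l") (auto simp: act_boost axis_def tanh_def)
  then show ?thesis by (simp add: vec_eq_iff)
qed

lemma std_geodesic_eq: "std_geodesic l = range (\<lambda>t. axis l (of_real (tanh t)))"
  by (simp add: std_geodesic_def act_boost_0)

section \<open>The stabilizer of the origin and transitivity on the ball\<close>

lemma mult_axis_nth: "(g *v axis j 1) $ i = g $ i $ j" for g :: "complex ^ 'a::finite ^ 'b::finite"
  by (simp add: matrix_vector_mult_def axis_def if_distrib[of "\<lambda>x. _ * x"] cong: if_cong)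

lemma emb_0: "emb 0 = axis None 1"
  by (simp add: vec_eq_iff split_option_all axis_def)

text \<open>Fixing the origin makes the \<open>None\<close> column a multiple of the basis vector
  \<open>axis None 1\<close>. Orthogonality of the other columns to it clears the
  \<open>None\<close> row, and preservation of its norm makes the corner entry unimodular.\<close>

lemma stabilizer_entries:
  fixes k :: "('n::finite) mtx"
  assumes k: "k \<in> Un1" and 0: "act k 0 = 0"
  shows "k $ Some i $ None = 0" "k $ None $ Some i = 0" "cmod (k $ None $ None) = 1"
proof -
  let ?d = "k $ None $ None"
  have d: "?d \<noteq> 0"
    using Un1_None_nonzero[OF k, of 0] by (simp add: emb_0 mult_axis_nth)
  have S: "k $ Some j $ None = 0" for j
  proof -
    have "act k 0 $ j = k $ Some j $ None / ?d" by (simp add: act_def emb_0 mult_axis_nth)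
    with 0 d show ?thesis by simp
  qed
  show "k $ Some i $ None = 0" by (rule S)
  have c: "k *v axis None 1 = ?d *s axis None 1"
    using S by (simp add: vec_eq_iff mult_axis_nth split_option_all) (simp add: axis_def)
  have "herm (k *v axis (Some i) 1) (k *v axis None 1) = herm (axis (Some i) 1) (axis None 1)"
    by (rule Un1_herm[OF k])
  with d show "k $ None $ Some i = 0"
    unfolding c by (simp add: herm_scale_right herm_axis_None mult_axis_nth) (simp add: axis_def)
  have N: "herm (axis None 1) (axis None 1 :: complex ^ ('n option)) = - 1"
    by (simp add: herm_axis_None)
  have "herm (k *v axis None 1) (k *v axis None 1) = - 1"
    using Un1_herm[OF k] N by simp
  then have "of_real ((cmod ?d)\<^sup>2) = (1::complex)"
    unfolding c herm_scale_left herm_scale_right N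
    by (simp add: complex_norm_square mult.commute del: of_real_power)
  then have "(cmod ?d)\<^sup>2 = 1" by (metis of_real_eq_1_iff)
  then show "cmod ?d = 1" by (simp add: abs_square_eq_1)
qed

lemma stabilizer_mult:
  assumes "k \<in> Un1" "act k 0 = 0"
  shows "(k *v v) $ None = k $ None $ None * v $ None"
    "(k *v v) $ Some i = (\<Sum>j\<in>UNIV. k $ Some i $ Some j * v $ Some j)"
  using stabilizer_entries[OF assms] by (simp_all add: matrix_vector_mult_def sum_UNIV_option)

lemma stabilizer_linear:
  assumes "k \<in> Un1" "act k 0 = 0"
  shows "linear (act k)"
proof (rule linearI)
  show "act k (x + y) = act k x + act k y" for x y
    by (simp add: vec_eq_iff act_def stabilizer_mult[OF assms] algebra_simps sum.distrib add_divide_distrib)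
  show "act k (r *\<^sub>R x) = r *\<^sub>R act k x" for r x
    by (simp add: vec_eq_iff act_def stabilizer_mult[OF assms] scaleR_conv_of_real[where 'a = complex] sum_distrib_left
        sum_divide_distrib mult_ac)
qed

lemma stabilizer_norm:
  assumes "k \<in> Un1" "act k 0 = 0"
  shows "norm (act k z) = norm z"
proof -
  have "(k *v emb z) $ None \<noteq> 0" "cmod (jfac k z) = 1"
    using stabilizer_entries(3)[OF assms] by (auto simp: stabilizer_mult[OF assms] jfac_def norm_inverse)
  from hgt_act'[OF assms(1) this(1)] this(2) have "(norm (act k z))\<^sup>2 = (norm z)\<^sup>2"
    by (simp add: hgt_eq)
  then show ?thesis by (simp add: power2_eq_iff_nonneg)
qed

text \<open>If the endpoint \<open>axis l 1\<close> is fixed as well, column \<open>l\<close> is the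
  corner entry times a basis vector, and unitarity clears row \<open>l\<close> too. Hence the action
  leaves coordinate \<open>l\<close> alone, and the whole complex line through the geodesic is fixed
  pointwise.\<close>

lemma stabilizer_axis:
  assumes k: "k \<in> Un1" "act k 0 = 0" and e: "act k (axis l 1) = axis l 1"
  shows "act k z $ l = z $ l" "jfac k z = inverse (k $ None $ None)" "act k (axis l x) = axis l x"
proof -
  let ?d = "k $ None $ None"
  have d: "?d \<noteq> 0" using stabilizer_entries(3)[OF k] by auto
  have c: "k $ Some i $ Some l = (if i = l then ?d else 0)" for i
  proof -
    have "(\<Sum>j\<in>UNIV. k $ Some i $ Some j * axis l 1 $ j) = k $ Some i $ Some l"
      by (simp add: axis_def if_distrib[of "\<lambda>x. _ * x"] cong: if_cong)
    then have "act k (axis l 1) $ i = k $ Some i $ Some l / ?d"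
      by (simp add: act_def stabilizer_mult[OF k])
    with e d show ?thesis by (auto simp: axis_def field_simps split: if_splits)
  qed
  have cl: "k *v axis (Some l) 1 = ?d *s axis (Some l) 1"
    using c stabilizer_entries[OF k] by (simp add: vec_eq_iff mult_axis_nth split_option_all) (simp add: axis_def)
  have r: "k $ Some l $ Some j = (if j = l then ?d else 0)" for j
  proof (cases "j = l")
    case False
    have "herm (k *v axis (Some j) 1) (k *v axis (Some l) 1) = herm (axis (Some j) 1) (axis (Some l) 1)"
      by (rule Un1_herm[OF k(1)])
    with d False show ?thesis
      unfolding cl by (simp add: herm_scale_right herm_axis_Some mult_axis_nth) (simp add: axis_def)
  qed (simp add: c)
  show "jfac k z = inverse ?d" by (simp add: jfac_def stabilizer_mult[OF k])
  have "(\<Sum>j\<in>UNIV. k $ Some l $ Some j * emb z $ Some j) = ?d * z $ l"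
    by (simp add: r if_distrib[of "\<lambda>x. x * _"] cong: if_cong)
  then show "act k z $ l = z $ l"
    using d by (simp add: act_def stabilizer_mult[OF k])
  show "act k (axis l x) = axis l x"
  proof -
    have "(\<Sum>j\<in>UNIV. k $ Some i $ Some j * axis l x $ j) = k $ Some i $ Some l * x" for i
      by (simp add: axis_def if_distrib[of "\<lambda>x. _ * x"] cong: if_cong)
    then have "act k (axis l x) $ i = axis l x $ i" for i
      using c d by (simp add: act_def stabilizer_mult[OF k]) (simp add: axis_def)
    then show ?thesis by (simp add: vec_eq_iff)
  qed
qed

text \<open>A complex reflection of \<open>C^n\<close>, composed with a phase in the negative direction.\<close>

definition reflection_mtx :: "complex ^ 'n::finite \<Rightarrow> complex \<Rightarrow> 'n mtx"
  where "reflection_mtx v \<mu> = (\<chi> a b. case (a, b) of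
      (Some i, Some j) \<Rightarrow> (if i = j then 1 else 0) - 2 * v $ i * cnj (v $ j) / of_real ((norm v)\<^sup>2)
    | (None, None) \<Rightarrow> \<mu> | _ \<Rightarrow> 0)"

lemma reflection_mult:
  "(reflection_mtx v \<mu> *v y) $ None = \<mu> * y $ None"
  "(reflection_mtx v \<mu> *v y) $ Some i =
     y $ Some i - 2 * ((\<Sum>j\<in>UNIV. y $ Some j * cnj (v $ j)) / of_real ((norm v)\<^sup>2)) * v $ i"
  by (simp_all add: matrix_vector_mult_def sum_UNIV_option reflection_mtx_def algebra_simps sum_subtractf
      if_distrib[of "\<lambda>x. _ * x"] sum_distrib_left sum_divide_distrib cong: if_cong)

lemma reflection_Un1:
  fixes v :: "complex ^ 'n::finite"
  assumes "cmod \<mu> = 1"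
  shows "reflection_mtx v \<mu> \<in> Un1"
proof -
  let ?N = "complex_of_real ((norm v)\<^sup>2)"
  define P where "P y = (\<Sum>j\<in>UNIV. y $ Some j * cnj (v $ j))" for y :: "complex ^ ('n option)"
  have N: "(\<Sum>j\<in>UNIV. v $ j * cnj (v $ j)) = ?N"
    by (simp add: norm_vec_square complex_norm_square del: of_real_power)
  have mu: "\<mu> * cnj \<mu> = 1"
    using assms by (metis complex_norm_square of_real_1 one_power2)
  have "herm (reflection_mtx v \<mu> *v y) (reflection_mtx v \<mu> *v w) = herm y w" for y w :: "complex ^ ('n option)"
  proof -
    define a b where "a = P y / ?N" and "b = P w / ?N"
    have "(\<Sum>i\<in>UNIV. (y $ Some i - 2 * a * v $ i) * cnj (w $ Some i - 2 * b * v $ i))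
        = (\<Sum>i\<in>UNIV. y $ Some i * cnj (w $ Some i)) - 2 * cnj b * P y - 2 * a * cnj (P w) + 4 * a * cnj b * ?N"
      unfolding N[symmetric] P_def
      by (simp add: algebra_simps sum.distrib sum_subtractf sum_distrib_left)
    \<comment> \<open>For \<open>v = 0\<close> division by zero gives \<open>a = b = 0\<close>, and
      the matrix is just a phase in the negative direction.\<close>
    moreover have "- 2 * cnj b * P y - 2 * a * cnj (P w) + 4 * a * cnj b * ?N = 0"
      by (cases "v = 0") (simp_all add: a_def b_def field_simps)
    ultimately have "(\<Sum>i\<in>UNIV. (y $ Some i - 2 * a * v $ i) * cnj (w $ Some i - 2 * b * v $ i))
        = (\<Sum>i\<in>UNIV. y $ Some i * cnj (w $ Some i))" by (simp add: algebra_simps)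
    moreover have "\<mu> * y $ None * cnj (\<mu> * w $ None) = y $ None * cnj (w $ None)"
      using mu by (simp add: algebra_simps)
    ultimately show ?thesis
      unfolding herm_def reflection_mult a_def b_def P_def by (simp only:)
  qed
  then show ?thesis by (simp add: Un1_def)
qed

lemma tanh_artanh_real: "tanh (artanh x) = x" if "\<bar>x\<bar> < 1" for x :: real
proof -
  define e where "e = exp (- (2 * artanh x))"
  have e: "e = (1 - x) / (1 + x)"
    using that by (simp add: artanh_def exp_minus e_def)
  have "tanh (artanh x) = (1 - e) / (1 + e)"
    by (simp add: e_def tanh_real_altdef)
  moreover have "1 - e = 2 * x / (1 + x)" "1 + e = 2 / (1 + x)"
    using that by (simp_all add: e field_simps)
  ultimately show ?thesis using that by simp
qed

text \<open>Choose a phase \<open>\<mu>\<close> that makes coordinate \<open>l\<close> of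
  \<open>p\<close> real and nonnegative. Then \<open>\<mu> *s p\<close> and the point
  \<open>y\<close> of the geodesic at the same distance from the origin have equal norm and a real
  product, so the reflection in their difference carries \<open>y\<close> to
  \<open>\<mu> *s p\<close>. Putting \<open>\<mu>\<close> into the \<open>None\<close> direction as
  well divides it out again in the action.\<close>

lemma polar_decomposition_point:
  fixes p :: "complex ^ 'n::finite"
  assumes p: "p \<in> uball"
  shows "\<exists>k t. k \<in> Un1 \<and> act k 0 = 0 \<and> act k (act (boost l t) 0) = p"
proof -
  define r where "r = norm p"
  have "\<bar>r\<bar> < 1" using p by (simp add: r_def)
  then have t: "tanh (artanh r) = r" by (rule tanh_artanh_real)
  define \<mu> where "\<mu> = (if p $ l = 0 then 1 else cnj (p $ l) / of_real (cmod (p $ l)))"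
  have mu: "cmod \<mu> = 1" by (simp add: \<mu>_def norm_divide)
  have pl: "\<mu> * p $ l = of_real (cmod (p $ l))"
    by (cases "p $ l = 0")
      (simp_all add: \<mu>_def mult.commute[of "cnj _"] complex_norm_square[symmetric] power2_eq_square)
  define y where "y = (axis l (of_real r) :: complex ^ 'n)"
  define v where "v = \<mu> *s p - y"
  define k where "k = reflection_mtx v \<mu>"
  have k: "k \<in> Un1" unfolding k_def by (rule reflection_Un1[OF mu])
  have k0: "act k 0 = 0"
    by (simp add: vec_eq_iff act_def k_def reflection_mult)
  have P: "(\<Sum>j\<in>UNIV. y $ j * cnj (v $ j)) = of_real (r * (cmod (p $ l) - r))"
  proof -
    have "(\<Sum>j\<in>UNIV. y $ j * cnj (v $ j)) = (\<Sum>j\<in>UNIV. if j = l then of_real r * cnj (v $ l) else 0)"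
      by (intro sum.cong) (auto simp: y_def axis_def)
    also have "\<dots> = of_real r * cnj (v $ l)" by simp
    finally show ?thesis by (simp add: v_def y_def pl)
  qed
  have N: "(norm v)\<^sup>2 = 2 * r * (r - cmod (p $ l))"
  proof -
    have s: "(\<Sum>i\<in>UNIV. f i) = f l + (\<Sum>i\<in>UNIV - {l}. f i)" for f :: "'n \<Rightarrow> real"
      by (simp add: sum.remove)
    have "(\<Sum>i\<in>UNIV - {l}. (cmod (v $ i))\<^sup>2) = (\<Sum>i\<in>UNIV - {l}. (cmod (p $ i))\<^sup>2)"
      by (intro sum.cong) (auto simp: v_def y_def axis_def norm_mult mu)
    also have "\<dots> = r\<^sup>2 - (cmod (p $ l))\<^sup>2"
      using norm_vec_square[of p] s[of "\<lambda>i. (cmod (p $ i))\<^sup>2"] by (simp add: r_def)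
    finally have "(norm v)\<^sup>2 = (cmod (v $ l))\<^sup>2 + (r\<^sup>2 - (cmod (p $ l))\<^sup>2)"
      using s[of "\<lambda>i. (cmod (v $ i))\<^sup>2"] norm_vec_square[of v] by simp
    moreover have "v $ l = of_real (cmod (p $ l) - r)" by (simp add: v_def y_def pl)
    then have "(cmod (v $ l))\<^sup>2 = (cmod (p $ l) - r)\<^sup>2"
      by (metis norm_of_real power2_abs)
    ultimately show ?thesis by (simp add: power2_eq_square algebra_simps)
  qed
  have "act k y $ i = p $ i" for i
  proof -
    have "(k *v emb y) $ Some i = \<mu> * p $ i"
    proof (cases "v = 0")
      case True
      then show ?thesis by (simp add: k_def reflection_mult) (metis True eq_iff_diff_eq_0 v_def vector_smult_component)
    next
      case False
      then have "2 * r * (r - cmod (p $ l)) \<noteq> 0" using N by auto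
      \<comment> \<open>With this quotient equal to \<open>- 1/2\<close> the reflection adds exactly
        \<open>v\<close> to \<open>y\<close>.\<close>
      then have "(r * (cmod (p $ l) - r)) / (norm v)\<^sup>2 = - 1/2" unfolding N by (simp add: field_simps)
      then have "(\<Sum>j\<in>UNIV. y $ j * cnj (v $ j)) / of_real ((norm v)\<^sup>2) = - 1/2"
        unfolding P of_real_divide[symmetric] by simp
      then show ?thesis by (simp add: k_def reflection_mult del: of_real_power) (simp add: v_def)
    qed
    moreover have "(k *v emb y) $ None = \<mu>" "\<mu> \<noteq> 0" using mu by (auto simp: k_def reflection_mult)
    ultimately show ?thesis by (simp add: act_def)
  qed
  then have "act k (act (boost l (artanh r)) 0) = p"
    by (simp add: act_boost_0 t y_def vec_eq_iff)
  with k k0 show ?thesis by blast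
qed

section \<open>Lebesgue measure under isometries and holomorphic maps\<close>

lemma nn_integral_lborel_translate:
  fixes a :: "'a::euclidean_space"
  assumes [measurable]: "f \<in> borel_measurable borel"
  shows "(\<integral>\<^sup>+x. f (a + x) \<partial>lborel) = (\<integral>\<^sup>+x. f x \<partial>lborel)"
proof -
  have "(\<integral>\<^sup>+x. f x \<partial>lborel) = (\<integral>\<^sup>+x. f x \<partial>distr lborel borel ((+) a))"
    by (simp add: lborel_distr_plus)
  also have "\<dots> = (\<integral>\<^sup>+x. f (a + x) \<partial>lborel)"
    by (rule nn_integral_distr) auto
  finally show ?thesis ..
qed

lemma nn_integral_lborel_reflect:
  fixes a :: "'a::euclidean_space"
  assumes [measurable]: "f \<in> borel_measurable borel"
  shows "(\<integral>\<^sup>+x. f (a - x) \<partial>lborel) = (\<integral>\<^sup>+x. f x \<partial>lborel)"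
proof -
  have "(\<integral>\<^sup>+x. f x \<partial>lborel) = (\<integral>\<^sup>+x. f x \<partial>density (distr lborel borel (\<lambda>x. a + (- 1) *\<^sub>R x)) (\<lambda>_. 1))"
    using lborel_affine[of "- 1" a] by simp
  also have "\<dots> = (\<integral>\<^sup>+x. f (a - x) \<partial>lborel)"
    by (simp add: density_1 nn_integral_distr)
  finally show ?thesis ..
qed

text \<open>
  Both sides of the Fubini identity below count the pairs \<open>(x, y)\<close> with \<open>T x \<in> A\<close> and \<open>y\<close> in the unit
  ball; the shear \<open>x \<mapsto> x + T^(-1) y\<close>, \<open>y \<mapsto> y - T x\<close> exchanges the two factors.
\<close>

lemma distr_lborel_isometry:
  fixes T :: "'a::euclidean_space \<Rightarrow> 'b::euclidean_space"
  assumes lin: "linear T" and iso: "\<And>x. norm (T x) = norm x" and surj: "surj T"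
  shows "distr lborel borel T = lborel"
proof (rule measure_eqI)
  show "sets (distr lborel borel T) = sets lborel" by simp
  have cont: "continuous_on UNIV T" using lin by (simp add: linear_continuous_on linear_linear)
  have [measurable]: "T \<in> borel \<rightarrow>\<^sub>M borel" using cont by (rule borel_measurable_continuous_onI)
  have inj: "inj T" using lin iso by (metis linear_injective_0 norm_eq_zero)
  have dim: "DIM('a) = DIM('b)"
    using dim_image_eq[of T UNIV] lin inj surj by (simp add: inj_on_subset)
  fix A assume "A \<in> sets (distr lborel borel T)"
  then have [measurable]: "A \<in> sets borel" by simp
  let ?B = "ball 0 1 :: 'b set"
  define I where "I A x = (indicator A x :: ennreal)" for A and x :: 'b
  have [measurable]: "I A \<in> borel_measurable borel" "I ?B \<in> borel_measurable borel"
    by (auto simp: I_def[abs_def] intro!: borel_measurable_indicator)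
  have "emeasure (distr lborel borel T) A = (\<integral>\<^sup>+x. I A x \<partial>distr lborel borel T)"
    by (simp add: I_def)
  also have "\<dots> = (\<integral>\<^sup>+x. I A (T x) \<partial>lborel)"
    by (simp add: nn_integral_distr)
  finally have "emeasure lborel ?B * emeasure (distr lborel borel T) A = (\<integral>\<^sup>+y. I ?B y * (\<integral>\<^sup>+x. I A (T x) \<partial>lborel) \<partial>lborel)"
    by (subst nn_integral_multc) (auto simp: I_def[abs_def] intro!: borel_measurable_indicator)
  also have "\<dots> = (\<integral>\<^sup>+y. (\<integral>\<^sup>+x. I ?B y * I A (T x + y) \<partial>lborel) \<partial>lborel)"
  proof (rule nn_integral_cong)
    fix y
    obtain a where a: "y = T a" using surj by blast
    have "(\<integral>\<^sup>+x. I A (T x) \<partial>lborel) = (\<integral>\<^sup>+x. I A (T (a + x)) \<partial>lborel)"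
      by (rule nn_integral_lborel_translate[symmetric]) measurable
    then show "I ?B y * (\<integral>\<^sup>+x. I A (T x) \<partial>lborel) = (\<integral>\<^sup>+x. I ?B y * I A (T x + y) \<partial>lborel)"
      by (simp add: nn_integral_cmult a linear_add[OF lin] add.commute)
  qed
  also have "\<dots> = (\<integral>\<^sup>+x. (\<integral>\<^sup>+y. I ?B y * I A (T x + y) \<partial>lborel) \<partial>lborel)"
    by (rule lborel_pair.Fubini') measurable
  also have "\<dots> = (\<integral>\<^sup>+x. (\<integral>\<^sup>+y. I ?B (y - T x) * I A y \<partial>lborel) \<partial>lborel)"
  proof (rule nn_integral_cong)
    fix x
    show "(\<integral>\<^sup>+y. I ?B y * I A (T x + y) \<partial>lborel) = (\<integral>\<^sup>+y. I ?B (y - T x) * I A y \<partial>lborel)"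
      using nn_integral_lborel_translate[of "\<lambda>y. I ?B (y - T x) * I A y" "T x"] by simp
  qed
  also have "\<dots> = (\<integral>\<^sup>+y. (\<integral>\<^sup>+x. I ?B (y - T x) * I A y \<partial>lborel) \<partial>lborel)"
    by (rule lborel_pair.Fubini'[symmetric]) measurable
  also have "\<dots> = (\<integral>\<^sup>+y. emeasure lborel ?B * I A y \<partial>lborel)"
  proof (rule nn_integral_cong)
    fix y
    obtain a where a: "y = T a" using surj by blast
    have "(\<integral>\<^sup>+x. I ?B (T (a - x)) \<partial>lborel) = (\<integral>\<^sup>+x. I ?B (T x) \<partial>lborel)"
      by (rule nn_integral_lborel_reflect) measurable
    also have "\<dots> = (\<integral>\<^sup>+x. indicator (ball 0 1 :: 'a set) x \<partial>lborel)"
      by (intro nn_integral_cong) (simp add: I_def iso indicator_def)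
    also have "\<dots> = emeasure lborel ?B"
      using emeasure_ball[of 1 "0::'a"] emeasure_ball[of 1 "0::'b"] dim by simp
    finally show "(\<integral>\<^sup>+x. I ?B (y - T x) * I A y \<partial>lborel) = emeasure lborel ?B * I A y"
      by (simp add: nn_integral_multc a linear_diff[OF lin])
  qed
  also have "\<dots> = emeasure lborel ?B * emeasure lborel A"
    by (simp add: nn_integral_cmult I_def)
  finally have "emeasure lborel ?B * emeasure (distr lborel borel T) A = emeasure lborel ?B * emeasure lborel A" .
  moreover have "emeasure lborel ?B \<noteq> 0" "emeasure lborel ?B \<noteq> \<infinity>"
    using emeasure_ball[of 1 "0::'b"] unit_ball_vol_pos[of "real DIM('b)"] by (simp_all add: less_le)
  ultimately show "emeasure (distr lborel borel T) A = emeasure lborel A"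
    by (simp add: ennreal_mult_cancel_left)
qed

lemma distr_lborel_Complex: "distr lborel borel (\<lambda>(x, y). Complex x y) = lborel"
proof (rule distr_lborel_isometry)
  show "linear (\<lambda>(x, y). Complex x y)"
    by (rule linearI) (auto simp: complex_eq_iff)
  show "norm (case p of (x, y) \<Rightarrow> Complex x y) = norm p" for p
    by (cases p) (simp add: complex_norm norm_Pair)
  show "surj (\<lambda>(x, y). Complex x y)"
    by (rule surjI[where f = "\<lambda>z. (Re z, Im z)"]) simp
qed

text \<open>Real change of variables on \<open>real ^ 2\<close>, transported by the isometry
  \<open>U\<close>. The differential of \<open>f\<close> is multiplication by \<open>f' x\<close>, a
  similarity of determinant \<open>(cmod (f' x))\<^sup>2\<close>. Boundedness of \<open>A\<close>
  keeps the measure of the image finite, as the passage from the gauge integral to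
  \<open>emeasure\<close> requires.\<close>

lemma emeasure_holomorphic_image:
  assumes S: "open S" and der: "\<And>x. x \<in> S \<Longrightarrow> (f has_field_derivative f' x) (at x)"
    and inj: "inj_on f S" and A: "A \<in> sets borel" "bounded A"
  shows "emeasure lborel (A \<inter> f ` S) = (\<integral>\<^sup>+x. ennreal ((cmod (f' x))\<^sup>2) * indicator {x\<in>S. f x \<in> A} x \<partial>lborel)"
proof -
  define U where "U v = Complex (v $ 1) (v $ 2)" for v :: "real ^ 2"
  define T where "T z = (vector [Re z, Im z] :: real ^ 2)" for z
  have UT [simp]: "U (T z) = z" "T (U v) = v" for z v
    by (simp_all add: U_def T_def vec_eq_iff forall_2)
  have linU: "linear U" by (rule linearI) (auto simp: U_def complex_eq_iff)
  have linT: "linear T" by (rule linearI) (auto simp: T_def vec_eq_iff forall_2)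
  have dU: "distr lborel borel U = lborel"
    by (rule distr_lborel_isometry[OF linU])
      (simp_all add: U_def[abs_def] complex_norm norm_vec_def L2_set_def sum_2 surjI[of _ T] T_def)
  have contU: "continuous_on X U" for X using linU by (simp add: linear_continuous_on linear_linear)
  have contT: "continuous_on X T" for X using linT by (simp add: linear_continuous_on linear_linear)
  have [measurable]: "U \<in> borel \<rightarrow>\<^sub>M borel" using contU by (rule borel_measurable_continuous_onI)
  have contf: "continuous_on S f"
    using der by (meson DERIV_isCont continuous_at_imp_continuous_on)
  have hol: "f holomorphic_on S"
    using der S by (simp add: holomorphic_on_open) blast
  have opf: "open (f ` S)" by (rule open_mapping_thm3[OF hol S inj])
  define SA where "SA = {x\<in>S. f x \<in> A}"
  have SA: "SA \<in> sets borel"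
  proof -
    have "f -` A \<inter> S \<in> sets (restrict_space borel S)"
      using measurable_sets[OF borel_measurable_continuous_on_restrict[OF contf] A(1)] S
      by (simp add: space_restrict_space)
    then show ?thesis using S by (simp add: sets_restrict_space_iff SA_def vimage_def Int_def conj_commute)
  qed
  define g where "g v = T (f (U v))" for v
  define g' where "g' v = (\<lambda>d. T (f' (U v) * U d))" for v
  have Uinv: "U -` SA \<in> sets borel" using SA measurable_sets[of U borel borel SA] by simp
  have derg: "(g has_derivative g' v) (at v within U -` SA)" if "v \<in> U -` SA" for v
  proof -
    have "(f has_derivative (\<lambda>d. f' (U v) * d)) (at (U v))"
      using der[of "U v"] that by (simp add: has_field_derivative_def SA_def)
    then have "(f \<circ> U has_derivative (\<lambda>d. f' (U v) * d) \<circ> U) (at v within U -` SA)"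
      using linU by (intro diff_chain_within) (auto intro: linear_imp_has_derivative has_derivative_at_withinI)
    from diff_chain_within[OF this linear_imp_has_derivative[OF linT]]
    show ?thesis by (simp add: g_def[abs_def] g'_def o_def)
  qed
  have injg: "inj_on g (U -` SA)"
  proof (rule inj_onI)
    fix v w assume "v \<in> U -` SA" "w \<in> U -` SA" "g v = g w"
    then have "f (U v) = f (U w)" unfolding g_def by (metis UT(1))
    with \<open>v \<in> _\<close> \<open>w \<in> _\<close> inj have "U v = U w" by (auto simp: SA_def inj_on_def)
    then show "v = w" by (metis UT(2))
  qed
  have det: "\<bar>det (matrix (g' v))\<bar> = (cmod (f' (U v)))\<^sup>2" for v
    unfolding cmod_power2 by (simp add: det_2 matrix_def g'_def T_def U_def axis_def power2_eq_square)
  have im: "g ` (U -` SA) = U -` (A \<inter> f ` S)"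
  proof (intro set_eqI iffI)
    fix v assume "v \<in> U -` (A \<inter> f ` S)"
    then obtain x where x: "x \<in> S" "U v = f x" "f x \<in> A" by auto
    then have "v = g (T x)" by (simp add: g_def) (metis UT(2))
    moreover have "T x \<in> U -` SA" using x by (simp add: SA_def)
    ultimately show "v \<in> g ` (U -` SA)" by blast
  qed (auto simp: g_def SA_def)
  have meas: "A \<inter> f ` S \<in> sets borel" using A opf by auto
  have em: "emeasure lborel (U -` X) = emeasure lborel X" if "X \<in> sets borel" for X
    using that emeasure_distr[of U lborel borel X] dU by simp
  have fin: "emeasure lborel (A \<inter> f ` S) < \<infinity>"
    using emeasure_bounded_finite[of "A \<inter> f ` S"] A(2) by (auto intro: bounded_subset)
  have "U -` (A \<inter> f ` S) \<in> sets borel"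
    using measurable_sets[of U borel borel "A \<inter> f ` S"] meas by (simp del: vimage_Int)
  then have lm: "U -` (A \<inter> f ` S) \<in> lmeasurable"
    using fin em[OF meas] by (auto intro!: fmeasurableI)
  have "((\<lambda>v. \<bar>det (matrix (g' v))\<bar>) has_integral measure lebesgue (U -` (A \<inter> f ` S))) (U -` SA)"
    using has_measure_differentiable_image[OF _ derg injg, of "measure lebesgue (U -` (A \<inter> f ` S))"] lm Uinv
    unfolding im by auto
  then have "(\<integral>\<^sup>+v. ennreal (indicator (U -` SA) v * (cmod (f' (U v)))\<^sup>2) \<partial>lborel) = ennreal (measure lebesgue (U -` (A \<inter> f ` S)))"
    unfolding det by (intro nn_integral_has_integral_lebesgue) auto
  also have "\<dots> = emeasure lborel (A \<inter> f ` S)"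
    using fin em[OF meas] \<open>U -` (A \<inter> f ` S) \<in> sets borel\<close>
    by (subst em[OF meas, symmetric], subst emeasure_eq_ennreal_measure) (auto simp del: vimage_Int)
  finally have *: "emeasure lborel (A \<inter> f ` S) = (\<integral>\<^sup>+v. ennreal (indicator SA (U v) * (cmod (f' (U v)))\<^sup>2) \<partial>lborel)"
    by (simp add: indicator_vimage)
  have "continuous_on S f'"
    using holomorphic_on_imp_continuous_on[OF holomorphic_deriv[OF hol S]] der
    by (subst continuous_on_cong[OF refl, of S f' "deriv f"]) (auto simp: DERIV_imp_deriv[symmetric])
  then have "(\<lambda>x. indicator S x *\<^sub>R f' x) \<in> borel_measurable borel"
    using S by (intro borel_measurable_continuous_on_indicator) auto
  then have "(\<lambda>x. indicator SA x * (cmod (indicator S x *\<^sub>R f' x))\<^sup>2) \<in> borel_measurable borel"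
    using SA by measurable
  also have "(\<lambda>x. indicator SA x * (cmod (indicator S x *\<^sub>R f' x))\<^sup>2) = (\<lambda>x. indicator SA x * (cmod (f' x))\<^sup>2)"
    by (auto simp: SA_def indicator_def)
  finally have [measurable]: "(\<lambda>x. indicator SA x * (cmod (f' x))\<^sup>2) \<in> borel_measurable borel" .
  have "(\<integral>\<^sup>+v. ennreal (indicator SA (U v) * (cmod (f' (U v)))\<^sup>2) \<partial>lborel)
      = (\<integral>\<^sup>+x. ennreal (indicator SA x * (cmod (f' x))\<^sup>2) \<partial>distr lborel borel U)"
    by (subst nn_integral_distr) auto
  then show ?thesis
    unfolding * dU by (auto simp: SA_def indicator_def intro!: nn_integral_cong)
qed

text \<open>Lebesgue measure on the image and the push-forward of the density
  \<open>(cmod (f' x))\<^sup>2\<close> agree on bounded Borel sets; exhausting by balls makes them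
  equal as measures, and then every nonnegative function may be substituted.\<close>

lemma nn_integral_holomorphic_substitution:
  assumes S: "open S" and der: "\<And>x. x \<in> S \<Longrightarrow> (f has_field_derivative f' x) (at x)"
    and inj: "inj_on f S" and [measurable]: "\<phi> \<in> borel_measurable borel"
  shows "(\<integral>\<^sup>+x. \<phi> x * indicator (f ` S) x \<partial>lborel) =
    (\<integral>\<^sup>+x. \<phi> (f x) * ennreal ((cmod (f' x))\<^sup>2) * indicator S x \<partial>lborel)"
proof -
  have hol: "f holomorphic_on S"
    using der S by (simp add: holomorphic_on_open) blast
  have opf [measurable]: "f ` S \<in> sets borel" using open_mapping_thm3[OF hol S inj] by auto
  have Sb [measurable]: "S \<in> sets borel" using S by auto
  \<comment> \<open>Extension by 0 outside the open set \<open>S\<close> makes the map and its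
    derivative Borel measurable on the whole plane.\<close>
  define F where "F x = (if x \<in> S then f x else 0)" for x
  define F' where "F' x = (if x \<in> S then f' x else 0)" for x
  have [measurable]: "F \<in> borel \<rightarrow>\<^sub>M borel"
    unfolding F_def using S holomorphic_on_imp_continuous_on[OF hol]
    by (intro borel_measurable_continuous_on_if) auto
  have "continuous_on S f'"
    using holomorphic_on_imp_continuous_on[OF holomorphic_deriv[OF hol S]] der
    by (subst continuous_on_cong[OF refl, of S f' "deriv f"]) (auto simp: DERIV_imp_deriv[symmetric])
  then have [measurable]: "F' \<in> borel \<rightarrow>\<^sub>M borel"
    unfolding F'_def using S by (intro borel_measurable_continuous_on_if) auto
  define M1 where "M1 = density lborel (\<lambda>x. indicator (f ` S) x :: ennreal)"
  define M2 where "M2 = distr (density lborel (\<lambda>x. ennreal ((cmod (F' x))\<^sup>2) * indicator S x)) borel F"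
  have eq: "emeasure M1 A = emeasure M2 A" if [measurable]: "A \<in> sets borel" and "bounded A" for A
  proof -
    have "emeasure M1 A = emeasure lborel (A \<inter> f ` S)"
      by (simp add: M1_def emeasure_density mult.commute Int_commute flip: indicator_inter_arith)
    also have "\<dots> = (\<integral>\<^sup>+x. ennreal ((cmod (f' x))\<^sup>2) * indicator {x\<in>S. f x \<in> A} x \<partial>lborel)"
      by (rule emeasure_holomorphic_image[OF S der inj that])
    also have "\<dots> = (\<integral>\<^sup>+x. ennreal ((cmod (F' x))\<^sup>2) * indicator S x * indicator (F -` A) x \<partial>lborel)"
      by (intro nn_integral_cong) (auto simp: F_def F'_def indicator_def)
    also have "\<dots> = emeasure M2 A"
      using measurable_sets[of F borel borel A] by (simp add: M2_def emeasure_distr emeasure_density)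
    finally show ?thesis .
  qed
  have "M1 = M2"
  proof (rule measure_eqI)
    fix A assume "A \<in> sets M1"
    then have A [measurable]: "A \<in> sets borel" by (simp add: M1_def)
    have U: "(\<Union>n. A \<inter> ball 0 (real n)) = A"
      using reals_Archimedean2 by (auto simp: dist_norm)
    have inc: "incseq (\<lambda>n. A \<inter> ball 0 (real n))"
      by (auto simp: incseq_def)
    have r: "range (\<lambda>n. A \<inter> ball 0 (real n)) \<subseteq> sets borel"
      using A by (auto intro!: sets.Int)
    have "emeasure M1 A = (SUP n. emeasure M1 (A \<inter> ball 0 (real n)))"
      using SUP_emeasure_incseq[OF _ inc, of M1] U r by (auto simp: M1_def)
    also have "\<dots> = (SUP n. emeasure M2 (A \<inter> ball 0 (real n)))"
      by (intro SUP_cong eq) auto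
    also have "\<dots> = emeasure M2 A"
      using SUP_emeasure_incseq[OF _ inc, of M2] U r by (auto simp: M2_def)
    finally show "emeasure M1 A = emeasure M2 A" .
  qed (simp add: M1_def M2_def)
  then have "(\<integral>\<^sup>+x. \<phi> x \<partial>M1) = (\<integral>\<^sup>+x. \<phi> x \<partial>M2)" by simp
  then have "(\<integral>\<^sup>+x. indicator (f ` S) x * \<phi> x \<partial>lborel) =
      (\<integral>\<^sup>+x. ennreal ((cmod (F' x))\<^sup>2) * indicator S x * \<phi> (F x) \<partial>lborel)"
    by (simp add: M1_def M2_def nn_integral_density nn_integral_distr)
  also have "\<dots> = (\<integral>\<^sup>+x. \<phi> (f x) * ennreal ((cmod (f' x))\<^sup>2) * indicator S x \<partial>lborel)"
    by (intro nn_integral_cong) (auto simp: F_def F'_def indicator_def mult_ac)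
  finally show ?thesis by (simp add: mult.commute)
qed

section \<open>The invariant volume\<close>

lemma borel_measurable_vec_nth [measurable (raw)]:
  fixes f :: "'x \<Rightarrow> 'a::euclidean_space ^ 'n"
  assumes "f \<in> borel_measurable M"
  shows "(\<lambda>x. f x $ i) \<in> borel_measurable M"
proof -
  have "(\<lambda>z :: 'a ^ 'n. z $ i) \<in> borel_measurable borel"
    by (intro borel_measurable_continuous_onI continuous_intros)
  from measurable_compose[OF assms this] show ?thesis .
qed

lemma borel_measurable_vec_lambda [measurable (raw)]:
  fixes f :: "'x \<Rightarrow> 'n::finite \<Rightarrow> 'a::euclidean_space"
  assumes "\<And>i. (\<lambda>x. f x i) \<in> borel_measurable M"
  shows "(\<lambda>x. \<chi> i. f x i) \<in> borel_measurable M"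
proof (subst borel_measurable_euclidean_space, intro ballI)
  fix b :: "'a ^ 'n" assume "b \<in> Basis"
  then obtain i u where "b = axis i u" by (auto simp: Basis_vec_def)
  with assms[of i] show "(\<lambda>x. (\<chi> i. f x i) \<bullet> b) \<in> borel_measurable M"
    by (simp add: inner_axis)
qed

text \<open>Lebesgue measure is determined by its values on boxes, and a box in
  \<open>'a ^ 'n\<close> is a product of boxes in the coordinates.\<close>

lemma lborel_vec_eq:
  "(lborel :: ('a::euclidean_space ^ 'n::finite) measure) = distr (PiM UNIV (\<lambda>_. lborel)) borel vec_lambda"
proof (rule lborel_eqI)
  interpret product_sigma_finite "\<lambda>_ :: 'n. lborel :: 'a measure" ..
  have meas: "vec_lambda \<in> PiM UNIV (\<lambda>_ :: 'n. lborel :: 'a measure) \<rightarrow>\<^sub>M borel"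
    by (rule borel_measurable_vec_lambda) measurable
  fix lo up :: "'a ^ 'n"
  assume le: "\<And>b. b \<in> Basis \<Longrightarrow> lo \<bullet> b \<le> up \<bullet> b"
  have le': "(lo $ i) \<bullet> b \<le> (up $ i) \<bullet> b" if "b \<in> Basis" for i b
    using le[of "axis i b"] that by (auto simp: Basis_vec_def inner_axis)
  have B: "(Basis :: ('a ^ 'n) set) = (\<lambda>(i, b). axis i b) ` (UNIV \<times> Basis)"
    by (auto simp: Basis_vec_def)
  have inj: "inj_on (\<lambda>(i :: 'n, b :: 'a). axis i b) (UNIV \<times> Basis)"
    by (auto simp: inj_on_def axis_eq_axis)
  have pre: "vec_lambda -` box lo up \<inter> space (PiM UNIV (\<lambda>_ :: 'n. lborel :: 'a measure)) = (\<Pi>\<^sub>E i\<in>UNIV. box (lo $ i) (up $ i))"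
    unfolding box_def B by (auto simp: space_PiM inner_axis PiE_def Pi_def)
  have "emeasure (distr (PiM UNIV (\<lambda>_. lborel)) borel vec_lambda) (box lo up)
      = (\<Prod>i\<in>UNIV. ennreal (\<Prod>b\<in>Basis. (up $ i - lo $ i) \<bullet> b))"
    using le' by (simp add: emeasure_distr[OF meas] pre emeasure_PiM)
  also have "\<dots> = ennreal (\<Prod>i\<in>UNIV. \<Prod>b\<in>Basis. (up $ i - lo $ i) \<bullet> b)"
    using le' by (intro prod_ennreal prod_nonneg) (simp add: inner_diff_left)
  also have "(\<Prod>i\<in>UNIV. \<Prod>b\<in>Basis. (up $ i - lo $ i) \<bullet> b) = (\<Prod>b\<in>Basis. (up - lo) \<bullet> b)"
    unfolding B by (subst prod.reindex[OF inj]) (simp add: prod.cartesian_product inner_axis case_prod_unfold)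
  finally show "emeasure (distr (PiM UNIV (\<lambda>_. lborel)) borel vec_lambda) (box lo up) = ennreal (\<Prod>b\<in>Basis. (up - lo) \<bullet> b)" .
qed simp

section \<open>Integration one coordinate at a time\<close>

definition vupd :: "'a ^ 'n \<Rightarrow> 'n \<Rightarrow> 'a \<Rightarrow> 'a ^ 'n::finite"
  where "vupd z i w = (\<chi> j. if j = i then w else z $ j)"

lemma vupd_nth [simp]: "vupd z i w $ j = (if j = i then w else z $ j)"
  by (simp add: vupd_def)

lemma vupd_vupd [simp]: "vupd (vupd z i v) i w = vupd z i w"
  by (simp add: vec_eq_iff)

lemma measurable_vupd [measurable (raw)]:
  fixes f :: "'x \<Rightarrow> 'a::euclidean_space ^ 'n::finite"
  assumes [measurable]: "f \<in> borel_measurable M" "g \<in> borel_measurable M"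
  shows "(\<lambda>x. vupd (f x) i (g x)) \<in> borel_measurable M"
  unfolding vupd_def by measurable

lemma nn_integral_lborel_slice:
  fixes \<phi> :: "'a::euclidean_space ^ 'n::finite \<Rightarrow> ennreal"
  assumes [measurable]: "\<phi> \<in> borel_measurable borel"
  shows "(\<integral>\<^sup>+z. \<phi> z \<partial>lborel) =
    (\<integral>\<^sup>+x. (\<integral>\<^sup>+w. \<phi> (vupd (vec_lambda x) i w) \<partial>lborel) \<partial>PiM (UNIV - {i}) (\<lambda>_. lborel))"
proof -
  interpret product_sigma_finite "\<lambda>_ :: 'n. lborel :: 'a measure" ..
  have [measurable]: "vec_lambda \<in> PiM UNIV (\<lambda>_ :: 'n. lborel :: 'a measure) \<rightarrow>\<^sub>M borel"
    by (rule borel_measurable_vec_lambda) measurable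
  have "(\<integral>\<^sup>+z. \<phi> z \<partial>lborel) = (\<integral>\<^sup>+x. \<phi> (vec_lambda x) \<partial>PiM (insert i (UNIV - {i})) (\<lambda>_. lborel))"
    by (subst lborel_vec_eq) (simp add: nn_integral_distr insert_absorb)
  also have "\<dots> = (\<integral>\<^sup>+x. (\<integral>\<^sup>+w. \<phi> (vec_lambda (x(i := w))) \<partial>lborel) \<partial>PiM (UNIV - {i}) (\<lambda>_. lborel))"
    by (rule product_nn_integral_insert) (auto simp: insert_absorb)
  also have "\<dots> = (\<integral>\<^sup>+x. (\<integral>\<^sup>+w. \<phi> (vupd (vec_lambda x) i w) \<partial>lborel) \<partial>PiM (UNIV - {i}) (\<lambda>_. lborel))"
  proof -
    have "vec_lambda (x(i := w)) = vupd (vec_lambda x) i w" for x and w :: 'a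
      by (simp add: vec_eq_iff)
    then show ?thesis by (simp only:)
  qed
  finally show ?thesis .
qed

text \<open>Tonelli in coordinate \<open>i\<close>: it reduces the changes of variables on C^n to
  planar ones.\<close>

lemma nn_integral_slice_cong:
  fixes \<phi> :: "'a::euclidean_space ^ 'n::finite \<Rightarrow> ennreal"
  assumes "\<phi> \<in> borel_measurable borel" "\<psi> \<in> borel_measurable borel"
    and "\<And>z. (\<integral>\<^sup>+w. \<phi> (vupd z i w) \<partial>lborel) = (\<integral>\<^sup>+w. \<psi> (vupd z i w) \<partial>lborel)"
  shows "(\<integral>\<^sup>+z. \<phi> z \<partial>lborel) = (\<integral>\<^sup>+z. \<psi> z \<partial>lborel)"
  unfolding nn_integral_lborel_slice[OF assms(1), of i] nn_integral_lborel_slice[OF assms(2), of i] assms(3) ..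

text \<open>Layer cake: the power is the integral of \<open>p * t ^ (p - 1)\<close> over t from 0 to
  R - |w|^2. After exchanging the integrals, the points \<open>w\<close> over level \<open>t\<close>
  form a disc of area \<open>pi * (R - t)\<close>. As \<open>p\<close> is positive, the truncated
  values contribute nothing.\<close>

lemma nn_integral_disc_power:
  fixes R :: real
  assumes p: "1 \<le> p"
  shows "(\<integral>\<^sup>+w. ennreal ((max 0 (R - (cmod w)\<^sup>2)) ^ p) \<partial>lborel) = ennreal (pi / real (p + 1) * (max 0 R) ^ (p + 1))"
proof (cases "R \<le> 0")
  case True
  then have "max 0 (R - (cmod w)\<^sup>2) = 0" for w :: complex
    by (metis diff_le_0_iff_le max.absorb1 order_trans zero_le_power2)
  with True p show ?thesis by (simp add: zero_power)
next
  case False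
  then have R: "0 < R" by simp
  have slice: "ennreal ((max 0 (R - (cmod w)\<^sup>2)) ^ p) =
      (\<integral>\<^sup>+t. ennreal (real p * \<bar>t\<bar> ^ (p - 1)) * indicator {0..R - (cmod w)\<^sup>2} t \<partial>lborel)" for w :: complex
  proof (cases "0 \<le> R - (cmod w)\<^sup>2")
    case True
    have "(\<integral>\<^sup>+t. ennreal (real p * \<bar>t\<bar> ^ (p - 1)) * indicator {0..R - (cmod w)\<^sup>2} t \<partial>lborel)
        = ennreal ((R - (cmod w)\<^sup>2) ^ p - 0 ^ p)"
      by (rule nn_integral_FTC_Icc) (use True p in \<open>auto intro!: derivative_eq_intros\<close>)
    with True p show ?thesis by (simp add: zero_power)
  next
    case False
    with p show ?thesis by (simp add: zero_power)
  qed
  have swap: "indicator {0..R - (cmod w)\<^sup>2} t = (indicator {0..R} t * indicator (cball 0 (sqrt (R - t))) w :: ennreal)" for t and w :: complex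
  proof -
    have "t \<le> R - (cmod w)\<^sup>2 \<longleftrightarrow> t \<le> R \<and> cmod w \<le> sqrt (R - t)"
    proof (cases "t \<le> R")
      case True
      then have "cmod w \<le> sqrt (R - t) \<longleftrightarrow> (cmod w)\<^sup>2 \<le> R - t"
        by (metis abs_norm_cancel diff_ge_0_iff_ge norm_ge_zero real_le_lsqrt real_sqrt_le_iff real_sqrt_abs)
      with True show ?thesis by auto
    next
      case False
      then show ?thesis using zero_le_power2[of "cmod w"] by linarith
    qed
    then show ?thesis by (auto simp: indicator_def)
  qed
  have "(\<integral>\<^sup>+w. ennreal ((max 0 (R - (cmod w)\<^sup>2)) ^ p) \<partial>lborel)
      = (\<integral>\<^sup>+w. (\<integral>\<^sup>+t. ennreal (real p * \<bar>t\<bar> ^ (p - 1)) * indicator {0..R - (cmod w)\<^sup>2} t \<partial>lborel) \<partial>lborel)"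
    by (simp only: slice)
  also have "\<dots> = (\<integral>\<^sup>+t. (\<integral>\<^sup>+w. ennreal (real p * \<bar>t\<bar> ^ (p - 1)) * indicator {0..R - (cmod w)\<^sup>2} t \<partial>lborel) \<partial>lborel)"
    unfolding indicator_def atLeastAtMost_iff by (rule lborel_pair.Fubini'[symmetric]) measurable
  also have "\<dots> = (\<integral>\<^sup>+t. ennreal (real p * \<bar>t\<bar> ^ (p - 1) * (pi * (R - t))) * indicator {0..R} t \<partial>lborel)"
  proof (rule nn_integral_cong)
    fix t
    show "(\<integral>\<^sup>+w. ennreal (real p * \<bar>t\<bar> ^ (p - 1)) * indicator {0..R - (cmod w)\<^sup>2} t \<partial>lborel)
        = ennreal (real p * \<bar>t\<bar> ^ (p - 1) * (pi * (R - t))) * indicator {0..R} t"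
    proof (cases "t \<in> {0..R}")
      case True
      then have "emeasure lborel (cball 0 (sqrt (R - t)) :: complex set) = ennreal (pi * (R - t))"
        using unit_ball_vol_2 by (subst emeasure_cball) auto
      with True show ?thesis
        by (simp add: swap nn_integral_cmult_indicator ennreal_mult'[symmetric])
    qed (simp add: swap)
  qed
  also have "\<dots> = ennreal (pi / real (p + 1) * (max 0 R) ^ (p + 1))"
  proof -
    obtain q where q: "p = Suc q" using p by (cases p) auto
    \<comment> \<open>\<open>c\<close> is \<open>p / (p + 1)\<close>, the coefficient of the
      primitive of p t^p; \<open>1 - c\<close> then supplies the factor
      \<open>1 / (p + 1)\<close>.\<close>
    define c where "c = (real q + 1) / (real q + 2)"
    have c: "c * (real q + 2) = real q + 1" by (simp add: c_def)
    define G where "G t = pi * (R * t ^ Suc q - c * t ^ Suc (Suc q))" for t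
    have "(G has_real_derivative pi * (R * ((real q + 1) * t ^ q) - c * (real q + 2) * t ^ Suc q)) (at t)" for t
    proof -
      have d: "((\<lambda>t. t ^ Suc k) has_real_derivative (real k + 1) * t ^ k) (at t)" for k
        using DERIV_pow[of "Suc k" t] by (simp add: add.commute)
      show ?thesis
        unfolding G_def
        using DERIV_cmult[OF DERIV_diff[OF DERIV_cmult[OF d[of q], of R] DERIV_cmult[OF d[of "Suc q"], of c]], of pi]
        by (simp add: algebra_simps)
    qed
    then have "(G has_real_derivative real p * \<bar>t\<bar> ^ (p - 1) * (pi * (R - t))) (at t)" if "0 \<le> t" for t
      by (rule DERIV_cong) (use that in \<open>unfold c, simp add: q algebra_simps\<close>)
    then have "(\<integral>\<^sup>+t. ennreal (real p * \<bar>t\<bar> ^ (p - 1) * (pi * (R - t))) * indicator {0..R} t \<partial>lborel) = ennreal (G R - G 0)"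
      by (intro nn_integral_FTC_Icc) (use R in auto)
    also have "G R - G 0 = pi * (1 - c) * R ^ Suc (Suc q)" by (simp add: G_def algebra_simps)
    also have "1 - c = 1 / real (p + 1)" by (simp add: c_def q field_simps)
    finally show ?thesis using R by (simp add: q)
  qed
  finally show ?thesis .
qed

text \<open>Integrating out one coordinate, with 1 minus the sum of the other squares in the place
  of \<open>R\<close>, raises the exponent from \<open>p\<close> to \<open>p + 1\<close> and costs
  \<open>pi / (p + 1)\<close>. The product of these factors telescopes to the quotient of
  factorials.\<close>

lemma nn_integral_PiM_ball_power:
  fixes h :: "complex \<Rightarrow> ennreal" and l :: 'n
  assumes "finite J" "l \<notin> J" "1 \<le> p" and [measurable]: "h \<in> borel_measurable borel"
  shows "(\<integral>\<^sup>+x. h (x l) * ennreal ((max 0 (1 - (\<Sum>i\<in>insert l J. (cmod (x i))\<^sup>2))) ^ p) \<partial>PiM (insert l J) (\<lambda>_. lborel)) =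
    ennreal (pi ^ card J * fact p / fact (p + card J)) *
      (\<integral>\<^sup>+w. h w * ennreal ((max 0 (1 - (cmod w)\<^sup>2)) ^ (p + card J)) \<partial>lborel)"
  using assms(1-3)
proof (induction J arbitrary: p rule: finite_induct)
  case empty
  interpret product_sigma_finite "\<lambda>_ :: 'n. lborel :: complex measure" ..
  show ?case
    using product_nn_integral_singleton[of "\<lambda>w. h w * ennreal ((max 0 (1 - (cmod w)\<^sup>2)) ^ p)" l] by simp
next
  case (insert j J)
  interpret product_sigma_finite "\<lambda>_ :: 'n. lborel :: complex measure" ..
  have jl: "j \<noteq> l" "j \<notin> insert l J" "l \<notin> J" using insert by auto
  define S where "S x = (\<Sum>i\<in>insert l J. (cmod (x i))\<^sup>2)" for x :: "'n \<Rightarrow> complex"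
  have S: "(\<Sum>i\<in>insert l (insert j J). (cmod ((x(j := w)) i))\<^sup>2) = S x + (cmod w)\<^sup>2" for x w
  proof -
    have "(\<Sum>i\<in>insert j (insert l J). (cmod ((x(j := w)) i))\<^sup>2) = (cmod w)\<^sup>2 + (\<Sum>i\<in>insert l J. (cmod ((x(j := w)) i))\<^sup>2)"
      using insert.hyps jl by (subst sum.insert) auto
    also have "(\<Sum>i\<in>insert l J. (cmod ((x(j := w)) i))\<^sup>2) = S x"
      unfolding S_def using jl by (intro sum.cong) auto
    finally show ?thesis by (simp add: insert_commute)
  qed
  have "(\<integral>\<^sup>+x. h (x l) * ennreal ((max 0 (1 - (\<Sum>i\<in>insert l (insert j J). (cmod (x i))\<^sup>2))) ^ p) \<partial>PiM (insert l (insert j J)) (\<lambda>_. lborel))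
     = (\<integral>\<^sup>+x. h (x l) * ennreal ((max 0 (1 - (\<Sum>i\<in>insert l (insert j J). (cmod (x i))\<^sup>2))) ^ p) \<partial>PiM (insert j (insert l J)) (\<lambda>_. lborel))"
    by (simp add: insert_commute)
  also have "\<dots> = (\<integral>\<^sup>+x. (\<integral>\<^sup>+w. h ((x(j := w)) l) * ennreal ((max 0 (1 - (\<Sum>i\<in>insert l (insert j J). (cmod ((x(j := w)) i))\<^sup>2))) ^ p) \<partial>lborel) \<partial>PiM (insert l J) (\<lambda>_. lborel))"
    by (rule product_nn_integral_insert) (use insert.hyps jl in auto)
  also have "\<dots> = (\<integral>\<^sup>+x. h (x l) * (\<integral>\<^sup>+w. ennreal ((max 0 ((1 - S x) - (cmod w)\<^sup>2)) ^ p) \<partial>lborel) \<partial>PiM (insert l J) (\<lambda>_. lborel))"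
    using jl by (simp only: S) (simp add: nn_integral_cmult diff_diff_add)
  also have "\<dots> = (\<integral>\<^sup>+x. ennreal (pi / real (p + 1)) * (h (x l) * ennreal ((max 0 (1 - S x)) ^ (p + 1))) \<partial>PiM (insert l J) (\<lambda>_. lborel))"
  proof (rule nn_integral_cong)
    fix x
    have "(\<integral>\<^sup>+w. ennreal ((max 0 ((1 - S x) - (cmod w)\<^sup>2)) ^ p) \<partial>lborel) = ennreal (pi / real (p + 1)) * ennreal ((max 0 (1 - S x)) ^ (p + 1))"
      unfolding nn_integral_disc_power[OF \<open>1 \<le> p\<close>] by (rule ennreal_mult') simp
    then show "h (x l) * (\<integral>\<^sup>+w. ennreal ((max 0 ((1 - S x) - (cmod w)\<^sup>2)) ^ p) \<partial>lborel)
      = ennreal (pi / real (p + 1)) * (h (x l) * ennreal ((max 0 (1 - S x)) ^ (p + 1)))"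
      by (simp only: mult.left_commute)
  qed
  also have "\<dots> = ennreal (pi / real (p + 1)) * (\<integral>\<^sup>+x. h (x l) * ennreal ((max 0 (1 - S x)) ^ (p + 1)) \<partial>PiM (insert l J) (\<lambda>_. lborel))"
    unfolding S_def by (rule nn_integral_cmult) measurable
  also have "\<dots> = ennreal (pi / real (p + 1)) * (ennreal (pi ^ card J * fact (p + 1) / fact (p + 1 + card J)) *
      (\<integral>\<^sup>+w. h w * ennreal ((max 0 (1 - (cmod w)\<^sup>2)) ^ (p + 1 + card J)) \<partial>lborel))"
    unfolding S_def using insert.prems jl by (subst insert.IH) auto
  also have "ennreal (pi / real (p + 1)) * (ennreal (pi ^ card J * fact (p + 1) / fact (p + 1 + card J)) * I)
      = ennreal (pi ^ card (insert j J) * fact p / fact (p + card (insert j J))) * I" for I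
  proof -
    have "pi / real (p + 1) * (pi ^ card J * fact (p + 1) / fact (p + 1 + card J)) = pi ^ card (insert j J) * fact p / fact (p + card (insert j J))"
      using insert.hyps by (simp add: field_simps del: of_nat_Suc)
    then show ?thesis
      by (simp only: mult.assoc[symmetric] ennreal_mult'[symmetric] divide_nonneg_nonneg pi_ge_zero of_nat_0_le_iff)
  qed
  finally show ?case using insert.hyps by simp
qed

lemma nn_integral_ball_power:
  fixes h :: "complex \<Rightarrow> ennreal" and l :: "'n::finite"
  assumes p: "1 \<le> p" and [measurable]: "h \<in> borel_measurable borel"
  shows "(\<integral>\<^sup>+z. h (z $ l) * ennreal ((max 0 (1 - (norm z)\<^sup>2)) ^ p) \<partial>(lborel :: (complex ^ 'n) measure)) =
    ennreal (pi ^ (CARD('n) - 1) * fact p / fact (p + CARD('n) - 1)) *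
      (\<integral>\<^sup>+w. h w * ennreal ((max 0 (1 - (cmod w)\<^sup>2)) ^ (p + CARD('n) - 1)) \<partial>lborel)"
proof -
  have [measurable]: "vec_lambda \<in> PiM UNIV (\<lambda>_ :: 'n. lborel :: complex measure) \<rightarrow>\<^sub>M borel"
    by (rule borel_measurable_vec_lambda) measurable
  have c: "card (UNIV - {l}) = CARD('n) - 1" "p + (CARD('n) - 1) = p + CARD('n) - 1"
    using card_gt_0_iff[of "UNIV :: 'n set"] by (auto simp: card_Diff_singleton)
  have n: "(norm (vec_lambda x))\<^sup>2 = (\<Sum>i\<in>insert l (UNIV - {l}). (cmod (x i))\<^sup>2)" for x
    by (simp add: norm_vec_square insert_absorb)
  have "(\<integral>\<^sup>+z. h (z $ l) * ennreal ((max 0 (1 - (norm z)\<^sup>2)) ^ p) \<partial>(lborel :: (complex ^ 'n) measure))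
     = (\<integral>\<^sup>+x. h (x l) * ennreal ((max 0 (1 - (norm (vec_lambda x))\<^sup>2)) ^ p) \<partial>PiM (insert l (UNIV - {l})) (\<lambda>_. lborel))"
    by (subst lborel_vec_eq) (simp add: nn_integral_distr insert_absorb)
  also have "\<dots> = (\<integral>\<^sup>+x. h (x l) * ennreal ((max 0 (1 - (\<Sum>i\<in>insert l (UNIV - {l}). (cmod (x i))\<^sup>2))) ^ p) \<partial>PiM (insert l (UNIV - {l})) (\<lambda>_. lborel))"
    by (simp only: n)
  finally show ?thesis
    using nn_integral_PiM_ball_power[of "UNIV - {l}" l p h] p by (simp add: c)
qed

lemma nn_integral_mult_complex:
  fixes c :: complex
  assumes "c \<noteq> 0" and [measurable]: "f \<in> borel_measurable borel"
  shows "(\<integral>\<^sup>+w. f w \<partial>lborel) = (\<integral>\<^sup>+w. f (c * w) * ennreal ((cmod c)\<^sup>2) \<partial>lborel)"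
proof -
  have "range ((*) c) = UNIV"
    using assms by (intro surjI[where f = "\<lambda>w. w / c"]) simp
  then show ?thesis
    using nn_integral_holomorphic_substitution[of UNIV "(*) c" "\<lambda>_. c" f] assms
    by (auto simp: inj_on_def intro!: derivative_eq_intros)
qed

text \<open>The multiplier depends only on coordinate \<open>l\<close>, which is itself not scaled.
  With all coordinates but one held fixed it is therefore a nonzero constant, and each scaled
  coordinate contributes its squared modulus.\<close>

lemma nn_integral_scale_coordinates:
  fixes \<Phi> :: "complex ^ 'n::finite \<Rightarrow> ennreal" and a :: "complex \<Rightarrow> complex"
  assumes J: "finite J" "l \<notin> J" and [measurable]: "\<Phi> \<in> borel_measurable borel" "a \<in> borel_measurable borel"
    and nz: "\<And>w. a w \<noteq> 0"
  shows "(\<integral>\<^sup>+z. \<Phi> z \<partial>lborel) =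
    (\<integral>\<^sup>+z. \<Phi> (\<chi> i. if i \<in> J then a (z $ l) * z $ i else z $ i) * ennreal (cmod (a (z $ l)) ^ (2 * card J)) \<partial>lborel)"
  using J
proof (induction J rule: finite_induct)
  case (insert j J)
  define \<Psi> where "\<Psi> z = \<Phi> (\<chi> i. if i \<in> J then a (z $ l) * z $ i else z $ i) * ennreal (cmod (a (z $ l)) ^ (2 * card J))" for z
  have [measurable]: "\<Psi> \<in> borel_measurable borel" unfolding \<Psi>_def by measurable
  have "(\<integral>\<^sup>+z. \<Phi> z \<partial>lborel) = (\<integral>\<^sup>+z. \<Psi> z \<partial>lborel)"
    unfolding \<Psi>_def using insert by auto
  also have "\<dots> = (\<integral>\<^sup>+z. \<Psi> (vupd z j (a (z $ l) * z $ j)) * ennreal ((cmod (a (z $ l)))\<^sup>2) \<partial>lborel)"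
  proof (rule nn_integral_slice_cong[where i = j])
    fix z
    show "(\<integral>\<^sup>+w. \<Psi> (vupd z j w) \<partial>lborel) =
      (\<integral>\<^sup>+w. \<Psi> (vupd (vupd z j w) j (a (vupd z j w $ l) * vupd z j w $ j)) * ennreal ((cmod (a (vupd z j w $ l)))\<^sup>2) \<partial>lborel)"
      using insert.prems nn_integral_mult_complex[OF nz[of "z $ l"], of "\<lambda>w. \<Psi> (vupd z j w)"] by simp
  qed measurable
  also have "\<dots> = (\<integral>\<^sup>+z. \<Phi> (\<chi> i. if i \<in> insert j J then a (z $ l) * z $ i else z $ i) * ennreal (cmod (a (z $ l)) ^ (2 * card (insert j J))) \<partial>lborel)"
  proof (rule nn_integral_cong)
    fix z
    have "(\<chi> i. if i \<in> J then a (vupd z j (a (z $ l) * z $ j) $ l) * vupd z j (a (z $ l) * z $ j) $ i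
        else vupd z j (a (z $ l) * z $ j) $ i) = (\<chi> i. if i \<in> insert j J then a (z $ l) * z $ i else z $ i)"
      using insert by (auto simp: vec_eq_iff)
    moreover have "vupd z j (a (z $ l) * z $ j) $ l = z $ l" using insert by auto
    ultimately show "\<Psi> (vupd z j (a (z $ l) * z $ j)) * ennreal ((cmod (a (z $ l)))\<^sup>2) =
        \<Phi> (\<chi> i. if i \<in> insert j J then a (z $ l) * z $ i else z $ i) * ennreal (cmod (a (z $ l)) ^ (2 * card (insert j J)))"
      using insert.hyps by (simp add: \<Psi>_def mult.assoc ennreal_mult'[symmetric] power_add[symmetric])
  qed
  finally show ?case .
qed simp

section \<open>Invariance of the volume under the group\<close>

lemma borel_measurable_matrix_vector_mult [measurable (raw)]:
  fixes A :: "complex ^ 'a::finite ^ 'b::finite"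
  assumes [measurable]: "f \<in> borel_measurable M"
  shows "(\<lambda>x. A *v f x) \<in> borel_measurable M"
  unfolding matrix_vector_mult_def by measurable

lemma borel_measurable_emb [measurable (raw)]:
  assumes [measurable]: "f \<in> borel_measurable M"
  shows "(\<lambda>x. emb (f x)) \<in> borel_measurable M"
proof -
  have "(\<lambda>x. case k of None \<Rightarrow> 1 | Some i \<Rightarrow> f x $ i) \<in> borel_measurable M" for k
    by (cases k) auto
  then show ?thesis unfolding emb_def by (rule borel_measurable_vec_lambda)
qed

lemma borel_measurable_jfac [measurable (raw)]:
  assumes [measurable]: "f \<in> borel_measurable M"
  shows "(\<lambda>x. jfac g (f x)) \<in> borel_measurable M"
  unfolding jfac_def by measurable

lemma borel_measurable_act [measurable (raw)]:
  assumes [measurable]: "f \<in> borel_measurable M"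
  shows "(\<lambda>x. act g (f x)) \<in> borel_measurable M"
  unfolding act_def by measurable

lemma borel_measurable_hgt [measurable (raw)]:
  assumes [measurable]: "f \<in> borel_measurable M"
  shows "(\<lambda>x. hgt (f x)) \<in> borel_measurable M"
  unfolding hgt_eq by measurable

lemma ball_measurable [measurable]: "ball x r \<in> sets borel"
  by simp

definition vol_density :: "complex ^ 'n::finite \<Rightarrow> ennreal"
  where "vol_density z = ennreal (indicator uball z * (4 ^ CARD('n) / hgt z ^ (CARD('n) + 1)))"

lemma vol_density_measurable [measurable]: "vol_density \<in> borel_measurable borel"
  unfolding vol_density_def by measurable

lemma nn_integral_inv_vol:
  assumes [measurable]: "\<phi> \<in> borel_measurable borel"
  shows "(\<integral>\<^sup>+z. \<phi> z \<partial>inv_vol) = (\<integral>\<^sup>+z. vol_density z * \<phi> z \<partial>lborel)"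
  unfolding inv_vol_def vol_density_def by (rule nn_integral_density) measurable

lemma norm_axis: "norm (axis l x :: complex ^ 'n::finite) = cmod x"
proof -
  have "(\<Sum>i\<in>UNIV. (cmod (axis l x $ i))\<^sup>2) = (\<Sum>i\<in>UNIV. if i = l then (cmod x)\<^sup>2 else 0)"
    by (intro sum.cong) (auto simp: axis_def)
  then have "(norm (axis l x :: complex ^ 'n))\<^sup>2 = (cmod x)\<^sup>2"
    unfolding norm_vec_square by simp
  then show ?thesis by simp
qed

lemma component_uball: "z \<in> uball \<Longrightarrow> z $ l \<in> ball 0 1" for z :: "complex ^ 'n::finite"
  using Finite_Cartesian_Product.norm_nth_le[of z l] by simp

lemma act_boost_axis: "act (boost l t) (axis l x) =
    axis l ((of_real (cosh t) * x + of_real (sinh t)) / (of_real (cosh t) + of_real (sinh t) * x))"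
proof -
  have "act (boost l t) (axis l x) $ i = axis l ((of_real (cosh t) * x + of_real (sinh t)) / (of_real (cosh t) + of_real (sinh t) * x)) $ i" for i
    by (cases "i = l") (simp_all add: act_boost axis_def)
  then show ?thesis by (simp add: vec_eq_iff)
qed

text \<open>The disc is the ball for the one-element index type \<open>1\<close>, so the general
  fact about denominators applies.\<close>

lemma boost_denominator: "x \<in> ball 0 1 \<Longrightarrow> complex_of_real (cosh t) + of_real (sinh t) * x \<noteq> 0"
  using Un1_None_nonzero[OF boost_Un1, of "axis (undefined :: 1) x" undefined t]
  by (simp add: norm_axis boost_mult)

text \<open>In dimension one a boost is an automorphism of the disc, with inverse the boost for
  \<open>- t\<close>. Its complex derivative is the inverse square of the denominator because
  \<open>cosh\<close> and \<open>sinh\<close> satisfy the hyperbolic Pythagorean identity; the area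
  factor is the squared modulus of that, a fourth power.\<close>

lemma nn_integral_moebius_boost:
  assumes [measurable]: "f \<in> borel_measurable borel"
  shows "(\<integral>\<^sup>+w. f w * indicator (ball 0 1) w \<partial>lborel) =
    (\<integral>\<^sup>+w. f ((of_real (cosh t) * w + of_real (sinh t)) / (of_real (cosh t) + of_real (sinh t) * w))
      * ennreal (cmod (inverse (of_real (cosh t) + of_real (sinh t) * w)) ^ 4) * indicator (ball 0 1) w \<partial>lborel)"
proof -
  let ?l = "undefined :: 1"
  define B where "B t w = act (boost ?l t) (axis ?l w) $ ?l" for t w
  have B: "B t w = (of_real (cosh t) * w + of_real (sinh t)) / (of_real (cosh t) + of_real (sinh t) * w)" for t w
    by (simp add: B_def act_boost_axis)
  have ax: "axis ?l (B t w) = act (boost ?l t) (axis ?l w)" for t w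
    by (simp only: act_boost_axis B)
  have Bball: "B t w \<in> ball 0 1" if "w \<in> ball 0 1" for t w
    using act_uball[OF boost_Un1, of "axis ?l w" ?l t] that unfolding ax[symmetric] by (simp add: norm_axis)
  have Binv: "B (- t) (B t w) = w" if "w \<in> ball 0 1" for t w
    using act_comp[OF boost_Un1, of "axis ?l w" "boost ?l (- t)" ?l t] that
    by (simp add: boost_add boost_0 norm_axis B_def[of "- t"] ax)
  have im: "B t ` ball 0 1 = ball 0 1"
  proof (intro equalityI subsetI)
    fix x :: complex assume x: "x \<in> ball 0 1"
    then have "x = B t (B (- t) x)" using Binv[of x "- t"] by simp
    with Bball[OF x] show "x \<in> B t ` ball 0 1" by blast
  qed (use Bball in auto)
  have inj: "inj_on (B t) (ball 0 1)"
    using Binv by (metis inj_on_inverseI)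
  have c: "complex_of_real (cosh t) * of_real (cosh t) - of_real (sinh t) * of_real (sinh t) = 1"
    using hyperbolic_pythagoras[of t] by (metis of_real_1 of_real_diff of_real_mult power2_eq_square)
  have der: "(B t has_field_derivative (inverse (of_real (cosh t) + of_real (sinh t) * w))\<^sup>2) (at w)" if "w \<in> ball 0 1" for w
  proof -
    have "((\<lambda>w. (of_real (cosh t) * w + of_real (sinh t)) / (of_real (cosh t) + of_real (sinh t) * w)) has_field_derivative
      (of_real (cosh t) * (of_real (cosh t) + of_real (sinh t) * w) - (of_real (cosh t) * w + of_real (sinh t)) * of_real (sinh t)) /
       ((of_real (cosh t) + of_real (sinh t) * w) * (of_real (cosh t) + of_real (sinh t) * w))) (at w)"
      using boost_denominator[OF that, of t] by (auto intro!: derivative_eq_intros)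
    moreover have "of_real (cosh t) * (of_real (cosh t) + of_real (sinh t) * w) - (of_real (cosh t) * w + of_real (sinh t)) * of_real (sinh t) = 1"
      using c by (simp add: algebra_simps)
    ultimately show ?thesis by (simp add: B[abs_def] power2_eq_square inverse_eq_divide)
  qed
  show ?thesis
    using nn_integral_holomorphic_substitution[OF open_ball der inj assms] unfolding im
    by (simp add: B norm_power power_mult[symmetric])
qed

text \<open>A boost is triangular: coordinate \<open>l\<close> undergoes a Moebius map of the disc,
  and every other coordinate is multiplied by the automorphy factor, which depends only on
  coordinate \<open>l\<close>. The Jacobian is the modulus of that factor to the power 4 + 2(n - 1)
  = 2(n + 1), which is just what the height in the denominator of the volume form absorbs.\<close>

lemma nn_integral_inv_vol_boost:
  fixes \<phi> :: "complex ^ 'n::finite \<Rightarrow> ennreal"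
  assumes [measurable]: "\<phi> \<in> borel_measurable borel"
  shows "(\<integral>\<^sup>+z. \<phi> (act (boost l t) z) \<partial>inv_vol) = (\<integral>\<^sup>+z. \<phi> z \<partial>inv_vol)"
proof -
  let ?B = "ball (0 :: complex) 1"
  \<comment> \<open>The value 1 off the disc keeps the multiplier nonzero everywhere, as the scaling
    of coordinates demands; the integrand vanishes there.\<close>
  define a where "a w = (if w \<in> ?B then inverse (of_real (cosh t) + of_real (sinh t) * w) else 1)" for w
  have anz: "a w \<noteq> 0" for w using boost_denominator[of w t] by (auto simp: a_def)
  have [measurable]: "a \<in> borel_measurable borel" unfolding a_def by measurable
  define \<beta> where "\<beta> w = (of_real (cosh t) * w + of_real (sinh t)) * inverse (of_real (cosh t) + of_real (sinh t) * w)" for w :: complex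
  have [measurable]: "\<beta> \<in> borel_measurable borel" unfolding \<beta>_def by measurable
  define G where "G z = vol_density z * \<phi> z" for z
  have [measurable]: "G \<in> borel_measurable borel" unfolding G_def by measurable
  have G0: "G z = G z * indicator ?B (z $ l)" for z
    using component_uball[of z l] by (auto simp: G_def vol_density_def indicator_def)
  define G1 where "G1 z = G (vupd z l (\<beta> (z $ l))) * ennreal (cmod (a (z $ l)) ^ 4) * indicator ?B (z $ l)" for z
  have [measurable]: "G1 \<in> borel_measurable borel" unfolding G1_def by measurable
  have "(\<integral>\<^sup>+z. \<phi> z \<partial>inv_vol) = (\<integral>\<^sup>+z. G z \<partial>lborel)"
    by (simp add: nn_integral_inv_vol G_def)
  also have "\<dots> = (\<integral>\<^sup>+z. G1 z \<partial>lborel)"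
  proof (rule nn_integral_slice_cong[where i = l])
    fix z
    have "(\<integral>\<^sup>+w. G (vupd z l w) \<partial>lborel) = (\<integral>\<^sup>+w. G (vupd z l w) * indicator ?B w \<partial>lborel)"
      using G0[of "vupd z l _"] by simp
    also have "\<dots> = (\<integral>\<^sup>+w. G (vupd z l (\<beta> w)) * ennreal (cmod (inverse (of_real (cosh t) + of_real (sinh t) * w)) ^ 4) * indicator ?B w \<partial>lborel)"
      by (subst nn_integral_moebius_boost[of _ t]) (simp_all add: \<beta>_def divide_inverse)
    also have "\<dots> = (\<integral>\<^sup>+w. G1 (vupd z l w) \<partial>lborel)"
      by (intro nn_integral_cong) (auto simp: G1_def a_def indicator_def)
    finally show "(\<integral>\<^sup>+w. G (vupd z l w) \<partial>lborel) = (\<integral>\<^sup>+w. G1 (vupd z l w) \<partial>lborel)" .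
  qed measurable
  also have "\<dots> = (\<integral>\<^sup>+z. G1 (\<chi> i. if i \<in> UNIV - {l} then a (z $ l) * z $ i else z $ i) * ennreal (cmod (a (z $ l)) ^ (2 * card (UNIV - {l}))) \<partial>lborel)"
    by (rule nn_integral_scale_coordinates) (auto simp: anz)
  also have "\<dots> = (\<integral>\<^sup>+z. vol_density z * \<phi> (act (boost l t) z) \<partial>lborel)"
  proof (rule nn_integral_cong)
    fix z :: "complex ^ 'n"
    let ?s = "\<chi> i. if i \<in> UNIV - {l} then a (z $ l) * z $ i else z $ i"
    show "G1 ?s * ennreal (cmod (a (z $ l)) ^ (2 * card (UNIV - {l}))) = vol_density z * \<phi> (act (boost l t) z)"
    proof (cases "z $ l \<in> ?B")
      case True
      have j: "a (z $ l) = jfac (boost l t) z" using True by (simp add: a_def jfac_boost)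
      have N: "(boost l t *v emb z) $ None \<noteq> 0"
        using boost_denominator[OF True, of t] by (simp add: boost_mult)
      have "vupd ?s l (\<beta> (z $ l)) = act (boost l t) z"
        using True by (auto simp: vec_eq_iff a_def \<beta>_def act_boost divide_inverse mult.commute)
      then have "G1 ?s * ennreal (cmod (a (z $ l)) ^ (2 * card (UNIV - {l})))
          = G (act (boost l t) z) * ennreal (cmod (a (z $ l)) ^ (4 + 2 * card (UNIV - {l})))"
        using True by (simp add: G1_def mult.assoc ennreal_mult'[symmetric] power_add[symmetric])
      also have "4 + 2 * card (UNIV - {l}) = 2 * (CARD('n) + 1)"
      proof -
        have "card (UNIV - {l}) = CARD('n) - 1" "0 < CARD('n)" by auto
        then show ?thesis by arith
      qed
      also have "vol_density (act (boost l t) z) * ennreal (cmod (a (z $ l)) ^ (2 * (CARD('n) + 1))) = vol_density z"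
      proof -
        have h: "hgt (act (boost l t) z) = hgt z * (cmod (a (z $ l)))\<^sup>2"
          unfolding j by (rule hgt_act'[OF boost_Un1 N])
        then have u: "act (boost l t) z \<in> uball \<longleftrightarrow> z \<in> uball"
          using anz[of "z $ l"] unfolding hgt_pos_iff[symmetric] h by (simp add: zero_less_mult_iff)
        show ?thesis
        proof (cases "z \<in> uball")
          case True
          have "4 ^ CARD('n) / (hgt z * (cmod (a (z $ l)))\<^sup>2) ^ (CARD('n) + 1) * cmod (a (z $ l)) ^ (2 * (CARD('n) + 1))
            = 4 ^ CARD('n) / hgt z ^ (CARD('n) + 1)"
            using anz[of "z $ l"] unfolding power_mult_distrib power_mult by simp
          with True u h show ?thesis
            by (simp add: vol_density_def ennreal_mult'[symmetric] hgt_pos less_imp_le del: power_Suc)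
        qed (use u in \<open>simp add: vol_density_def\<close>)
      qed
      then have "G (act (boost l t) z) * ennreal (cmod (a (z $ l)) ^ (2 * (CARD('n) + 1))) = vol_density z * \<phi> (act (boost l t) z)"
        unfolding G_def by (metis mult.assoc mult.commute)
      finally show ?thesis .
    next
      case False
      then have "z \<notin> uball" using component_uball[of z l] by auto
      with False show ?thesis by (simp add: G1_def vol_density_def)
    qed
  qed
  also have "\<dots> = (\<integral>\<^sup>+z. \<phi> (act (boost l t) z) \<partial>inv_vol)"
    by (simp add: nn_integral_inv_vol)
  finally show ?thesis ..
qed

lemma nn_integral_lborel_stabilizer:
  fixes \<phi> :: "complex ^ 'n::finite \<Rightarrow> ennreal"
  assumes k: "k \<in> Un1" "act k 0 = 0" and [measurable]: "\<phi> \<in> borel_measurable borel"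
  shows "(\<integral>\<^sup>+z. \<phi> (act k z) \<partial>lborel) = (\<integral>\<^sup>+z. \<phi> z \<partial>lborel)"
proof -
  have "surj (act k)"
    using stabilizer_linear[OF k] stabilizer_norm[OF k]
    by (metis linear_injective_0 linear_injective_imp_surjective norm_eq_zero)
  then have "distr lborel borel (act k) = lborel"
    by (intro distr_lborel_isometry stabilizer_linear[OF k] stabilizer_norm[OF k])
  then have "(\<integral>\<^sup>+z. \<phi> z \<partial>lborel) = (\<integral>\<^sup>+z. \<phi> z \<partial>distr lborel borel (act k))" by simp
  then show ?thesis by (simp add: nn_integral_distr)
qed

lemma nn_integral_inv_vol_stabilizer:
  fixes \<phi> :: "complex ^ 'n::finite \<Rightarrow> ennreal"
  assumes k: "k \<in> Un1" "act k 0 = 0" and [measurable]: "\<phi> \<in> borel_measurable borel"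
  shows "(\<integral>\<^sup>+z. \<phi> (act k z) \<partial>inv_vol) = (\<integral>\<^sup>+z. \<phi> z \<partial>inv_vol)"
proof -
  have "vol_density z = vol_density (act k z)" for z
    by (simp add: vol_density_def hgt_eq stabilizer_norm[OF k] indicator_def)
  then have "(\<integral>\<^sup>+z. \<phi> (act k z) \<partial>inv_vol) = (\<integral>\<^sup>+z. vol_density (act k z) * \<phi> (act k z) \<partial>lborel)"
    by (simp add: nn_integral_inv_vol)
  then show ?thesis
    using nn_integral_lborel_stabilizer[OF k, of "\<lambda>z. vol_density z * \<phi> z"]
    by (simp add: nn_integral_inv_vol)
qed

lemma AE_inv_vol_uball: "AE z in inv_vol. z \<in> uball"
  unfolding inv_vol_def by (subst AE_density) (auto simp: indicator_def)

text \<open>\<open>KAK\<close>: if \<open>k b\<close> and \<open>g\<close> map the origin to the same point, then \<open>(k b)^(-1) g\<close> fixes it.\<close>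

lemma nn_integral_inv_vol_act:
  fixes \<phi> :: "complex ^ 'n::finite \<Rightarrow> ennreal"
  assumes g: "g \<in> Un1" and [measurable]: "\<phi> \<in> borel_measurable borel"
  shows "(\<integral>\<^sup>+z. \<phi> (act g z) \<partial>inv_vol) = (\<integral>\<^sup>+z. \<phi> z \<partial>inv_vol)"
proof -
  fix l :: 'n
  have "act g 0 \<in> uball" by (rule act_uball[OF g]) simp
  then obtain k t where k: "k \<in> Un1" "act k 0 = 0" and kt: "act k (act (boost l t) 0) = act g 0"
    using polar_decomposition_point by blast
  define h where "h = k ** boost l t"
  have h: "h \<in> Un1" unfolding h_def by (rule Un1_mult[OF k(1) boost_Un1])
  define k' where "k' = matrix_inv h ** g"
  have k': "k' \<in> Un1" unfolding k'_def by (rule Un1_mult[OF Un1_matrix_inv[OF h] g])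
  have "act k' 0 = act (matrix_inv h) (act h 0)"
    by (simp add: k'_def act_comp g kt[symmetric]) (simp add: h_def act_comp boost_Un1)
  then have k'0: "act k' 0 = 0" by (simp add: act_inverse h)
  have "h ** k' = g"
    by (simp add: k'_def matrix_mul_assoc Un1_inverse[OF h])
  then have *: "act g z = act k (act (boost l t) (act k' z))" if "z \<in> uball" for z
    using act_comp[OF k', of z h] act_comp[OF boost_Un1, of "act k' z" k l t] act_uball[OF k', of z] that
    by (simp add: h_def)
  have "(\<integral>\<^sup>+z. \<phi> (act g z) \<partial>inv_vol) = (\<integral>\<^sup>+z. \<phi> (act k (act (boost l t) (act k' z))) \<partial>inv_vol)"
    by (intro nn_integral_cong_AE eventually_mono[OF AE_inv_vol_uball]) (simp add: *)
  also have "\<dots> = (\<integral>\<^sup>+z. \<phi> (act k (act (boost l t) z)) \<partial>inv_vol)"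
    by (rule nn_integral_inv_vol_stabilizer[OF k' k'0]) measurable
  also have "\<dots> = (\<integral>\<^sup>+z. \<phi> (act k z) \<partial>inv_vol)"
    by (rule nn_integral_inv_vol_boost) measurable
  also have "\<dots> = (\<integral>\<^sup>+z. \<phi> z \<partial>inv_vol)"
    by (rule nn_integral_inv_vol_stabilizer[OF k]) measurable
  finally show ?thesis .
qed

lemma distr_inv_vol_act:
  assumes "g \<in> Un1"
  shows "distr inv_vol borel (act g) = inv_vol"
proof (rule measure_eqI)
  have s: "sets inv_vol = sets borel" by (simp add: inv_vol_def)
  have [measurable]: "act g \<in> inv_vol \<rightarrow>\<^sub>M borel"
    by (simp add: inv_vol_def)
  show "sets (distr inv_vol borel (act g)) = sets inv_vol" by (simp add: s)
  fix A assume "A \<in> sets (distr inv_vol borel (act g))"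
  then have [measurable]: "A \<in> sets borel" by simp
  have "emeasure (distr inv_vol borel (act g)) A = (\<integral>\<^sup>+z. indicator A z \<partial>distr inv_vol borel (act g))" by simp
  also have "\<dots> = (\<integral>\<^sup>+z. indicator A (act g z) \<partial>inv_vol)" by (rule nn_integral_distr) measurable
  also have "\<dots> = (\<integral>\<^sup>+z. indicator A z \<partial>inv_vol)" by (rule nn_integral_inv_vol_act[OF assms]) measurable
  finally show "emeasure (distr inv_vol borel (act g)) A = emeasure inv_vol A" by (simp add: s)
qed

section \<open>Holomorphic functions on the strip and along curves\<close>

lemma has_derivative_vecI:
  fixes c :: "complex \<Rightarrow> complex ^ 'n::finite"
  assumes "\<And>i. ((\<lambda>x. c x $ i) has_field_derivative d $ i) (at x)"
  shows "(c has_derivative (\<lambda>h. h *s d)) (at x)"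
proof (subst has_derivative_componentwise_within, intro ballI)
  fix b :: "complex ^ 'n" assume "b \<in> Basis"
  then obtain i u where b: "b = axis i u" by (auto simp: Basis_vec_def)
  have "((\<lambda>x. c x $ i) has_derivative (\<lambda>h. h * d $ i)) (at x)"
    using assms[of i] by (simp add: has_field_derivative_def mult_commute_abs)
  then have "((\<lambda>x. c x $ i \<bullet> u) has_derivative (\<lambda>h. (h * d $ i) \<bullet> u)) (at x)"
    by (rule has_derivative_inner_left)
  then show "((\<lambda>x. c x \<bullet> b) has_derivative (\<lambda>h. (h *s d) \<bullet> b)) (at x)"
    by (simp add: b inner_axis)
qed

text \<open>Holomorphy in several variables is used only through one-variable curves. Complex
  linearity of the derivative \<open>D\<close> is what turns the chain rule into multiplication by
  the number \<open>D d\<close>.\<close>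

lemma holomorphic_Cn_curve:
  assumes f: "holomorphic_Cn f uball" and S: "open S"
    and c: "\<And>i. (\<lambda>x. c x $ i) holomorphic_on S" "\<And>x. x \<in> S \<Longrightarrow> c x \<in> uball"
  shows "(\<lambda>x. f (c x)) holomorphic_on S"
  unfolding holomorphic_on_open[OF S]
proof (intro ballI)
  fix x assume x: "x \<in> S"
  obtain D where D: "(f has_derivative D) (at (c x))" "\<And>r v. D (r *s v) = r * D v"
    using f c(2)[OF x] unfolding holomorphic_Cn_def by blast
  define d where "d = (\<chi> i. deriv (\<lambda>x. c x $ i) x)"
  have "(c has_derivative (\<lambda>h. h *s d)) (at x)"
    by (rule has_derivative_vecI) (simp add: d_def holomorphic_derivI[OF c(1) S x])
  from diff_chain_at[OF this D(1)]
  have "((\<lambda>x. f (c x)) has_derivative (\<lambda>h. h * D d)) (at x)"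
    by (simp add: o_def D(2))
  then show "\<exists>f'. ((\<lambda>x. f (c x)) has_field_derivative f') (at x)"
    by (auto simp: has_field_derivative_def mult_commute_abs)
qed

lemma holomorphic_mult_emb:
  assumes "\<And>i. (\<lambda>x. c x $ i) holomorphic_on S"
  shows "(\<lambda>x. (g *v emb (c x)) $ k) holomorphic_on S"
  unfolding matrix_vector_mult_def by (simp add: sum_UNIV_option) (intro holomorphic_intros assms)

lemma holomorphic_slash_curve:
  assumes f: "holomorphic_Cn f uball" and S: "open S" and g: "g \<in> Un1"
    and c: "\<And>i. (\<lambda>x. c x $ i) holomorphic_on S" "\<And>x. x \<in> S \<Longrightarrow> c x \<in> uball"
  shows "(\<lambda>x. slash m f g (c x)) holomorphic_on S"
proof -
  have nz: "(g *v emb (c x)) $ None \<noteq> 0" if "x \<in> S" for x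
    using Un1_None_nonzero[OF g, of "c x"] c(2)[OF that] by auto
  have "(\<lambda>x. act g (c x) $ i) holomorphic_on S" for i
    unfolding act_def using nz by (simp) (intro holomorphic_intros holomorphic_mult_emb c(1), auto)
  moreover have "act g (c x) \<in> uball" if "x \<in> S" for x
    by (rule act_uball[OF g c(2)[OF that]])
  ultimately have "(\<lambda>x. f (act g (c x))) holomorphic_on S"
    by (rule holomorphic_Cn_curve[OF f S])
  moreover have "(\<lambda>x. jfac g (c x)) holomorphic_on S"
    unfolding jfac_def using nz by (intro holomorphic_intros holomorphic_mult_emb c(1)) auto
  ultimately show ?thesis unfolding slash_def by (intro holomorphic_intros)
qed

lemma continuous_on_slash:
  assumes f: "holomorphic_Cn f uball" and g: "g \<in> Un1"
  shows "continuous_on uball (slash m f g)"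
proof -
  have fc: "continuous_on uball f"
    using f unfolding holomorphic_Cn_def by (meson continuous_at_imp_continuous_on has_derivative_continuous)
  have N: "continuous_on uball (\<lambda>z. (g *v emb z) $ k)" for k
    unfolding matrix_vector_mult_def by (simp add: sum_UNIV_option) (intro continuous_intros)
  have nz: "(g *v emb z) $ None \<noteq> 0" if "z \<in> uball" for z
    using Un1_None_nonzero[OF g, of z] that by auto
  have "continuous_on uball (act g)"
    unfolding act_def using nz by (intro continuous_intros continuous_on_vec_lambda N) auto
  then have "continuous_on uball (\<lambda>z. f (act g z))"
    using act_uball[OF g] by (intro continuous_on_compose2[OF fc]) auto
  moreover have "continuous_on uball (jfac g)"
    unfolding jfac_def using nz by (intro continuous_intros N) auto
  ultimately show ?thesis unfolding slash_def by (intro continuous_intros)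
qed

lemma circle_mean_value:
  assumes g: "g holomorphic_on ball 0 r" and r: "1 < r"
  shows "((\<lambda>t. g (exp (2 * of_real pi * \<i> * of_real t))) has_integral g 0) {0..1}"
proof -
  have "continuous_on (cball 0 1) g" "g holomorphic_on ball 0 1"
    using r by (auto intro!: holomorphic_on_imp_continuous_on holomorphic_on_subset[OF g])
  then have "((\<lambda>u. g u / (u - 0)) has_contour_integral 2 * of_real pi * \<i> * g 0) (circlepath 0 1)"
    by (intro Cauchy_integral_circlepath) auto
  then have "((\<lambda>t. g (circlepath 0 1 t) / (circlepath 0 1 t) * vector_derivative (circlepath 0 1) (at t within {0..1}))
      has_integral 2 * of_real pi * \<i> * g 0) {0..1}"
    by (simp add: has_contour_integral_def)
  then have "((\<lambda>t. 2 * of_real pi * \<i> * g (exp (2 * of_real pi * \<i> * of_real t))) has_integral 2 * of_real pi * \<i> * g 0) {0..1}"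
    by (rule has_integral_eq[rotated], simp_all add: vector_derivative_circlepath01, simp add: circlepath)
  then have "((\<lambda>t. inverse (2 * of_real pi * \<i>) * (2 * of_real pi * \<i> * g (exp (2 * of_real pi * \<i> * of_real t))))
      has_integral inverse (2 * of_real pi * \<i>) * (2 * of_real pi * \<i> * g 0)) {0..1}"
    by (rule has_integral_mult_right)
  then show ?thesis by (simp add: field_simps)
qed

text \<open>The difference \<open>P (z + s) - P z\<close> of a primitive of a periodic function is constant.\<close>

lemma periodic_holomorphic_integral:
  assumes S: "convex S" "open S" and H: "H holomorphic_on S" and s: "0 \<le> s"
    and shift: "\<And>z t. z \<in> S \<Longrightarrow> z + of_real t \<in> S"
    and per: "\<And>z. z \<in> S \<Longrightarrow> H (z + of_real s) = H z"
    and ab: "a \<in> S" "b \<in> S"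
  shows "integral {0..s} (\<lambda>t. H (a + of_real t)) = integral {0..s} (\<lambda>t. H (b + of_real t))"
proof -
  obtain P where P': "\<And>x. x \<in> S \<Longrightarrow> (P has_field_derivative H x) (at x within S)"
    by (rule holomorphic_convex_primitive'[OF S H]) (rule that)
  have P: "(P has_field_derivative H x) (at x)" if "x \<in> S" for x
    using P'[OF that] at_within_open[OF that S(2)] by simp
  have "((\<lambda>z. P (z + of_real s) - P z) has_field_derivative 0) (at z within S)" if "z \<in> S" for z
  proof -
    have "((\<lambda>z. P (z + of_real s) - P z) has_field_derivative H (z + of_real s) - H z) (at z)"
      using P[OF that] P[OF shift[OF that, of s]]
      by (intro DERIV_diff iffD1[OF DERIV_shift])
    then show ?thesis using per[OF that] by (simp add: has_field_derivative_at_within)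
  qed
  then have "\<exists>C. \<forall>z\<in>S. P (z + of_real s) - P z = C"
    by (intro has_field_derivative_zero_constant[OF S(1)])
  moreover have "integral {0..s} (\<lambda>t. H (z + of_real t)) = P (z + of_real s) - P z" if "z \<in> S" for z
  proof -
    have "((\<lambda>t. H (z + of_real t)) has_integral P (z + of_real s) - P (z + of_real 0)) {0..s}"
    proof (rule fundamental_theorem_of_calculus[OF s])
      fix t
      have 1: "((\<lambda>t. z + of_real t) has_vector_derivative 1) (at t within {0..s})"
        by (auto intro!: derivative_eq_intros)
      have 2: "(P has_field_derivative H (z + of_real t)) (at (z + of_real t) within (\<lambda>t. z + of_real t) ` {0..s})"
        using P[OF shift[OF that]] by (rule has_field_derivative_at_within)
      from field_vector_diff_chain_within[OF 1 2]
      show "((\<lambda>t. P (z + of_real t)) has_vector_derivative H (z + of_real t)) (at t within {0..s})"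
        by (simp add: o_def)
    qed
    then show ?thesis by (simp add: integral_unique)
  qed
  ultimately show ?thesis using ab by auto
qed

text \<open>The function sin(2y) cos(2y)^(2k+1) vanishes at both ends of the interval. Integrating
  its derivative gives the recursion (4k + 4) I(k+1) = 2 (2k + 1) I(k), where I(k) is the integral
  in question.\<close>

lemma wallis_integral:
  "((\<lambda>y. cos (2 * y) ^ (2 * k)) has_integral (pi / 2 * fact (2 * k) / (4 ^ k * (fact k)\<^sup>2))) {- (pi / 4)..pi / 4}"
proof (induction k)
  case 0
  show ?case using has_integral_const_real[of "1::real" "- (pi / 4)" "pi / 4"] by simp
next
  case (Suc k)
  let ?c = "\<lambda>y :: real. cos (2 * y)" and ?s = "\<lambda>y :: real. sin (2 * y)"
  define G where "G y = ?s y * ?c y ^ Suc (2 * k)" for y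
  have dG: "(G has_real_derivative (4 * real k + 4) * ?c y ^ (2 * Suc k) - 2 * (2 * real k + 1) * ?c y ^ (2 * k)) (at y)" for y
  proof -
    have dc: "(?c has_real_derivative - (2 * ?s y)) (at y)"
      by (auto intro!: derivative_eq_intros)
    have d: "((\<lambda>y. ?c y ^ Suc (2 * k)) has_real_derivative real (Suc (2 * k)) * (?c y ^ (2 * k) * (- (2 * ?s y)))) (at y)"
      by (rule DERIV_cong[OF DERIV_power[OF dc]]) simp
    have "(G has_real_derivative (2 * ?c y) * ?c y ^ Suc (2 * k) + (real (Suc (2 * k)) * (?c y ^ (2 * k) * (- (2 * ?s y)))) * ?s y) (at y)"
      unfolding G_def by (rule DERIV_mult[OF _ d]) (auto intro!: derivative_eq_intros)
    moreover have "(2 * ?c y) * ?c y ^ Suc (2 * k) + (real (Suc (2 * k)) * (?c y ^ (2 * k) * (- (2 * ?s y)))) * ?s y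
      = (4 * real k + 4) * ?c y ^ (2 * Suc k) - 2 * (2 * real k + 1) * ?c y ^ (2 * k)"
    proof -
      have s: "?s y * ?s y = 1 - ?c y * ?c y"
        using sin_cos_squared_add[of "2 * y"] by (simp add: power2_eq_square)
      have "(2 * ?c y) * ?c y ^ Suc (2 * k) + (real (Suc (2 * k)) * (?c y ^ (2 * k) * (- (2 * ?s y)))) * ?s y
        = 2 * ?c y ^ (2 * Suc k) - 2 * (2 * real k + 1) * ?c y ^ (2 * k) * (?s y * ?s y)"
        by (simp add: algebra_simps)
      then show ?thesis unfolding s by (simp add: algebra_simps)
    qed
    ultimately show ?thesis by simp
  qed
  have "((\<lambda>y. (4 * real k + 4) * ?c y ^ (2 * Suc k) - 2 * (2 * real k + 1) * ?c y ^ (2 * k)) has_integral (G (pi / 4) - G (- (pi / 4)))) {- (pi / 4)..pi / 4}"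
  proof (rule fundamental_theorem_of_calculus)
    show "(G has_vector_derivative (4 * real k + 4) * ?c y ^ (2 * Suc k) - 2 * (2 * real k + 1) * ?c y ^ (2 * k)) (at y within {- (pi / 4)..pi / 4})" for y
      using has_field_derivative_at_within[OF dG] by (simp only: has_real_derivative_iff_has_vector_derivative)
  qed simp
  moreover have "G (pi / 4) - G (- (pi / 4)) = 0" by (simp add: G_def)
  ultimately have "((\<lambda>y. (4 * real k + 4) * ?c y ^ (2 * Suc k) - 2 * (2 * real k + 1) * ?c y ^ (2 * k)) has_integral 0) {- (pi / 4)..pi / 4}"
    by simp
  from has_integral_add[OF this has_integral_mult_right[OF Suc, of "2 * (2 * real k + 1)"]]
  have "((\<lambda>y. (4 * real k + 4) * ?c y ^ (2 * Suc k)) has_integral (2 * (2 * real k + 1) * (pi / 2 * fact (2 * k) / (4 ^ k * (fact k)\<^sup>2)))) {- (pi / 4)..pi / 4}"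
    by simp
  from has_integral_mult_right[OF this, of "inverse (4 * real k + 4)"]
  have "((\<lambda>y. ?c y ^ (2 * Suc k)) has_integral inverse (4 * real k + 4) * (2 * (2 * real k + 1) * (pi / 2 * fact (2 * k) / (4 ^ k * (fact k)\<^sup>2)))) {- (pi / 4)..pi / 4}"
    by (simp add: mult.assoc[symmetric] del: power_Suc mult_Suc_right)
  also have "inverse (4 * real k + 4) * (2 * (2 * real k + 1) * (pi / 2 * fact (2 * k) / (4 ^ k * (fact k)\<^sup>2)))
     = pi / 2 * fact (2 * Suc k) / (4 ^ Suc k * (fact (Suc k))\<^sup>2)"
  proof -
    define q where "q = real k + 1"
    have q: "q \<noteq> 0" by (simp add: q_def)
    have f: "fact (2 * Suc k) = (2 * q) * (2 * real k + 1) * (fact (2 * k) :: real)" "fact (Suc k) = q * (fact k :: real)"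
      and c: "4 * real k + 4 = 4 * q"
      by (simp_all add: q_def algebra_simps)
    have key: "inverse (4 * q) * (2 * x * (pi / 2 * A / (B * D\<^sup>2))) = pi / 2 * (2 * q * x * A) / (4 * B * (q * D)\<^sup>2)" for x A B D
      using q by (simp add: field_simps power2_eq_square)
    show ?thesis unfolding f c power_Suc by (rule key)
  qed
  finally show ?case .
qed

section \<open>The conformal map \<open>tanh\<close> from the strip to the disc\<close>

lemma cosh_complex_of_real: "cosh (complex_of_real x) = of_real (cosh x)"
  by (simp add: cosh_field_def flip: exp_of_real)

lemma sinh_complex_of_real: "sinh (complex_of_real x) = of_real (sinh x)"
  by (simp add: sinh_field_def flip: exp_of_real)

text \<open>The bound \<open>pi / 4\<close> is chosen so that \<open>exp (2 * x)\<close> ranges over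
  the right half-plane, which the Cayley transform identifies with the unit disc.\<close>

definition strip :: "complex set"
  where "strip = {x. \<bar>Im x\<bar> < pi / 4}"

lemma strip_open: "open strip"
  unfolding strip_def by (intro open_Collect_less continuous_intros)

lemma strip_convex: "convex strip"
proof -
  have "strip = {x. Im x < pi / 4} \<inter> {x. Im x > - (pi / 4)}" by (auto simp: strip_def)
  then show ?thesis by (metis convex_Int convex_halfspace_Im_lt convex_halfspace_Im_gt)
qed

text \<open>Splitting into real and imaginary parts factors the difference as (cosh^2 -
  sinh^2)(cos^2 - sin^2), evaluated at \<open>Re x\<close> and \<open>Im x\<close>. Divided by the
  squared modulus of \<open>cosh x\<close> it becomes the height of the disc point
  \<open>tanh x\<close>.\<close>

lemma norm_cosh_sinh:
  "(cmod (cosh x))\<^sup>2 - (cmod (sinh x))\<^sup>2 = cos (2 * Im x)"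
proof -
  have x: "x = of_real (Re x) + \<i> * of_real (Im x)" by (simp add: complex_eq_iff)
  have ci: "cosh (\<i> * of_real y) = of_real (cos y)" for y
    by (simp add: cosh_field_def cos_exp_eq flip: cos_of_real)
  have si: "sinh (\<i> * of_real y) = \<i> * of_real (sin y)" for y
    by (simp add: sinh_field_def sin_exp_eq flip: sin_of_real) (simp add: diff_divide_distrib)
  have c: "cosh x = Complex (cosh (Re x) * cos (Im x)) (sinh (Re x) * sin (Im x))"
    by (subst x) (simp add: cosh_add ci si complex_eq_iff cosh_complex_of_real sinh_complex_of_real)
  have s: "sinh x = Complex (sinh (Re x) * cos (Im x)) (cosh (Re x) * sin (Im x))"
    by (subst x) (simp add: sinh_add ci si complex_eq_iff cosh_complex_of_real sinh_complex_of_real)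
  have "(cmod (cosh x))\<^sup>2 - (cmod (sinh x))\<^sup>2 = ((cosh (Re x))\<^sup>2 - (sinh (Re x))\<^sup>2) * ((cos (Im x))\<^sup>2 - (sin (Im x))\<^sup>2)"
    unfolding c s cmod_power2 by (simp add: power_mult_distrib algebra_simps)
  then show ?thesis by (simp add: hyperbolic_pythagoras cos_double)
qed

lemma cosh_strip_nonzero:
  assumes "x \<in> strip" shows "cosh x \<noteq> 0"
proof
  assume "cosh x = 0"
  then have "- (cmod (sinh x))\<^sup>2 = cos (2 * Im x)" using norm_cosh_sinh[of x] by simp
  then have "cos (2 * Im x) \<le> 0" by (metis neg_le_0_iff_le zero_le_power2)
  moreover have "0 < cos (2 * Im x)" using assms by (intro cos_gt_zero_pi) (auto simp: strip_def)
  ultimately show False by simp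
qed

lemma cos_strip_pos: "x \<in> strip \<Longrightarrow> 0 < cos (2 * Im x)"
  by (intro cos_gt_zero_pi) (auto simp: strip_def)

lemma norm_tanh_strip:
  assumes "x \<in> strip"
  shows "1 - (cmod (tanh x))\<^sup>2 = cos (2 * Im x) / (cmod (cosh x))\<^sup>2"
  unfolding norm_cosh_sinh[symmetric] tanh_def norm_divide power_divide
  using cosh_strip_nonzero[OF assms] by (simp add: diff_divide_distrib)

lemma tanh_exp:
  assumes "x \<in> strip"
  shows "1 + tanh x = 2 * exp (2 * x) / (exp (2 * x) + 1)" "1 - tanh x = 2 / (exp (2 * x) + 1)" "exp (2 * x) + 1 \<noteq> 0"
proof -
  have e: "exp (2 * x) = exp x * exp x" by (metis exp_add mult_2)
  have c: "2 * cosh x = (exp (2 * x) + 1) / exp x" and s: "2 * sinh x = (exp (2 * x) - 1) / exp x"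
    unfolding e by (simp_all add: cosh_field_def sinh_field_def exp_minus field_simps)
  show nz: "exp (2 * x) + 1 \<noteq> 0" using c cosh_strip_nonzero[OF assms] by auto
  have "tanh x = (2 * sinh x) / (2 * cosh x)" by (simp add: tanh_def)
  also have "\<dots> = (exp (2 * x) - 1) / (exp (2 * x) + 1)" unfolding c s by simp
  finally show "1 + tanh x = 2 * exp (2 * x) / (exp (2 * x) + 1)" "1 - tanh x = 2 / (exp (2 * x) + 1)"
    using nz by (simp_all add: field_simps)
qed

text \<open>The Cayley transform \<open>(1 + w) / (1 - w)\<close> of a disc point has positive real
  part, so its principal logarithm has imaginary part smaller than \<open>pi / 2\<close> in modulus;
  half of that logarithm is the preimage.\<close>

lemma tanh_strip_image: "tanh ` strip = ball 0 1"
proof (intro equalityI subsetI)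
  fix w :: complex assume "w \<in> tanh ` strip"
  then obtain x where x: "x \<in> strip" "w = tanh x" by blast
  have "0 < 1 - (cmod w)\<^sup>2"
    unfolding x(2) norm_tanh_strip[OF x(1)] using cos_strip_pos[OF x(1)] cosh_strip_nonzero[OF x(1)] by simp
  then show "w \<in> ball 0 1" by (simp add: abs_square_less_1)
next
  fix w :: complex assume w: "w \<in> ball 0 1"
  then have w1: "1 - w \<noteq> 0" "1 + w \<noteq> 0" by (auto simp: add_eq_0_iff)
  define q where "q = (1 + w) / (1 - w)"
  have q0: "q \<noteq> 0" using w1 by (simp add: q_def)
  have "Re q = (1 - (cmod w)\<^sup>2) / (cmod (1 - w))\<^sup>2"
    unfolding q_def Re_divide cmod_power2 by (simp add: power2_eq_square algebra_simps)
  then have "0 < Re q" using w w1 by (simp add: abs_square_less_1)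
  then have im: "\<bar>Im (Ln q)\<bar> < pi / 2" using Re_Ln_pos_lt[OF q0] by blast
  define x where "x = Ln q / 2"
  have x: "x \<in> strip" using im by (simp add: x_def strip_def)
  have e: "exp (2 * x) = q" using q0 by (simp add: x_def)
  have "tanh x = 1 - 2 / (q + 1)" using tanh_exp(2)[OF x] unfolding e by (simp add: algebra_simps)
  also have "\<dots> = w" using w1 tanh_exp(3)[OF x] unfolding e by (simp add: q_def field_simps)
  finally show "w \<in> tanh ` strip" using x by blast
qed

lemma tanh_strip_inj: "inj_on tanh strip"
proof (rule inj_onI)
  fix x y assume xy: "x \<in> strip" "y \<in> strip" "tanh x = tanh y"
  then have "2 / (exp (2 * x) + 1) = 2 / (exp (2 * y) + 1)"
    using tanh_exp(2) by metis
  then have "exp (2 * x) = exp (2 * y)"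
    using tanh_exp(3)[OF xy(1)] tanh_exp(3)[OF xy(2)] by (simp add: field_simps)
  moreover have "\<bar>Im (2 * x) - Im (2 * y)\<bar> < 2 * pi" using xy by (auto simp: strip_def)
  ultimately have "2 * x = 2 * y" by (rule exp_complex_eqI[rotated])
  then show "x = y" by simp
qed

lemma tanh_strip_deriv:
  assumes "x \<in> strip"
  shows "(tanh has_field_derivative inverse ((cosh x)\<^sup>2)) (at x)"
proof -
  have "cosh x \<noteq> 0" by (rule cosh_strip_nonzero[OF assms])
  then have "(tanh has_field_derivative 1 - (tanh x)\<^sup>2) (at x)"
    by (auto intro!: derivative_eq_intros)
  moreover have "1 - (tanh x)\<^sup>2 = inverse ((cosh x)\<^sup>2)"
  proof -
    have "1 - (tanh x)\<^sup>2 = ((cosh x)\<^sup>2 - (sinh x)\<^sup>2) / (cosh x)\<^sup>2"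
      using \<open>cosh x \<noteq> 0\<close> by (simp add: tanh_def power_divide diff_divide_distrib)
    then show ?thesis by (simp add: hyperbolic_pythagoras inverse_eq_divide)
  qed
  ultimately show ?thesis by simp
qed

section \<open>Integration over a geodesic strip\<close>

text \<open>The nonnegative version says that projecting the weighted measure to coordinate
  \<open>l\<close> gives a multiple of a weighted planar measure. An identity of measures transfers
  Bochner integrals whether or not they converge, so no integrability of \<open>h\<close> is
  assumed.\<close>

lemma integral_ball_power:
  fixes h :: "complex \<Rightarrow> complex" and l :: "'n::finite"
  assumes p: "1 \<le> p" and [measurable]: "h \<in> borel_measurable borel"
  shows "(\<integral>z. h (z $ l) * of_real ((max 0 (1 - (norm z)\<^sup>2)) ^ p) \<partial>(lborel :: (complex ^ 'n) measure)) =
    of_real (pi ^ (CARD('n) - 1) * fact p / fact (p + CARD('n) - 1)) *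
      (\<integral>w. h w * of_real ((max 0 (1 - (cmod w)\<^sup>2)) ^ (p + CARD('n) - 1)) \<partial>lborel)"
proof -
  define c where "c = pi ^ (CARD('n) - 1) * fact p / fact (p + CARD('n) - 1)"
  have c: "0 \<le> c" by (simp add: c_def)
  define f where "f z = (max 0 (1 - (norm z)\<^sup>2)) ^ p" for z :: "complex ^ 'n"
  define g where "g w = (max 0 (1 - (cmod w)\<^sup>2)) ^ (p + CARD('n) - 1)" for w
  have [measurable]: "f \<in> borel_measurable borel" "g \<in> borel_measurable borel"
    unfolding f_def g_def by measurable
  have fg: "0 \<le> f z" "0 \<le> g w" for z w by (simp_all add: f_def g_def)
  have eq: "distr (density lborel (\<lambda>z. ennreal (f z))) borel (\<lambda>z. z $ l) = density lborel (\<lambda>w. ennreal (c * g w))"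
  proof (rule measure_eqI)
    fix A assume "A \<in> sets (distr (density lborel (\<lambda>z. ennreal (f z))) borel (\<lambda>z. z $ l))"
    then have [measurable]: "A \<in> sets borel" by simp
    have "emeasure (distr (density lborel (\<lambda>z. ennreal (f z))) borel (\<lambda>z. z $ l)) A
       = (\<integral>\<^sup>+z. indicator A (z $ l) * ennreal (f z) \<partial>lborel)"
      by (subst nn_integral_indicator[symmetric], simp, subst nn_integral_distr)
        (simp_all add: nn_integral_density mult.commute)
    also have "\<dots> = ennreal c * (\<integral>\<^sup>+w. indicator A w * ennreal (g w) \<partial>lborel)"
      unfolding f_def g_def c_def by (rule nn_integral_ball_power[OF p]) measurable
    also have "\<dots> = emeasure (density lborel (\<lambda>w. ennreal (c * g w))) A"
      using c by (simp add: emeasure_density nn_integral_cmult[symmetric] ennreal_mult' mult_ac)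
    finally show "emeasure (distr (density lborel (\<lambda>z. ennreal (f z))) borel (\<lambda>z. z $ l)) A
       = emeasure (density lborel (\<lambda>w. ennreal (c * g w))) A" .
  qed simp
  have "(\<integral>z. h (z $ l) * of_real (f z) \<partial>lborel) = (\<integral>w. h w \<partial>distr (density lborel (\<lambda>z. ennreal (f z))) borel (\<lambda>z. z $ l))"
    by (subst integral_distr) (simp_all add: integral_density fg scaleR_conv_of_real mult.commute)
  also have "\<dots> = (\<integral>w. of_real c * (h w * of_real (g w)) \<partial>lborel)"
    unfolding eq using c fg by (subst integral_density) (simp_all add: scaleR_conv_of_real mult_ac)
  also have "\<dots> = of_real c * (\<integral>w. h w * of_real (g w) \<partial>lborel)"
    by (rule integral_mult_right_zero)
  finally show ?thesis unfolding f_def g_def c_def .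
qed

text \<open>The complex-valued form, again obtained from an equality of measures, so that
  integrability of \<open>h\<close> is not a hypothesis.\<close>

lemma integral_holomorphic_substitution:
  fixes h :: "complex \<Rightarrow> complex"
  assumes S: "open S" and der: "\<And>x. x \<in> S \<Longrightarrow> (f has_field_derivative f' x) (at x)"
    and inj: "inj_on f S" and [measurable]: "h \<in> borel_measurable borel"
  shows "(\<integral>x. indicator (f ` S) x *\<^sub>R h x \<partial>lborel) =
    (\<integral>x. indicator S x *\<^sub>R (of_real ((cmod (f' x))\<^sup>2) * h (f x)) \<partial>lborel)"
proof -
  have hol: "f holomorphic_on S"
    using der S by (simp add: holomorphic_on_open) blast
  have opf [measurable]: "f ` S \<in> sets borel" using open_mapping_thm3[OF hol S inj] by auto
  have Sb [measurable]: "S \<in> sets borel" using S by auto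
  define F where "F x = (if x \<in> S then f x else 0)" for x
  define F' where "F' x = (if x \<in> S then f' x else 0)" for x
  have [measurable]: "F \<in> borel \<rightarrow>\<^sub>M borel"
    unfolding F_def using S holomorphic_on_imp_continuous_on[OF hol]
    by (intro borel_measurable_continuous_on_if) auto
  have "continuous_on S f'"
    using holomorphic_on_imp_continuous_on[OF holomorphic_deriv[OF hol S]] der
    by (subst continuous_on_cong[OF refl, of S f' "deriv f"]) (auto simp: DERIV_imp_deriv[symmetric])
  then have [measurable]: "F' \<in> borel \<rightarrow>\<^sub>M borel"
    unfolding F'_def using S by (intro borel_measurable_continuous_on_if) auto
  define d where "d x = (cmod (F' x))\<^sup>2 * indicator S x" for x
  have [measurable]: "d \<in> borel_measurable borel" unfolding d_def by measurable
  have d0: "0 \<le> d x" for x by (simp add: d_def)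
  have eq: "density lborel (\<lambda>x. ennreal (indicator (f ` S) x)) = distr (density lborel (\<lambda>x. ennreal (d x))) borel F"
  proof (rule measure_eqI)
    fix A assume "A \<in> sets (density lborel (\<lambda>x. ennreal (indicator (f ` S) x)))"
    then have [measurable]: "A \<in> sets borel" by simp
    have "emeasure (density lborel (\<lambda>x. ennreal (indicator (f ` S) x))) A = (\<integral>\<^sup>+x. indicator A x * indicator (f ` S) x \<partial>lborel)"
      by (simp add: emeasure_density ennreal_indicator mult.commute)
    also have "\<dots> = (\<integral>\<^sup>+x. indicator A (f x) * ennreal ((cmod (f' x))\<^sup>2) * indicator S x \<partial>lborel)"
      by (rule nn_integral_holomorphic_substitution[OF S der inj]) auto
    also have "\<dots> = (\<integral>\<^sup>+x. ennreal (d x) * indicator A (F x) \<partial>lborel)"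
      by (intro nn_integral_cong) (auto simp: d_def F_def F'_def indicator_def)
    also have "\<dots> = emeasure (distr (density lborel (\<lambda>x. ennreal (d x))) borel F) A"
      by (subst nn_integral_indicator[of A, symmetric], simp, subst nn_integral_distr)
        (simp_all add: nn_integral_density)
    finally show "emeasure (density lborel (\<lambda>x. ennreal (indicator (f ` S) x))) A
      = emeasure (distr (density lborel (\<lambda>x. ennreal (d x))) borel F) A" .
  qed simp
  have "(\<integral>x. indicator (f ` S) x *\<^sub>R h x \<partial>lborel) = (\<integral>x. h x \<partial>density lborel (\<lambda>x. ennreal (indicator (f ` S) x)))"
    by (subst integral_density) simp_all
  also have "\<dots> = (\<integral>x. d x *\<^sub>R h (F x) \<partial>lborel)"
    unfolding eq by (subst integral_distr) (simp_all add: integral_density d0)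
  also have "\<dots> = (\<integral>x. indicator S x *\<^sub>R (of_real ((cmod (f' x))\<^sup>2) * h (f x)) \<partial>lborel)"
    by (intro Bochner_Integration.integral_cong refl) (auto simp: d_def F_def F'_def indicator_def scaleR_conv_of_real)
  finally show ?thesis .
qed

section \<open>Averaging over rotations that fix coordinate \<open>l\<close>\<close>

definition rot :: "'n \<Rightarrow> real \<Rightarrow> complex ^ 'n::finite \<Rightarrow> complex ^ 'n"
  where "rot l \<theta> z = (\<chi> i. if i = l then z $ l else exp (2 * of_real pi * \<i> * of_real \<theta>) * z $ i)"

lemma rot_nth [simp]: "rot l \<theta> z $ l = z $ l"
  by (simp add: rot_def)

lemma norm_exp_2pi [simp]: "cmod (exp (2 * of_real pi * \<i> * of_real \<theta>)) = 1"
  by (simp add: norm_exp_eq_Re)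

lemma norm_rot [simp]: "norm (rot l \<theta> z) = norm z"
proof -
  have "(norm (rot l \<theta> z))\<^sup>2 = (norm z)\<^sup>2"
    unfolding norm_vec_square by (intro sum.cong) (auto simp: rot_def norm_mult)
  then show ?thesis by simp
qed

lemma distr_lborel_rot: "distr lborel borel (rot l \<theta>) = lborel"
proof (rule distr_lborel_isometry)
  show "linear (rot l \<theta>)"
    by (rule linearI) (auto simp: rot_def vec_eq_iff algebra_simps)
  show "norm (rot l \<theta> z) = norm z" for z by simp
  show "surj (rot l \<theta>)"
    by (rule surjI[where f = "rot l (- \<theta>)"]) (auto simp: rot_def vec_eq_iff exp_minus)
qed

lemma rot_measurable:
  "(\<lambda>(\<theta>, z). rot l \<theta> z) \<in> borel_measurable (lborel \<Otimes>\<^sub>M lborel)"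
proof -
  have [measurable]: "(\<lambda>\<theta>. exp (2 * of_real pi * \<i> * of_real \<theta>) :: complex) \<in> borel_measurable borel"
    by (intro borel_measurable_continuous_onI continuous_intros)
  show ?thesis unfolding rot_def case_prod_unfold by measurable
qed

text \<open>The rotated points are the values on the unit circle of the holomorphic curve
  \<open>c\<close> that multiplies all coordinates except \<open>l\<close> by \<open>x\<close>; its
  centre \<open>c 0\<close> is the point of the axis. Holomorphy of \<open>F\<close> enters as
  holomorphy along curves, the form in which it is available for \<open>slash m f h\<close>.\<close>

lemma rot_mean_value:
  fixes F :: "complex ^ 'n::finite \<Rightarrow> complex"
  assumes curve: "\<And>S (c :: complex \<Rightarrow> complex ^ 'n). open S \<Longrightarrow> (\<And>i. (\<lambda>x. c x $ i) holomorphic_on S)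
      \<Longrightarrow> (\<And>x. x \<in> S \<Longrightarrow> c x \<in> uball) \<Longrightarrow> (\<lambda>x. F (c x)) holomorphic_on S"
    and z: "z \<in> uball"
  shows "((\<lambda>\<theta>. F (rot l \<theta> z)) has_integral F (axis l (z $ l))) {0..1}"
proof -
  define c where "c x = (\<chi> i. if i = l then z $ l else x * z $ i)" for x
  \<comment> \<open>The curve stays in the ball for |x| < 1 / |z|, a radius exceeding 1; for
    \<open>z = 0\<close> it is constant and 2 is an arbitrary choice.\<close>
  define r where "r = (if z = 0 then 2 else 1 / norm z)"
  have r: "1 < r" using z by (simp add: r_def)
  have nc: "norm (c x) \<le> max 1 (cmod x) * norm z" for x
  proof (rule power2_le_imp_le)
    have "(norm (c x))\<^sup>2 \<le> (\<Sum>i\<in>UNIV. (max 1 (cmod x))\<^sup>2 * (cmod (z $ i))\<^sup>2)"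
      unfolding norm_vec_square
    proof (rule sum_mono)
      fix i
      have "cmod (c x $ i) \<le> max 1 (cmod x) * cmod (z $ i)"
        by (auto simp: c_def norm_mult mult_right_mono intro: order_trans[OF _ mult_right_mono[of 1]])
      then show "(cmod (c x $ i))\<^sup>2 \<le> (max 1 (cmod x))\<^sup>2 * (cmod (z $ i))\<^sup>2"
        by (metis norm_ge_zero power_mono power_mult_distrib)
    qed
    then show "(norm (c x))\<^sup>2 \<le> (max 1 (cmod x) * norm z)\<^sup>2"
      by (simp add: power_mult_distrib norm_vec_square sum_distrib_left)
  qed simp
  have ball: "c x \<in> uball" if "x \<in> ball 0 r" for x
  proof -
    have "max 1 (cmod x) * norm z < 1"
      using that z r by (auto simp: r_def max_def field_simps split: if_splits)
    with nc[of x] show ?thesis by simp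
  qed
  have "(\<lambda>x. F (c x)) holomorphic_on ball 0 r"
  proof (rule curve)
    show "(\<lambda>x. c x $ i) holomorphic_on ball 0 r" for i
      by (cases "i = l") (auto simp: c_def intro!: holomorphic_intros)
  qed (use ball in auto)
  from circle_mean_value[OF this r]
  have "((\<lambda>t. F (c (exp (2 * of_real pi * \<i> * of_real t)))) has_integral F (c 0)) {0..1}" .
  moreover have "c 0 = axis l (z $ l)"
    by (auto simp: c_def vec_eq_iff axis_def)
  moreover have "c (exp (2 * of_real pi * \<i> * of_real t)) = rot l t z" for t
    by (simp add: c_def rot_def)
  ultimately show ?thesis by simp
qed

lemma uball_emeasure_finite: "emeasure lborel (uball :: (complex ^ 'n::finite) set) < \<infinity>"
  by (rule emeasure_bounded_finite) simp

text \<open>Lebesgue measure and the weight \<open>p\<close> are invariant under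
  \<open>rot l \<theta>\<close>, so the integral is unchanged when \<open>F\<close> is replaced by
  its rotate. Averaging over a full turn and exchanging the integrals replaces \<open>F\<close> by
  its mean value. The bound on the finite-volume ball justifies the exchange.\<close>

lemma integral_rot_average:
  fixes F :: "complex ^ 'n::finite \<Rightarrow> complex" and p :: "complex \<Rightarrow> real \<Rightarrow> complex"
  assumes curve: "\<And>S (c :: complex \<Rightarrow> complex ^ 'n). open S \<Longrightarrow> (\<And>i. (\<lambda>x. c x $ i) holomorphic_on S)
      \<Longrightarrow> (\<And>x. x \<in> S \<Longrightarrow> c x \<in> uball) \<Longrightarrow> (\<lambda>x. F (c x)) holomorphic_on S"
    and cont: "continuous_on uball F"
    and [measurable]: "(\<lambda>z :: complex ^ 'n. p (z $ l) (norm z)) \<in> borel_measurable borel"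
    and bound: "\<And>z. z \<in> uball \<Longrightarrow> cmod (F z * p (z $ l) (norm z)) \<le> B"
  shows "(\<integral>z. (if z \<in> uball then F z * p (z $ l) (norm z) else 0) \<partial>lborel) =
    (\<integral>z. (if z \<in> uball then F (axis l (z $ l)) * p (z $ l) (norm z) else 0) \<partial>lborel)"
proof -
  define F0 where "F0 z = (if z \<in> uball then F z else 0)" for z
  have [measurable]: "F0 \<in> borel_measurable borel"
    unfolding F0_def using cont by (intro borel_measurable_continuous_on_if) auto
  define \<Phi> where "\<Phi> \<theta> z = F0 (rot l \<theta> z) * p (z $ l) (norm z)" for \<theta> z
  note rot_measurable[of l, measurable]
  have [measurable]: "(\<lambda>(\<theta>, z). \<Phi> \<theta> z) \<in> borel_measurable (lborel \<Otimes>\<^sub>M lborel)"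
  proof -
    have "(\<lambda>(\<theta>, z). F0 (rot l \<theta> z)) \<in> borel_measurable (lborel \<Otimes>\<^sub>M lborel)"
      using measurable_compose[OF rot_measurable[of l], of F0 borel] by (simp add: case_prod_unfold)
    then show ?thesis unfolding \<Phi>_def by (simp add: case_prod_unfold)
  qed
  have \<Phi>_le: "cmod (\<Phi> \<theta> z) \<le> B * indicator uball z" for \<theta> z
    using bound[of "rot l \<theta> z"] by (auto simp: \<Phi>_def F0_def)
  have zero: "(\<integral>z. \<Phi> \<theta> z \<partial>lborel) = (\<integral>z. (if z \<in> uball then F z * p (z $ l) (norm z) else 0) \<partial>lborel)" for \<theta>
  proof -
    define P where "P z = F0 z * p (z $ l) (norm z)" for z
    have [measurable]: "P \<in> borel_measurable borel" unfolding P_def by measurable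
    have [measurable]: "rot l \<theta> \<in> borel_measurable borel"
      using measurable_compose[OF measurable_Pair1'[of \<theta> lborel lborel] rot_measurable[of l]] by simp
    have "(\<integral>z. P z \<partial>distr lborel borel (rot l \<theta>)) = (\<integral>z. P (rot l \<theta> z) \<partial>lborel)"
      by (rule integral_distr) auto
    also have "\<dots> = (\<integral>z. \<Phi> \<theta> z \<partial>lborel)"
      by (simp add: P_def \<Phi>_def)
    finally show ?thesis
      by (simp add: distr_lborel_rot P_def F0_def if_distrib[of "\<lambda>x. x * _"] cong: if_cong)
  qed
  let ?T = "\<lambda>\<theta> z. indicator {0..1::real} \<theta> *\<^sub>R \<Phi> \<theta> z"
  have int: "integrable (lborel \<Otimes>\<^sub>M lborel) (\<lambda>(\<theta>, z). ?T \<theta> z)"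
  proof (rule Bochner_Integration.integrable_bound)
    have "emeasure (lborel \<Otimes>\<^sub>M lborel) ({0..1::real} \<times> (uball :: (complex ^ 'n) set)) < \<infinity>"
      using uball_emeasure_finite[where 'n = 'n]
      by (subst lborel.emeasure_pair_measure_Times) (auto simp: ennreal_mult_less_top)
    then show "integrable (lborel \<Otimes>\<^sub>M lborel) (\<lambda>x. B * indicator ({0..1::real} \<times> (uball :: (complex ^ 'n) set)) x)"
      by (intro integrable_mult_right integrable_real_indicator) auto
    show "AE x in lborel \<Otimes>\<^sub>M lborel. norm (case x of (\<theta>, z) \<Rightarrow> ?T \<theta> z) \<le> norm (B * indicator ({0..1::real} \<times> uball) x)"
    proof (intro always_eventually allI)
      fix x :: "real \<times> (complex ^ 'n)"
      obtain \<theta> z where x: "x = (\<theta>, z)" by (cases x)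
      show "norm (case x of (\<theta>, z) \<Rightarrow> ?T \<theta> z) \<le> norm (B * indicator ({0..1::real} \<times> uball) x)"
        using \<Phi>_le[of \<theta> z] by (auto simp: x indicator_def split: if_splits)
    qed
  qed measurable
  have inner: "(\<integral>\<theta>. ?T \<theta> z \<partial>lborel) = (if z \<in> uball then F (axis l (z $ l)) * p (z $ l) (norm z) else 0)" for z
  proof (cases "z \<in> uball")
    case True
    have [measurable]: "(\<lambda>\<theta>. rot l \<theta> z) \<in> borel_measurable borel"
      using measurable_compose[OF measurable_Pair2'[of z lborel lborel] rot_measurable[of l]] by simp
    have b: "bounded ((\<lambda>\<theta>. F (rot l \<theta> z)) ` {0..1})"
    proof -
      have "continuous_on {0..1} (\<lambda>\<theta>. F (rot l \<theta> z))"
      proof (rule continuous_on_compose2[OF cont])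
        have "continuous_on {0..1} (\<lambda>\<theta>. if i = l then z $ l else exp (2 * of_real pi * \<i> * of_real \<theta>) * z $ i)" for i
          by (cases "i = l") (auto intro!: continuous_intros)
        then show "continuous_on {0..1} (\<lambda>\<theta>. rot l \<theta> z)"
          unfolding rot_def by (rule continuous_on_vec_lambda)
      qed (use True in auto)
      then show ?thesis by (intro compact_imp_bounded compact_continuous_image) auto
    qed
    then obtain D where D: "\<And>\<theta>. \<theta> \<in> {0..1} \<Longrightarrow> cmod (F (rot l \<theta> z)) \<le> D"
      unfolding bounded_iff by blast
    have "integrable lborel (\<lambda>\<theta>. indicator {0..1::real} \<theta> *\<^sub>R F0 (rot l \<theta> z))"
    proof (rule Bochner_Integration.integrable_bound)
      show "integrable lborel (\<lambda>\<theta>. D * indicator {0..1::real} \<theta>)"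
        by (intro integrable_mult_right integrable_real_indicator) auto
      show "AE \<theta> in lborel. norm (indicator {0..1} \<theta> *\<^sub>R F0 (rot l \<theta> z)) \<le> norm (D * indicator {0..1} \<theta>)"
        using D True by (intro always_eventually) (auto simp: indicator_def F0_def intro: order_trans[OF _ abs_ge_self])
    qed measurable
    note integ = this
    have e: "(\<lambda>\<theta>. indicator {0..1} \<theta> *\<^sub>R F0 (rot l \<theta> z)) = (\<lambda>\<theta>. if \<theta> \<in> {0..1} then F (rot l \<theta> z) else 0)"
      using True by (auto simp: F0_def)
    have "(\<integral>\<theta>. indicator {0..1} \<theta> *\<^sub>R F0 (rot l \<theta> z) \<partial>lborel) = F (axis l (z $ l))"
    proof (rule has_integral_unique)
      show "((\<lambda>\<theta>. indicator {0..1} \<theta> *\<^sub>R F0 (rot l \<theta> z)) has_integral (\<integral>\<theta>. indicator {0..1} \<theta> *\<^sub>R F0 (rot l \<theta> z) \<partial>lborel)) UNIV"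
        by (rule has_integral_integral_lborel[OF integ])
      show "((\<lambda>\<theta>. indicator {0..1} \<theta> *\<^sub>R F0 (rot l \<theta> z)) has_integral F (axis l (z $ l))) UNIV"
        unfolding e has_integral_restrict_UNIV by (rule rot_mean_value[OF curve True])
    qed
    then show ?thesis
      using True by (simp add: \<Phi>_def flip: mult_scaleR_left)
  qed (simp add: \<Phi>_def F0_def)
  have "(\<integral>\<theta>. (\<integral>z. ?T \<theta> z \<partial>lborel) \<partial>lborel) = (\<integral>z. (\<integral>\<theta>. ?T \<theta> z \<partial>lborel) \<partial>lborel)"
    using lborel_pair.Fubini_integral[OF int] by simp
  also have "(\<integral>\<theta>. (\<integral>z. ?T \<theta> z \<partial>lborel) \<partial>lborel) = (\<integral>z. (if z \<in> uball then F z * p (z $ l) (norm z) else 0) \<partial>lborel)"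
    by (simp add: zero)
  also have "(\<integral>z. (\<integral>\<theta>. ?T \<theta> z \<partial>lborel) \<partial>lborel) = (\<integral>z. (if z \<in> uball then F (axis l (z $ l)) * p (z $ l) (norm z) else 0) \<partial>lborel)"
    by (simp only: inner)
  finally show ?thesis .
qed

text \<open>The window \<open>1 \<le> stretch < exp (2 * s)\<close> that cuts out a fundamental set
  for the cyclic group becomes \<open>0 \<le> Re x < s\<close> in the strip coordinate.\<close>

lemma tanh_strip_quotient:
  assumes "x \<in> strip"
  shows "cmod (1 + tanh x) / cmod (1 - tanh x) = exp (2 * Re x)"
proof -
  have "(1 + tanh x) / (1 - tanh x) = exp (2 * x)"
    using tanh_exp[OF assms] by simp
  then have "cmod (1 + tanh x) / cmod (1 - tanh x) = cmod (exp (2 * x))"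
    by (metis norm_divide)
  then show ?thesis by (simp add: norm_exp_eq_Re)
qed

text \<open>The bound makes the integrand integrable over the rectangle of width \<open>s\<close>
  and height \<open>pi / 2\<close>, so the integration along horizontal lines may be done first. Its
  result is the same on every line, and only the power of the cosine remains to be
  integrated.\<close>

lemma integral_strip_Fubini:
  fixes H :: "complex \<Rightarrow> complex" and q :: nat
  assumes s: "0 < s" and hol: "H holomorphic_on strip"
    and per: "\<And>x. x \<in> strip \<Longrightarrow> H (x + of_real s) = H x"
    and bound: "\<And>x. x \<in> strip \<Longrightarrow> cmod (H x) * cos (2 * Im x) ^ (2 * q) \<le> B"
  shows "(\<integral>x. (if x \<in> strip \<and> 0 \<le> Re x \<and> Re x < s then H x * of_real (cos (2 * Im x) ^ (2 * q)) else 0) \<partial>lborel) =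
    of_real (pi / 2 * fact (2 * q) / (4 ^ q * (fact q)\<^sup>2)) * integral {0..s} (\<lambda>t. H (of_real t))"
proof -
  define H0 where "H0 x = (if x \<in> strip then H x else 0)" for x
  have [measurable]: "H0 \<in> borel_measurable borel"
    unfolding H0_def using strip_open holomorphic_on_imp_continuous_on[OF hol]
    by (intro borel_measurable_continuous_on_if) auto
  define J where "J = integral {0..s} (\<lambda>t. H (of_real t))"
  have [measurable]: "(\<lambda>(t, y). Complex t y) \<in> borel_measurable (borel \<Otimes>\<^sub>M borel)"
  proof -
    have "continuous_on UNIV (\<lambda>(t, y). Complex t y)"
      unfolding Complex_eq case_prod_unfold by (intro continuous_intros)
    then show ?thesis unfolding borel_prod by (rule borel_measurable_continuous_onI)
  qed
  have cm [measurable (raw)]: "(\<lambda>x. Complex (u x) (v x)) \<in> borel_measurable M"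
    if [measurable]: "u \<in> borel_measurable M" "v \<in> borel_measurable M" for u v :: "'z \<Rightarrow> real" and M
    unfolding Complex_eq by measurable
  define \<Xi> where "\<Xi> t y = indicator {0..<s} t *\<^sub>R (indicator {- (pi / 4)<..<pi / 4} y *\<^sub>R (H0 (Complex t y) * of_real (cos (2 * y) ^ (2 * q))))" for t y
  have \<Xi>m [measurable]: "(\<lambda>(t, y). \<Xi> t y) \<in> borel_measurable (lborel \<Otimes>\<^sub>M lborel)"
    unfolding \<Xi>_def case_prod_unfold by measurable
  have strip: "Complex t y \<in> strip \<longleftrightarrow> y \<in> {- (pi / 4)<..<pi / 4}" for t y
    by (auto simp: strip_def)
  have int: "integrable (lborel \<Otimes>\<^sub>M lborel) (\<lambda>(t, y). \<Xi> t y)"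
  proof (rule Bochner_Integration.integrable_bound)
    have "emeasure (lborel \<Otimes>\<^sub>M lborel) ({0..<s} \<times> {- (pi / 4)<..<pi / 4}) < \<infinity>"
      using s by (subst lborel.emeasure_pair_measure_Times) (auto simp: ennreal_mult_less_top)
    then show "integrable (lborel \<Otimes>\<^sub>M lborel) (\<lambda>x. B * indicator ({0..<s} \<times> {- (pi / 4)<..<pi / 4}) x)"
      by (intro integrable_mult_right integrable_real_indicator) auto
    show "AE x in lborel \<Otimes>\<^sub>M lborel. norm (case x of (t, y) \<Rightarrow> \<Xi> t y) \<le> norm (B * indicator ({0..<s} \<times> {- (pi / 4)<..<pi / 4}) x)"
    proof (intro always_eventually allI)
      fix x :: "real \<times> real"
      obtain t y where x: "x = (t, y)" by (cases x)
      show "norm (case x of (t, y) \<Rightarrow> \<Xi> t y) \<le> norm (B * indicator ({0..<s} \<times> {- (pi / 4)<..<pi / 4}) x)"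
        using bound[of "Complex t y"] strip[of t y]
        by (auto simp: x \<Xi>_def H0_def indicator_def norm_mult norm_power power_even_abs split: if_splits)
    qed
  qed measurable
  have inner: "(\<integral>t. \<Xi> t y \<partial>lborel) = indicator {- (pi / 4)<..<pi / 4} y *\<^sub>R (of_real (cos (2 * y) ^ (2 * q)) * J)" for y
  proof (cases "y \<in> {- (pi / 4)<..<pi / 4}")
    case True
    have in_strip: "\<i> * of_real y + of_real t \<in> strip" for t
      using True by (auto simp: strip_def)
    have Ht: "H0 (Complex t y) = H (\<i> * of_real y + of_real t)" for t
      using in_strip[of t] by (simp add: H0_def Complex_eq add.commute)
    have "continuous_on {0..s} (\<lambda>t. H (\<i> * of_real y + of_real t))"
      using in_strip by (intro continuous_on_compose2[OF holomorphic_on_imp_continuous_on[OF hol]] continuous_intros) auto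
    then have si: "set_integrable lborel {0..s} (\<lambda>t. H (\<i> * of_real y + of_real t))"
      by (rule borel_integrable_atLeastAtMost')
    \<comment> \<open>The window is half-open while the period integral is over a closed interval;
      the endpoint \<open>s\<close> is a null set.\<close>
    have "(\<integral>t. indicator {0..<s} t *\<^sub>R H0 (Complex t y) \<partial>lborel) = (\<integral>t. indicator {0..s} t *\<^sub>R H (\<i> * of_real y + of_real t) \<partial>lborel)"
    proof (rule integral_cong_AE)
      show "AE t in lborel. indicator {0..<s} t *\<^sub>R H0 (Complex t y) = indicator {0..s} t *\<^sub>R H (\<i> * of_real y + of_real t)"
        using AE_lborel_singleton[of s] by eventually_elim (auto simp: Ht indicator_def)
      show "(\<lambda>t. indicator {0..s} t *\<^sub>R H (\<i> * of_real y + of_real t)) \<in> borel_measurable lborel"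
        using si unfolding set_integrable_def by (rule borel_measurable_integrable)
    qed measurable
    also have "\<dots> = integral {0..s} (\<lambda>t. H (\<i> * of_real y + of_real t))"
      using set_borel_integral_eq_integral(2)[OF si] by (simp add: set_lebesgue_integral_def)
    \<comment> \<open>Holomorphy and periodicity allow the path at height \<open>y\<close> to be
      moved to the real axis.\<close>
    also have "\<dots> = integral {0..s} (\<lambda>t. H (0 + of_real t))"
      using s in_strip[of 0]
      by (intro periodic_holomorphic_integral[OF strip_convex strip_open hol _ _ per]) (auto simp: strip_def)
    finally have "(\<integral>t. indicator {0..<s} t *\<^sub>R H0 (Complex t y) \<partial>lborel) = J" by (simp add: J_def)
    moreover have "(\<integral>t. \<Xi> t y \<partial>lborel) = (\<integral>t. of_real (cos (2 * y) ^ (2 * q)) * (indicator {0..<s} t *\<^sub>R H0 (Complex t y)) \<partial>lborel)"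
      using True by (intro Bochner_Integration.integral_cong refl) (simp add: \<Xi>_def)
    then have "(\<integral>t. \<Xi> t y \<partial>lborel) = of_real (cos (2 * y) ^ (2 * q)) * (\<integral>t. indicator {0..<s} t *\<^sub>R H0 (Complex t y) \<partial>lborel)"
      by (simp only: integral_mult_right_zero)
    ultimately show ?thesis using True by simp
  qed (simp add: \<Xi>_def)
  have "(\<integral>x. (if x \<in> strip \<and> 0 \<le> Re x \<and> Re x < s then H x * of_real (cos (2 * Im x) ^ (2 * q)) else 0) \<partial>lborel)
     = (\<integral>x. \<Xi> (Re x) (Im x) \<partial>distr lborel borel (\<lambda>(t, y). Complex t y))"
    unfolding distr_lborel_Complex
    by (intro Bochner_Integration.integral_cong refl) (auto simp: \<Xi>_def H0_def strip_def indicator_def)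
  also have "\<dots> = (\<integral>x. (case x of (t, y) \<Rightarrow> \<Xi> t y) \<partial>(lborel \<Otimes>\<^sub>M lborel))"
  proof -
    have [measurable]: "(\<lambda>x. \<Xi> (Re x) (Im x)) \<in> borel_measurable borel"
      unfolding \<Xi>_def by measurable
    show ?thesis
      unfolding lborel_prod by (subst integral_distr) (auto simp: case_prod_unfold borel_prod[symmetric])
  qed
  also have "\<dots> = (\<integral>y. (\<integral>t. \<Xi> t y \<partial>lborel) \<partial>lborel)"
    using lborel_pair.integral_snd[OF int] by simp
  also have "(\<integral>y. (\<integral>t. \<Xi> t y \<partial>lborel) \<partial>lborel) = (\<integral>y. indicator {- (pi / 4)<..<pi / 4} y *\<^sub>R (of_real (cos (2 * y) ^ (2 * q)) * J) \<partial>lborel)"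
    by (simp only: inner)
  also have "(\<integral>y. indicator {- (pi / 4)<..<pi / 4} y *\<^sub>R (of_real (cos (2 * y) ^ (2 * q)) * J) \<partial>lborel)
      = of_real (\<integral>y. indicator {- (pi / 4)<..<pi / 4} y * cos (2 * y) ^ (2 * q) \<partial>lborel) * J"
  proof -
    have "(\<integral>y. indicator {- (pi / 4)<..<pi / 4} y *\<^sub>R (of_real (cos (2 * y) ^ (2 * q)) * J) \<partial>lborel)
      = (\<integral>y. of_real (indicator {- (pi / 4)<..<pi / 4} y * cos (2 * y) ^ (2 * q)) * J \<partial>lborel)"
      by (intro Bochner_Integration.integral_cong refl) (simp add: scaleR_conv_of_real mult.assoc)
    then show ?thesis by (simp only: integral_mult_left_zero integral_complex_of_real)
  qed
  also have "(\<integral>y. indicator {- (pi / 4)<..<pi / 4} y * cos (2 * y) ^ (2 * q) \<partial>lborel) = pi / 2 * fact (2 * q) / (4 ^ q * (fact q)\<^sup>2)"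
  proof -
    have "(\<integral>y. indicator {- (pi / 4)<..<pi / 4} y * cos (2 * y) ^ (2 * q) \<partial>lborel) = (\<integral>y. indicator {- (pi / 4)..pi / 4} y * cos (2 * y) ^ (2 * q) \<partial>lborel)"
    proof (rule integral_cong_AE)
      show "AE y in lborel. indicator {- (pi / 4)<..<pi / 4} y * cos (2 * y) ^ (2 * q) = indicator {- (pi / 4)..pi / 4} y * cos (2 * y) ^ (2 * q)"
        using AE_lborel_singleton[of "pi / 4"] AE_lborel_singleton[of "- (pi / 4)"]
        by eventually_elim (auto simp: indicator_def)
    qed measurable
    also have "\<dots> = integral {- (pi / 4)..pi / 4} (\<lambda>y. cos (2 * y) ^ (2 * q))"
    proof -
      have "set_integrable lborel {- (pi / 4)..pi / 4} (\<lambda>y. cos (2 * y) ^ (2 * q))"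
        by (intro borel_integrable_atLeastAtMost' continuous_intros)
      from set_borel_integral_eq_integral(2)[OF this] show ?thesis by (simp add: set_lebesgue_integral_def)
    qed
    finally show ?thesis using wallis_integral by (simp add: integral_unique)
  qed
  finally show ?thesis by (simp add: J_def)
qed

text \<open>Here \<open>F\<close> plays the part of the transported form \<open>slash m f h\<close>,
  \<open>per\<close> that of its invariance under the conjugate of \<open>\<gamma>0\<close>, and
  \<open>\<Psi>\<close> is the transported integrand with the density of the volume
  included.\<close>

lemma integral_geodesic_strip:
  fixes F :: "complex ^ 'n::finite \<Rightarrow> complex" and l :: 'n
  assumes curve: "\<And>S (c :: complex \<Rightarrow> complex ^ 'n). open S \<Longrightarrow> (\<And>i. (\<lambda>x. c x $ i) holomorphic_on S)
      \<Longrightarrow> (\<And>x. x \<in> S \<Longrightarrow> c x \<in> uball) \<Longrightarrow> (\<lambda>x. F (c x)) holomorphic_on S"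
    and cont: "continuous_on uball F"
    and bound: "\<And>z. z \<in> uball \<Longrightarrow> cmod (F z) * hgt z ^ m \<le> M"
    and m: "CARD('n) + 1 \<le> m" and s: "0 < s"
    and per: "\<And>x. x \<in> strip \<Longrightarrow> F (axis l (tanh (x + of_real s))) * inverse (cosh (x + of_real s)) ^ (2 * m)
      = F (axis l (tanh x)) * inverse (cosh x) ^ (2 * m)"
    and \<Psi>: "\<Psi> = (\<lambda>z. if z \<in> uball \<and> 1 \<le> cmod (1 + z $ l) / cmod (1 - z $ l) \<and> cmod (1 + z $ l) / cmod (1 - z $ l) < exp (2 * s)
      then F z * cnj (inverse ((1 - (z $ l)\<^sup>2) ^ m)) * of_real (4 ^ CARD('n) * hgt z ^ (2 * m - CARD('n) - 1)) else 0)"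
  shows "\<Psi> \<in> borel_measurable borel" "integrable lborel \<Psi>"
    "(\<integral>z. \<Psi> z \<partial>lborel) = of_real (fact (2 * m - CARD('n) - 1) / (fact (m - 1))\<^sup>2 * pi ^ CARD('n) * (2 * 4 ^ CARD('n) / 4 ^ m))
      * integral {0..s} (\<lambda>t. F (axis l (of_real (tanh t))) * of_real (inverse (cosh t)) ^ (2 * m))"
proof -
  \<comment> \<open>The height has exponent \<open>2 * m\<close> in the inner product, and the
    volume form removes n + 1. Integrating out the n - 1 other coordinates raises what is left to
    \<open>2 * (m - 1)\<close>.\<close>
  define p where "p = 2 * m - CARD('n) - 1"
  have p: "1 \<le> p" "m \<le> p" "p + CARD('n) - 1 = 2 * (m - 1)"
    using m by (auto simp: p_def)
  define E where "E w = cmod (1 + w) / cmod (1 - w)" for w :: complex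
  define wt where "wt w = (if w \<in> ball 0 1 \<and> 1 \<le> E w \<and> E w < exp (2 * s) then cnj (inverse ((1 - w\<^sup>2) ^ m)) else 0)" for w
  have cnj_meas [measurable (raw)]: "(\<lambda>x. cnj (u x)) \<in> borel_measurable N" if "u \<in> borel_measurable N" for u :: "'z \<Rightarrow> complex" and N
    using measurable_compose[OF that, of cnj borel] by (simp add: borel_measurable_continuous_onI continuous_on_cnj)
  have [measurable]: "E \<in> borel_measurable borel" unfolding E_def by measurable
  have [measurable]: "wt \<in> borel_measurable borel" unfolding wt_def by measurable
  have hgt1: "hgt z \<le> 1" for z :: "complex ^ 'n" by (simp add: hgt_eq)
  have M: "0 \<le> M"
  proof -
    have "0 \<le> cmod (F 0) * hgt (0 :: complex ^ 'n) ^ m" by (simp add: hgt_eq)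
    also have "\<dots> \<le> M" by (rule bound) simp
    finally show ?thesis .
  qed
  \<comment> \<open>Bounds the weight on the window. There |1 - w| <= |1 + w|, and since the two sum
    to at least 2, |1 + w| >= 1; together with |1 + w| <= e^(2s) |1 - w| this keeps |1 - w^2| above
    e^(-2s).\<close>
  define K where "K = exp (2 * s) ^ m"
  have K: "0 \<le> K" by (simp add: K_def)
  have wtK: "cmod (wt w) \<le> K" for w
  proof (cases "w \<in> ball 0 1 \<and> 1 \<le> E w \<and> E w < exp (2 * s)")
    case True
    then have w: "cmod w < 1" "1 \<le> E w" "E w < exp (2 * s)" by auto
    then have pos: "0 < cmod (1 - w)" by auto
    then have 1: "cmod (1 - w) \<le> cmod (1 + w)" "cmod (1 + w) \<le> exp (2 * s) * cmod (1 - w)"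
      using w by (auto simp: E_def field_simps)
    have "2 \<le> cmod (1 + w) + cmod (1 - w)" using norm_triangle_ineq[of "1 + w" "1 - w"] by simp
    with 1 have 2: "1 \<le> cmod (1 + w)" by linarith
    have "1 \<le> cmod (1 + w) * cmod (1 + w)" using 2 mult_mono[of 1 "cmod (1 + w)" 1 "cmod (1 + w)"] by simp
    also have "\<dots> \<le> cmod (1 + w) * (exp (2 * s) * cmod (1 - w))" using 1 by (intro mult_left_mono) auto
    also have "\<dots> = exp (2 * s) * cmod (1 - w\<^sup>2)"
      by (simp add: norm_mult[symmetric] power2_eq_square algebra_simps)
    finally have 3: "inverse (cmod (1 - w\<^sup>2)) \<le> exp (2 * s)"
      by (cases "1 - w\<^sup>2 = 0") (auto simp: field_simps)
    have "wt w = cnj (inverse ((1 - w\<^sup>2) ^ m))" using True by (simp only: wt_def simp_thms if_True)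
    then have "cmod (wt w) = inverse (cmod (1 - w\<^sup>2)) ^ m"
      by (simp only: complex_mod_cnj norm_inverse norm_power power_inverse)
    then show ?thesis using power_mono[OF 3, of m] by (simp add: K_def)
  next
    case False
    then have "wt w = 0" unfolding wt_def by (rule if_not_P)
    with K show ?thesis by simp
  qed
  \<comment> \<open>The weight is a function of coordinate \<open>l\<close> and the norm only, hence
    invariant under the rotations.\<close>
  define P where "P w r = of_real (4 ^ CARD('n)) * (wt w * of_real ((max 0 (1 - r\<^sup>2)) ^ p))" for w r
  have [measurable]: "(\<lambda>z :: complex ^ 'n. P (z $ l) (norm z)) \<in> borel_measurable borel"
    unfolding P_def by measurable
  \<comment> \<open>Since \<open>m \<le> p\<close> and the height is at most 1, the cusp form bound
    with exponent \<open>m\<close> also controls exponent \<open>p\<close>.\<close>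
  have PF: "cmod (F z * P (z $ l) (norm z)) \<le> M * (4 ^ CARD('n) * K)" if z: "z \<in> uball" for z
  proof -
    have h: "max 0 (1 - (norm z)\<^sup>2) = hgt z" "0 \<le> hgt z" using hgt_pos[OF z] by (simp_all add: hgt_eq)
    have "cmod (F z) * hgt z ^ p \<le> cmod (F z) * hgt z ^ m"
      using h hgt1[of z] p by (intro mult_left_mono power_decreasing) auto
    then have "cmod (F z) * hgt z ^ p \<le> M" using bound[OF z] by linarith
    moreover have "4 ^ CARD('n) * cmod (wt (z $ l)) \<le> 4 ^ CARD('n) * K" using wtK by simp
    ultimately have "(cmod (F z) * hgt z ^ p) * (4 ^ CARD('n) * cmod (wt (z $ l))) \<le> M * (4 ^ CARD('n) * K)"
      using M h by (intro mult_mono) auto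
    then show ?thesis using h by (simp add: P_def norm_mult norm_power mult_ac)
  qed
  have \<Psi>P: "\<Psi> z = (if z \<in> uball then F z * P (z $ l) (norm z) else 0)" for z
  proof (cases "z \<in> uball")
    case True
    have "max 0 (1 - (norm z)\<^sup>2) = hgt z" using hgt_pos[OF True] by (simp add: hgt_eq)
    then show ?thesis
      using True component_uball[OF True, of l] by (auto simp: \<Psi> P_def wt_def E_def p_def mult_ac)
  qed (simp add: \<Psi>)
  have F0: "(\<lambda>z. if z \<in> uball then F z else 0) \<in> borel_measurable borel"
    using cont by (intro borel_measurable_continuous_on_if) auto
  have \<Psi>eq: "\<Psi> = (\<lambda>z. (if z \<in> uball then F z else 0) * P (z $ l) (norm z))"
    by (auto simp: \<Psi>P)
  show meas: "\<Psi> \<in> borel_measurable borel" unfolding \<Psi>eq using F0 by measurable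
  show "integrable lborel \<Psi>"
  proof (rule Bochner_Integration.integrable_bound)
    show "integrable lborel (\<lambda>z. M * (4 ^ CARD('n) * K) * indicator (uball :: (complex ^ 'n) set) z)"
      using uball_emeasure_finite[where 'n = 'n] by (intro integrable_mult_right integrable_real_indicator) auto
    show "AE z in lborel. norm (\<Psi> z) \<le> norm (M * (4 ^ CARD('n) * K) * indicator uball z)"
      using PF M K by (intro always_eventually) (auto simp: \<Psi>P indicator_def intro: order_trans[OF _ abs_ge_self])
  qed (use meas in simp)
  define h where "h w = (if w \<in> ball 0 1 then F (axis l w) * wt w else 0)" for w
  have axc: "continuous_on X (axis l :: complex \<Rightarrow> complex ^ 'n)" for X
  proof -
    have "continuous_on X (\<lambda>w. if i = l then w else (0 :: complex))" for i
      by (cases "i = l") auto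
    then have "continuous_on X (\<lambda>w. \<chi> i. if i = l then w else (0 :: complex))" by (rule continuous_on_vec_lambda)
    then show ?thesis by (simp add: axis_def)
  qed
  have hm [measurable]: "h \<in> borel_measurable borel"
  proof -
    have "continuous_on (ball 0 1) (\<lambda>w. F (axis l w))"
      by (rule continuous_on_compose2[OF cont axc]) (auto simp: norm_axis)
    then have "(\<lambda>w. if w \<in> ball 0 1 then F (axis l w) else 0) \<in> borel_measurable borel"
      by (intro borel_measurable_continuous_on_if) auto
    moreover have "h = (\<lambda>w. (if w \<in> ball 0 1 then F (axis l w) else 0) * wt w)"
      by (auto simp: h_def)
    ultimately show ?thesis by simp
  qed
  define H where "H x = F (axis l (tanh x)) * inverse (cosh x) ^ (2 * m)" for x
  have tball: "tanh x \<in> ball 0 1" if "x \<in> strip" for x using tanh_strip_image that by blast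
  have Hhol: "H holomorphic_on strip"
  proof -
    have th: "tanh holomorphic_on strip"
      using tanh_strip_deriv strip_open by (auto simp: holomorphic_on_open)
    have "(\<lambda>x. F (axis l (tanh x))) holomorphic_on strip"
    proof (rule curve[OF strip_open])
      show "(\<lambda>x. axis l (tanh x) $ i) holomorphic_on strip" for i
        by (cases "i = l") (auto simp: axis_def intro: th)
    qed (use tball in \<open>auto simp: norm_axis\<close>)
    moreover have "cosh holomorphic_on strip"
      unfolding cosh_field_def[abs_def] by (intro holomorphic_intros) auto
    ultimately show ?thesis
      unfolding H_def using cosh_strip_nonzero by (intro holomorphic_intros) auto
  qed
  have tc: "1 - (cmod (tanh x))\<^sup>2 = cos (2 * Im x) / (cmod (cosh x))\<^sup>2" if "x \<in> strip" for x
    by (rule norm_tanh_strip[OF that])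
  \<comment> \<open>At the disc point \<open>tanh x\<close> the cusp form bound controls exponent
    \<open>m\<close> of the cosine. The exponent \<open>2 * (m - 1)\<close> is at least
    \<open>m\<close> because m >= 2, and the cosine is at most 1.\<close>
  have Hb: "cmod (H x) * cos (2 * Im x) ^ (2 * (m - 1)) \<le> M" if x: "x \<in> strip" for x
  proof -
    have c: "0 < cmod (cosh x)" "0 < cos (2 * Im x)" using cosh_strip_nonzero[OF x] cos_strip_pos[OF x] by auto
    have "cmod (F (axis l (tanh x))) * hgt (axis l (tanh x) :: complex ^ 'n) ^ m \<le> M"
      using tball[OF x] by (intro bound) (simp add: norm_axis)
    also have "hgt (axis l (tanh x) :: complex ^ 'n) = cos (2 * Im x) / (cmod (cosh x))\<^sup>2"
      by (simp add: hgt_eq norm_axis tc[OF x])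
    also have "(cos (2 * Im x) / (cmod (cosh x))\<^sup>2) ^ m = inverse (cmod (cosh x)) ^ (2 * m) * cos (2 * Im x) ^ m"
      by (simp add: power_mult_distrib power_inverse divide_inverse power_mult[symmetric])
    finally have "cmod (H x) * cos (2 * Im x) ^ m \<le> M"
      by (simp add: H_def norm_mult norm_power norm_inverse mult.assoc)
    moreover have "cmod (H x) * cos (2 * Im x) ^ (2 * (m - 1)) \<le> cmod (H x) * cos (2 * Im x) ^ m"
    proof (intro mult_left_mono power_decreasing)
      have "0 < CARD('n)" by simp
      with m show "m \<le> 2 * (m - 1)" by linarith
    qed (use c in auto)
    ultimately show ?thesis by linarith
  qed
  let ?c = "complex_of_real (pi ^ (CARD('n) - 1) * fact p / fact (2 * (m - 1)))"
  have "(\<integral>z. \<Psi> z \<partial>lborel) = (\<integral>z. (if z \<in> uball then F (axis l (z $ l)) * P (z $ l) (norm z) else 0) \<partial>lborel)"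
    unfolding \<Psi>P by (rule integral_rot_average[OF curve cont _ PF]) measurable
  also have "\<dots> = (\<integral>z. of_real (4 ^ CARD('n)) * (h (z $ l) * of_real ((max 0 (1 - (norm z)\<^sup>2)) ^ p)) \<partial>(lborel :: (complex ^ 'n) measure))"
  proof (intro Bochner_Integration.integral_cong refl)
    fix z :: "complex ^ 'n"
    show "(if z \<in> uball then F (axis l (z $ l)) * P (z $ l) (norm z) else 0) =
      of_real (4 ^ CARD('n)) * (h (z $ l) * of_real ((max 0 (1 - (norm z)\<^sup>2)) ^ p))"
    proof (cases "z \<in> uball")
      case True
      then show ?thesis using component_uball[OF True, of l] by (simp add: h_def P_def)
    next
      case False
      then have "1 \<le> (norm z)\<^sup>2" by (simp add: power2_ge_1_iff)
      with False p show ?thesis by (simp add: zero_power)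
    qed
  qed
  also have "\<dots> = of_real (4 ^ CARD('n)) * (?c * (\<integral>w. h w * of_real ((max 0 (1 - (cmod w)\<^sup>2)) ^ (2 * (m - 1))) \<partial>lborel))"
    unfolding integral_mult_right_zero integral_ball_power[OF p(1) hm, of l] p(3) ..
  also have "(\<integral>w. h w * of_real ((max 0 (1 - (cmod w)\<^sup>2)) ^ (2 * (m - 1))) \<partial>lborel)
    = (\<integral>w. indicator (tanh ` strip) w *\<^sub>R (h w * of_real ((max 0 (1 - (cmod w)\<^sup>2)) ^ (2 * (m - 1)))) \<partial>lborel)"
    unfolding tanh_strip_image by (intro Bochner_Integration.integral_cong refl) (simp add: h_def indicator_def)
  also have "\<dots> = (\<integral>x. indicator strip x *\<^sub>R (of_real ((cmod (inverse ((cosh x)\<^sup>2)))\<^sup>2) *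
      (h (tanh x) * of_real ((max 0 (1 - (cmod (tanh x))\<^sup>2)) ^ (2 * (m - 1))))) \<partial>lborel)"
    by (rule integral_holomorphic_substitution[OF strip_open tanh_strip_deriv tanh_strip_inj]) measurable
  also have "\<dots> = (\<integral>x. (if x \<in> strip \<and> 0 \<le> Re x \<and> Re x < s then H x * of_real (cos (2 * Im x) ^ (2 * (m - 1))) else 0) \<partial>lborel)"
  proof (intro Bochner_Integration.integral_cong refl)
    fix x
    show "indicator strip x *\<^sub>R (of_real ((cmod (inverse ((cosh x)\<^sup>2)))\<^sup>2) *
      (h (tanh x) * of_real ((max 0 (1 - (cmod (tanh x))\<^sup>2)) ^ (2 * (m - 1))))) =
      (if x \<in> strip \<and> 0 \<le> Re x \<and> Re x < s then H x * of_real (cos (2 * Im x) ^ (2 * (m - 1))) else 0)"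
    proof (cases "x \<in> strip")
      case x: True
      have c: "cosh x \<noteq> 0" "0 < cos (2 * Im x)" using cosh_strip_nonzero[OF x] cos_strip_pos[OF x] by auto
      have Ex: "E (tanh x) = exp (2 * Re x)" unfolding E_def by (rule tanh_strip_quotient[OF x])
      have mx: "max 0 (1 - (cmod (tanh x))\<^sup>2) = cos (2 * Im x) / (cmod (cosh x))\<^sup>2"
        unfolding tc[OF x] using c by simp
      have t2: "1 - (tanh x)\<^sup>2 = inverse ((cosh x)\<^sup>2)"
      proof -
        have "1 - (tanh x)\<^sup>2 = ((cosh x)\<^sup>2 - (sinh x)\<^sup>2) / (cosh x)\<^sup>2"
          using c by (simp add: tanh_def power_divide diff_divide_distrib)
        then show ?thesis by (simp add: hyperbolic_pythagoras inverse_eq_divide)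
      qed
      show ?thesis
      proof (cases "0 \<le> Re x \<and> Re x < s")
        case True
        \<comment> \<open>In the window the weight is the conjugated inverse power of 1 - tanh^2 =
          cosh^(-2), that is, a conjugated power of \<open>cosh x\<close>.\<close>
        have hx: "h (tanh x) = F (axis l (tanh x)) * cnj (cosh x ^ (2 * m))"
          using True tball[OF x] by (simp add: h_def wt_def Ex t2 power_inverse power_mult)
        define N where "N = cosh x * cnj (cosh x)"
        have N: "of_real ((cmod (cosh x))\<^sup>2) = N" "N \<noteq> 0"
          using c by (auto simp: N_def complex_norm_square simp del: of_real_power)
        have "of_real ((cmod (inverse ((cosh x)\<^sup>2)))\<^sup>2) = inverse (N\<^sup>2)"
          unfolding N(1)[symmetric] by (simp add: norm_inverse norm_power power_inverse power_mult[symmetric])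
        moreover have "complex_of_real ((cos (2 * Im x) / (cmod (cosh x))\<^sup>2) ^ (2 * (m - 1))) = of_real (cos (2 * Im x) ^ (2 * (m - 1))) * inverse (N ^ (2 * (m - 1)))"
          unfolding N(1)[symmetric] by (simp add: power_mult_distrib power_inverse divide_inverse)
        moreover have "inverse (N\<^sup>2) * inverse (N ^ (2 * (m - 1))) = inverse (N ^ (2 * m))"
        proof -
          have "2 * m = 2 + 2 * (m - 1)" using m by simp
          then show ?thesis by (metis inverse_mult_distrib power_add)
        qed
        \<comment> \<open>The area factor and the height contribute |cosh x|^(-4m) in all, and the
          weight cancels exactly the antiholomorphic half. The surviving cosh(x)^(-2m) is
          holomorphic, so all dependence that is not holomorphic sits in the cosine.\<close>
        moreover have "inverse (N ^ (2 * m)) * cnj (cosh x ^ (2 * m)) = inverse (cosh x) ^ (2 * m)"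
          using c by (simp add: N_def power_mult_distrib power_inverse field_simps)
        ultimately have "of_real ((cmod (inverse ((cosh x)\<^sup>2)))\<^sup>2) *
            (h (tanh x) * of_real ((cos (2 * Im x) / (cmod (cosh x))\<^sup>2) ^ (2 * (m - 1)))) = H x * of_real (cos (2 * Im x) ^ (2 * (m - 1)))"
          unfolding hx H_def by (simp add: mult_ac) (metis mult.assoc mult.commute)
        with True x show ?thesis by (simp add: mx)
      next
        case False
        then have "h (tanh x) = 0" by (auto simp: h_def wt_def Ex)
        with False x show ?thesis by auto
      qed
    qed simp
  qed
  also have "\<dots> = of_real (pi / 2 * fact (2 * (m - 1)) / (4 ^ (m - 1) * (fact (m - 1))\<^sup>2)) * integral {0..s} (\<lambda>t. H (of_real t))"
    by (rule integral_strip_Fubini[OF s Hhol _ Hb]) (simp_all add: H_def per)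
  also have "integral {0..s} (\<lambda>t. H (of_real t)) = integral {0..s} (\<lambda>t. F (axis l (of_real (tanh t))) * of_real (inverse (cosh t)) ^ (2 * m))"
    by (simp add: H_def tanh_def cosh_complex_of_real sinh_complex_of_real)
  finally have "(\<integral>z. \<Psi> z \<partial>lborel) = of_real (4 ^ CARD('n) * (pi ^ (CARD('n) - 1) * fact p / fact (2 * (m - 1)) * (pi / 2 * fact (2 * (m - 1)) / (4 ^ (m - 1) * (fact (m - 1))\<^sup>2))))
     * integral {0..s} (\<lambda>t. F (axis l (of_real (tanh t))) * of_real (inverse (cosh t)) ^ (2 * m))"
    by (simp add: mult.assoc)
  \<comment> \<open>The factorial of \<open>2 * (m - 1)\<close> from integrating out the other
    coordinates cancels the one in Wallis' integral.\<close>
  also have "4 ^ CARD('n) * (pi ^ (CARD('n) - 1) * fact p / fact (2 * (m - 1)) * (pi / 2 * fact (2 * (m - 1)) / (4 ^ (m - 1) * (fact (m - 1))\<^sup>2)))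
     = fact (2 * m - CARD('n) - 1) / (fact (m - 1))\<^sup>2 * pi ^ CARD('n) * (2 * 4 ^ CARD('n) / 4 ^ m)"
  proof -
    obtain k where k: "m = Suc k" using m by (cases m) auto
    obtain d where d: "CARD('n) = Suc d" using card_gt_0_iff[of "UNIV :: 'n set"] by (cases "CARD('n)") auto
    show ?thesis unfolding p_def[symmetric] unfolding d k by (simp add: field_simps)
  qed
  finally show "(\<integral>z. \<Psi> z \<partial>lborel) = of_real (fact (2 * m - CARD('n) - 1) / (fact (m - 1))\<^sup>2 * pi ^ CARD('n) * (2 * 4 ^ CARD('n) / 4 ^ m))
      * integral {0..s} (\<lambda>t. F (axis l (of_real (tanh t))) * of_real (inverse (cosh t)) ^ (2 * m))" .
qed

section \<open>Unfolding\<close>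

text \<open>Each point is isolated by a member of a countable basis, and distinct points need
  distinct members. Countability of the lattice permits unions of null sets over it and Fubini
  against its counting measure.\<close>

lemma countable_discrete:
  fixes S :: "'a::second_countable_topology set"
  assumes "discrete S"
  shows "countable S"
proof -
  obtain B :: "'a set set" where B: "countable B" "topological_basis B"
    using ex_countable_basis by blast
  have "\<exists>U\<in>B. U \<inter> S = {x}" if x: "x \<in> S" for x
  proof -
    obtain T where T: "open T" "T \<inter> S = {x}"
      using assms x unfolding discrete_def isolated_in_def by blast
    then obtain U where "U \<in> B" "x \<in> U" "U \<subseteq> T"
      using topological_basisE[OF B(2) T(1), of x] by blast
    with T x show ?thesis by (intro bexI[of _ U]) auto
  qed
  then obtain u where u: "\<And>x. x \<in> S \<Longrightarrow> u x \<in> B \<and> u x \<inter> S = {x}" by metis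
  then have "inj_on u S" by (metis inj_onI singleton_inject)
  moreover have "u ` S \<subseteq> B" using u by auto
  ultimately show ?thesis using B(1) countable_subset countable_image_inj_on by blast
qed

section \<open>Kernel of the action and fixed points\<close>

lemma mult_emb_nth: "(g *v emb z) $ k = g $ k $ None + (\<Sum>i\<in>UNIV. g $ k $ Some i * z $ i)"
  by (simp add: matrix_vector_mult_def sum_UNIV_option)

lemma mult_emb_axis: "(g *v emb (axis j x)) $ k = g $ k $ None + g $ k $ Some j * x"
  by (simp add: mult_emb_nth) (simp add: axis_def if_distrib[of "\<lambda>x. _ * x"] cong: if_cong)

text \<open>On a coordinate axis the fixed point equation is polynomial in the coordinate
  \<open>x\<close>. The origin clears the \<open>None\<close> column, and comparing
  \<open>x = 1/2\<close> with \<open>x = - 1/2\<close> separates the linear from the quadratic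
  coefficient.\<close>

lemma trivial_action_scalar:
  fixes g :: "('n::finite) mtx"
  assumes g: "g \<in> Un1" and triv: "\<And>z. z \<in> uball \<Longrightarrow> act g z = z"
  shows "g $ a $ b = (if a = b then g $ None $ None else 0)"
proof -
  have eq: "(g *v emb z) $ Some i = z $ i * (g *v emb z) $ None" if "z \<in> uball" for z i
  proof -
    have "act g z $ i = z $ i" using triv[OF that] by simp
    then show ?thesis using Un1_None_nonzero[OF g, of z] that by (simp add: act_def field_simps)
  qed
  have S0: "g $ Some i $ None = 0" for i
    using eq[of 0 i] by (simp add: emb_0 mult_axis_nth)
  have ax: "g $ Some i $ Some j * x = (if i = j then x * (g $ None $ None + g $ None $ Some j * x) else 0)" if "cmod x < 1" for i j x
  proof -
    have "(axis j x :: complex ^ 'n) \<in> uball" using that by (simp add: norm_axis)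
    from eq[OF this, of i] show ?thesis unfolding mult_emb_axis S0 by (simp add: axis_def)
  qed
  have p: "g $ Some i $ Some j = (if i = j then g $ None $ None + g $ None $ Some j / 2 else 0)" for i j
    using ax[of "1 / 2" i j] by (auto split: if_splits)
  have m: "g $ Some i $ Some j = (if i = j then g $ None $ None - g $ None $ Some j / 2 else 0)" for i j
    using ax[of "- 1 / 2" i j] by (auto split: if_splits)
  have N0: "g $ None $ Some j = 0" for j
    using p[of j j] m[of j j] by simp
  show ?thesis
    using S0 N0 p by (cases a; cases b) auto
qed

text \<open>A scalar matrix of determinant 1 is given by a root of unity of order n + 1. This makes
  the divisor in \<open>pet_inner\<close> a genuine positive count.\<close>

lemma finite_trivial_action:
  fixes \<Gamma> :: "('n::finite) mtx set"
  assumes "\<Gamma> \<subseteq> SUn1"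
  shows "finite {g\<in>\<Gamma>. \<forall>z\<in>uball. act g z = z}"
proof -
  let ?Z = "{g\<in>\<Gamma>. \<forall>z\<in>uball. act g z = z}"
  have sc: "g $ a $ b = (if a = b then g $ None $ None else 0)" if "g \<in> ?Z" for g a b
    using that assms SUn1_subset_Un1 by (intro trivial_action_scalar) auto
  have "(g $ None $ None) ^ CARD('n option) = 1" if "g \<in> ?Z" for g
  proof -
    have "det g = (\<Prod>i\<in>UNIV. g $ i $ i)"
      by (rule det_diagonal) (metis sc[OF that])
    also have "\<dots> = (\<Prod>i\<in>(UNIV :: 'n option set). g $ None $ None)"
      by (rule prod.cong) (metis sc[OF that])+
    finally show ?thesis using that assms by (auto simp: SUn1_def)
  qed
  then have "(\<lambda>g. g $ None $ None) ` ?Z \<subseteq> {x. x ^ CARD('n option) = 1}" by auto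
  moreover have "finite {x :: complex. x ^ CARD('n option) = 1}"
    by (rule finite_roots_unity) (simp add: Suc_le_eq)
  ultimately have "finite ((\<lambda>g. g $ None $ None) ` ?Z)" by (rule finite_subset)
  moreover have "inj_on (\<lambda>g. g $ None $ None) ?Z"
  proof (rule inj_onI)
    fix g h assume "g \<in> ?Z" "h \<in> ?Z" "g $ None $ None = h $ None $ None"
    then have "g $ a $ b = h $ a $ b" for a b using sc[of g a b] sc[of h a b] by simp
    then show "g = h" by (simp add: vec_eq_iff)
  qed
  ultimately show ?thesis by (rule finite_imageD)
qed

lemma null_sets_finite_slices:
  fixes A :: "(complex ^ 'n::finite) set"
  assumes [measurable]: "A \<in> sets borel" and fin: "\<And>z. finite {w. vupd z j w \<in> A}"
  shows "A \<in> null_sets lborel"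
proof -
  have "(\<integral>\<^sup>+z. indicator A z \<partial>lborel) = (\<integral>\<^sup>+z. 0 \<partial>(lborel :: (complex ^ 'n) measure))"
  proof (rule nn_integral_slice_cong[where i = j])
    fix z
    have "(\<integral>\<^sup>+w. indicator A (vupd z j w) \<partial>lborel) = (\<integral>\<^sup>+w. indicator {w. vupd z j w \<in> A} w \<partial>lborel)"
      by (intro nn_integral_cong) (simp add: indicator_def)
    also have "\<dots> = emeasure lborel {w. vupd z j w \<in> A}"
      using fin[of z] by (intro nn_integral_indicator) (auto intro: borel_closed finite_imp_closed)
    also have "\<dots> = 0"
      using finite_imp_null_set_lborel[OF fin[of z]] by (simp add: null_sets_def)
    finally show "(\<integral>\<^sup>+w. indicator A (vupd z j w) \<partial>lborel) = (\<integral>\<^sup>+w. 0 \<partial>(lborel :: complex measure))" by simp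
  qed measurable
  then show ?thesis by (simp add: null_sets_def)
qed

lemma finite_quadratic_roots:
  fixes a b c :: complex
  assumes "b \<noteq> 0 \<or> c \<noteq> 0"
  shows "finite {w. a + b * w + c * w * w = 0}"
proof -
  have "[:a, b, c:] \<noteq> 0" using assms by auto
  then have "finite {w. poly [:a, b, c:] w = 0}" by (rule poly_roots_finite)
  then show ?thesis by (simp add: algebra_simps)
qed

text \<open>
  Fixed points satisfy equations that are at most quadratic in each coordinate; one of them is
  nontrivial in some coordinate, unless the matrix is scalar.
\<close>

lemma AE_not_fixed:
  fixes g :: "('n::finite) mtx"
  assumes g: "g \<in> Un1" and nontriv: "\<exists>z\<in>uball. act g z \<noteq> z"
  shows "AE z in lborel. z \<in> uball \<longrightarrow> act g z \<noteq> z"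
proof -
  define e where "e i z = (g *v emb z) $ Some i - z $ i * (g *v emb z) $ None" for i and z :: "complex ^ 'n"
  have fixed: "e i z = 0" if "z \<in> uball" "act g z = z" for i z
  proof -
    have "act g z $ i = z $ i" using that by simp
    then show ?thesis using Un1_None_nonzero[OF g, of z] that by (simp add: act_def e_def field_simps)
  qed
  have row: "(g *v emb (vupd z j w)) $ k = (g *v emb (vupd z j 0)) $ k + g $ k $ Some j * w" for z j w k
  proof -
    have "(\<Sum>i\<in>UNIV. g $ k $ Some i * vupd z j w $ i) = (\<Sum>i\<in>UNIV. g $ k $ Some i * vupd z j 0 $ i + (if i = j then g $ k $ Some j * w else 0))"
      by (intro sum.cong) auto
    then show ?thesis unfolding mult_emb_nth by (simp add: sum.distrib)
  qed
  have eslice: "e i (vupd z j w) = ((g *v emb (vupd z j 0)) $ Some i - (if i = j then 0 else z $ i * (g *v emb (vupd z j 0)) $ None))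
      + (g $ Some i $ Some j - (if i = j then (g *v emb (vupd z j 0)) $ None else z $ i * g $ None $ Some j)) * w
      + (if i = j then - g $ None $ Some j else 0) * w * w" for i j z w
    unfolding e_def row[of z j w] by (simp add: algebra_simps)
  have null: "AE z in lborel. z \<in> uball \<longrightarrow> act g z \<noteq> z"
    if "\<And>z. finite {w. e i (vupd z j w) = 0}" for i j
  proof -
    have "{z. e i z = 0} \<in> null_sets lborel"
    proof (rule null_sets_finite_slices)
      have [measurable]: "e i \<in> borel_measurable borel" unfolding e_def by measurable
      show "{z. e i z = 0} \<in> sets borel" by measurable
      show "finite {w. vupd z j w \<in> {z. e i z = 0}}" for z using that[of z] by simp
    qed
    from AE_not_in[OF this] show ?thesis by eventually_elim (use fixed in auto)
  qed
  \<comment> \<open>The cases say which coefficient of a sliced equation is nonzero: the quadratic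
    one, the linear one, or, when all others vanish, the constant term of some component.\<close>
  consider (quad) j where "g $ None $ Some j \<noteq> 0"
    | (lin) i j where "\<And>j. g $ None $ Some j = 0" "g $ Some i $ Some j \<noteq> (if i = j then g $ None $ None else 0)"
    | (const) "\<And>j. g $ None $ Some j = 0" "\<And>i j. g $ Some i $ Some j = (if i = j then g $ None $ None else 0)"
    by blast
  then show ?thesis
  proof cases
    case quad
    show ?thesis
      by (rule null[of j j], subst eslice, rule finite_quadratic_roots) (use quad in simp)
  next
    case lin
    have "(g *v emb (vupd z j 0)) $ None = g $ None $ None" for z
      by (simp add: mult_emb_nth lin(1))
    then show ?thesis
      using lin by (intro null[of i j], subst eslice, intro finite_quadratic_roots) auto
  next
    case const
    have N: "(g *v emb z) $ None = g $ None $ None" for z by (simp add: mult_emb_nth const(1))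
    have S: "(g *v emb z) $ Some i = g $ Some i $ None + g $ None $ None * z $ i" for i z
      by (simp add: mult_emb_nth const(2) if_distrib[of "\<lambda>x. x * _"] cong: if_cong)
    have ne: "\<exists>i. g $ Some i $ None \<noteq> 0"
    proof (rule ccontr)
      assume "\<not> ?thesis"
      then have "act g z = z" if "z \<in> uball" for z
        using Un1_None_nonzero[OF g, of z] that by (simp add: vec_eq_iff act_def N S)
      with nontriv show False by auto
    qed
    then obtain i where "g $ Some i $ None \<noteq> 0" by blast
    then have "e i z \<noteq> 0" for z by (simp add: e_def N S)
    with fixed show ?thesis by (intro always_eventually) blast
  qed
qed

lemma sigma_finite_inv_vol: "sigma_finite_measure (inv_vol :: (complex ^ 'n::finite) measure)"
  unfolding inv_vol_def
  by (subst sigma_finite_measure.sigma_finite_iff_density_finite[OF lborel.sigma_finite_measure_axioms])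
    (auto intro!: measurable_compose[OF _ measurable_ennreal])

lemma sets_inv_vol [simp, measurable_cong]: "sets inv_vol = sets borel"
  by (simp add: inv_vol_def)

lemma space_inv_vol [simp]: "space inv_vol = UNIV"
  by (simp add: inv_vol_def)

lemma AE_inv_vol_I:
  assumes "AE z in lborel. z \<in> uball \<longrightarrow> P z"
  shows "AE z in inv_vol. P z"
proof -
  have "AE z in lborel. 0 < ennreal (indicator uball z * (4 ^ CARD('a) / hgt z ^ (CARD('a) + 1))) \<longrightarrow> P z"
    using assms by eventually_elim (auto simp: indicator_def split: if_splits)
  then show ?thesis unfolding inv_vol_def by (subst AE_density) auto
qed

lemma subgroup_SUn1_D:
  assumes "subgroup_SUn1 \<Gamma>"
  shows "\<Gamma> \<subseteq> SUn1" "\<gamma> \<in> \<Gamma> \<Longrightarrow> \<gamma> \<in> Un1" "mat 1 \<in> \<Gamma>" "a \<in> \<Gamma> \<Longrightarrow> b \<in> \<Gamma> \<Longrightarrow> a ** b \<in> \<Gamma>" "a \<in> \<Gamma> \<Longrightarrow> matrix_inv a \<in> \<Gamma>"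
  using assms SUn1_subset_Un1 unfolding subgroup_SUn1_def by auto

text \<open>Outside countably many null sets, a point \<open>z\<close> is fixed only by the kernel
  of the action. If \<open>\<gamma>1\<close> moves \<open>z\<close> to its representative in
  \<open>F\<close>, the elements whose inverse moves \<open>z\<close> into \<open>F\<close> are the
  products of a kernel element with the inverse of \<open>\<gamma>1\<close>, so they are as many as
  the kernel elements.\<close>

lemma card_fundamental_set_orbit:
  fixes \<Gamma> :: "('n::finite) mtx set"
  assumes \<Gamma>: "subgroup_SUn1 \<Gamma>" "countable \<Gamma>" and F: "fundamental_set \<Gamma> F"
  shows "AE z in inv_vol. card {\<gamma>\<in>\<Gamma>. act (matrix_inv \<gamma>) z \<in> F} = card {\<gamma>\<in>\<Gamma>. \<forall>z\<in>uball. act \<gamma> z = z}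
    \<and> finite {\<gamma>\<in>\<Gamma>. act (matrix_inv \<gamma>) z \<in> F}"
proof (rule AE_inv_vol_I)
  note G = subgroup_SUn1_D[OF \<Gamma>(1)]
  let ?Z = "{\<gamma>\<in>\<Gamma>. \<forall>z\<in>uball. act \<gamma> z = z}"
  have 1: "AE z in lborel. z \<in> uball \<longrightarrow> (\<exists>!p. p \<in> F \<and> (\<exists>\<gamma>\<in>\<Gamma>. p = act \<gamma> z))"
    using F by (simp add: fundamental_set_def)
  have "AE z in lborel. \<forall>\<gamma>\<in>\<Gamma> - ?Z. z \<in> uball \<longrightarrow> act \<gamma> z \<noteq> z"
  proof (subst AE_ball_countable)
    show "\<forall>\<gamma>\<in>\<Gamma> - ?Z. AE z in lborel. z \<in> uball \<longrightarrow> act \<gamma> z \<noteq> z"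
    proof
      fix \<gamma> assume "\<gamma> \<in> \<Gamma> - ?Z"
      then have "\<gamma> \<in> Un1" "\<exists>z\<in>uball. act \<gamma> z \<noteq> z" using G(2) by auto
      then show "AE z in lborel. z \<in> uball \<longrightarrow> act \<gamma> z \<noteq> z" by (rule AE_not_fixed)
    qed
  qed (use \<Gamma>(2) in auto)
  with 1 show "AE z in lborel. z \<in> uball \<longrightarrow>
    card {\<gamma>\<in>\<Gamma>. act (matrix_inv \<gamma>) z \<in> F} = card ?Z \<and> finite {\<gamma>\<in>\<Gamma>. act (matrix_inv \<gamma>) z \<in> F}"
  proof eventually_elim
    fix z
    assume ex: "z \<in> uball \<longrightarrow> (\<exists>!p. p \<in> F \<and> (\<exists>\<gamma>\<in>\<Gamma>. p = act \<gamma> z))"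
      and stab: "\<forall>\<gamma>\<in>\<Gamma> - ?Z. z \<in> uball \<longrightarrow> act \<gamma> z \<noteq> z"
    show "z \<in> uball \<longrightarrow> card {\<gamma>\<in>\<Gamma>. act (matrix_inv \<gamma>) z \<in> F} = card ?Z \<and> finite {\<gamma>\<in>\<Gamma>. act (matrix_inv \<gamma>) z \<in> F}"
    proof
      assume z: "z \<in> uball"
      then have zc: "z \<in> cball 0 1" by simp
      obtain \<gamma>1 where \<gamma>1: "\<gamma>1 \<in> \<Gamma>" "act \<gamma>1 z \<in> F"
        and uniq: "\<And>\<gamma>. \<gamma> \<in> \<Gamma> \<Longrightarrow> act \<gamma> z \<in> F \<Longrightarrow> act \<gamma> z = act \<gamma>1 z"
        using ex z by blast
      define t where "t \<sigma> = \<sigma> ** matrix_inv \<gamma>1" for \<sigma> :: "'n mtx"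
      have im: "{\<gamma>\<in>\<Gamma>. act (matrix_inv \<gamma>) z \<in> F} = t ` ?Z"
      proof (intro equalityI subsetI)
        fix \<gamma> assume "\<gamma> \<in> {\<gamma>\<in>\<Gamma>. act (matrix_inv \<gamma>) z \<in> F}"
        then have \<gamma>: "\<gamma> \<in> \<Gamma>" "act (matrix_inv \<gamma>) z \<in> F" by auto
        have e: "act (matrix_inv \<gamma>) z = act \<gamma>1 z" by (rule uniq[OF G(5)[OF \<gamma>(1)] \<gamma>(2)])
        have "act (\<gamma> ** \<gamma>1) z = act \<gamma> (act \<gamma>1 z)" by (rule act_comp[OF G(2)[OF \<gamma>1(1)] zc])
        also have "\<dots> = z" unfolding e[symmetric] by (rule act_inverse(2)[OF G(2)[OF \<gamma>(1)] zc])
        finally have "\<gamma> ** \<gamma>1 \<in> ?Z" using stab z G(4)[OF \<gamma>(1) \<gamma>1(1)] by blast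
        moreover have "\<gamma> = t (\<gamma> ** \<gamma>1)"
          by (simp add: t_def matrix_mul_assoc[symmetric] Un1_inverse[OF G(2)[OF \<gamma>1(1)]])
        ultimately show "\<gamma> \<in> t ` ?Z" by blast
      next
        fix \<gamma> assume "\<gamma> \<in> t ` ?Z"
        then obtain \<sigma> where \<sigma>: "\<sigma> \<in> \<Gamma>" "\<And>z. z \<in> uball \<Longrightarrow> act \<sigma> z = z" "\<gamma> = t \<sigma>" by blast
        have \<gamma>: "\<gamma> \<in> \<Gamma>" unfolding \<sigma>(3) t_def using \<sigma>(1) \<gamma>1(1) by (intro G(4) G(5))
        have u: "act \<gamma>1 z \<in> uball" by (rule act_uball[OF G(2)[OF \<gamma>1(1)] z])
        have "act \<gamma> (act \<gamma>1 z) = act \<sigma> (act (matrix_inv \<gamma>1) (act \<gamma>1 z))"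
          unfolding \<sigma>(3) t_def using u by (intro act_comp Un1_matrix_inv G(2)[OF \<gamma>1(1)]) auto
        also have "\<dots> = z" using \<sigma>(2)[OF z] act_inverse(1)[OF G(2)[OF \<gamma>1(1)] zc] by simp
        finally have "act (matrix_inv \<gamma>) z = act \<gamma>1 z"
          using act_inverse(1)[OF G(2)[OF \<gamma>], of "act \<gamma>1 z"] u by auto
        with \<gamma> \<gamma>1 show "\<gamma> \<in> {\<gamma>\<in>\<Gamma>. act (matrix_inv \<gamma>) z \<in> F}" by simp
      qed
      have "inj_on t ?Z"
      proof (rule inj_onI)
        fix \<sigma> \<tau> assume "t \<sigma> = t \<tau>"
        then have "t \<sigma> ** \<gamma>1 = t \<tau> ** \<gamma>1" by simp
        then show "\<sigma> = \<tau>" by (simp add: t_def matrix_mul_assoc[symmetric] Un1_inverse[OF G(2)[OF \<gamma>1(1)]])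
      qed
      then show "card {\<gamma>\<in>\<Gamma>. act (matrix_inv \<gamma>) z \<in> F} = card ?Z \<and> finite {\<gamma>\<in>\<Gamma>. act (matrix_inv \<gamma>) z \<in> F}"
        unfolding im using finite_trivial_action[OF G(1)] by (simp add: card_image)
    qed
  qed
qed

lemma measurable_pair_count_space:
  assumes "countable A" and [measurable]: "\<And>y. y \<in> A \<Longrightarrow> (\<lambda>x. f x y) \<in> M \<rightarrow>\<^sub>M K"
  shows "(\<lambda>(x, y). f x y) \<in> M \<Otimes>\<^sub>M count_space A \<rightarrow>\<^sub>M K"
  unfolding case_prod_unfold
  by (rule measurable_compose_countable'[where f = "\<lambda>a b. f (fst b) a" and g = snd and I = A])
    (use assms(1) in auto)

text \<open>For complex families unconditional and absolute summability coincide, so in the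
  divergent case both sides take the default value 0.\<close>

lemma infsum_eq_integral_count_space:
  fixes f :: "'a \<Rightarrow> complex"
  shows "infsum f A = (\<integral>x. f x \<partial>count_space A)"
proof (cases "integrable (count_space A) f")
  case True
  then show ?thesis
    using infsetsum_infsum[of f A] by (simp add: Infinite_Set_Sum.abs_summable_on_def infsetsum_def)
next
  case False
  then have "\<not> Infinite_Sum.abs_summable_on f A"
    unfolding abs_summable_equivalent Infinite_Set_Sum.abs_summable_on_def .
  then have "\<not> f summable_on A"
    using summable_on_iff_abs_summable_on_complex by blast
  with False show ?thesis by (simp add: infsum_not_exists not_integrable_integral_eq)
qed

text \<open>The map (z, \<gamma>) to \<gamma>z sends the measure on F x \<Gamma> to the volume times
  the order of the kernel. Since this is an identity of measures, integrability of
  \<open>\<psi>\<close> on the ball passes to F x \<Gamma>, and Fubini then gives the sum over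
  \<open>\<Gamma>\<close> under the integral over \<open>F\<close>.\<close>

lemma integral_unfolding:
  fixes \<Gamma> :: "('n::finite) mtx set" and \<psi> :: "complex ^ 'n \<Rightarrow> complex"
  assumes \<Gamma>: "subgroup_SUn1 \<Gamma>" "countable \<Gamma>" and F: "fundamental_set \<Gamma> F"
    and int: "integrable inv_vol \<psi>"
  shows "(LINT z:F|inv_vol. (\<Sum>\<^sub>\<infinity>\<gamma>\<in>\<Gamma>. \<psi> (act \<gamma> z))) =
    of_nat (card {\<gamma>\<in>\<Gamma>. \<forall>z\<in>uball. act \<gamma> z = z}) * (\<integral>z. \<psi> z \<partial>inv_vol)"
proof -
  note G = subgroup_SUn1_D[OF \<Gamma>(1)]
  let ?Z = "{\<gamma>\<in>\<Gamma>. \<forall>z\<in>uball. act \<gamma> z = z}"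
  let ?C = "count_space \<Gamma>"
  interpret V: sigma_finite_measure "inv_vol :: (complex ^ 'n) measure" by (rule sigma_finite_inv_vol)
  interpret C: sigma_finite_measure ?C by (rule sigma_finite_measure_count_space_countable[OF \<Gamma>(2)])
  interpret VC: pair_sigma_finite "inv_vol :: (complex ^ 'n) measure" ?C ..
  have [measurable]: "F \<in> sets borel" using F by (simp add: fundamental_set_def)
  have am [measurable]: "(\<lambda>(z, \<gamma>). act \<gamma> z) \<in> inv_vol \<Otimes>\<^sub>M ?C \<rightarrow>\<^sub>M borel"
    by (rule measurable_pair_count_space[OF \<Gamma>(2)]) measurable
  have fm [measurable]: "(\<lambda>x. indicator F (fst x) :: real) \<in> inv_vol \<Otimes>\<^sub>M ?C \<rightarrow>\<^sub>M borel"
    using measurable_pair_count_space[OF \<Gamma>(2), of "\<lambda>z \<gamma>. indicator F z :: real" inv_vol borel] by (simp add: case_prod_unfold)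
  have [measurable]: "\<psi> \<in> borel_measurable borel"
    using borel_measurable_integrable[OF int] by (simp add: measurable_cong_sets[OF sets_inv_vol refl])
  define D where "D = density (inv_vol \<Otimes>\<^sub>M ?C) (\<lambda>x. ennreal (indicator F (fst x)))"
  have Dm: "(\<lambda>(z, \<gamma>). act \<gamma> z) \<in> D \<rightarrow>\<^sub>M borel" using am by (simp add: D_def)
  have M: "distr D borel (\<lambda>(z, \<gamma>). act \<gamma> z) = density inv_vol (\<lambda>_. ennreal (real (card ?Z)))"
  proof (rule measure_eqI)
    fix A assume "A \<in> sets (distr D borel (\<lambda>(z, \<gamma>). act \<gamma> z))"
    then have A [measurable]: "A \<in> sets borel" by simp
    have "emeasure (distr D borel (\<lambda>(z, \<gamma>). act \<gamma> z)) A = (\<integral>\<^sup>+x. indicator A x \<partial>distr D borel (\<lambda>(z, \<gamma>). act \<gamma> z))"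
      by simp
    also have "\<dots> = (\<integral>\<^sup>+(z, \<gamma>). indicator A (act \<gamma> z) \<partial>D)"
      by (subst nn_integral_distr[OF Dm]) (auto simp: case_prod_unfold)
    also have "\<dots> = (\<integral>\<^sup>+(z, \<gamma>). ennreal (indicator F z) * indicator A (act \<gamma> z) \<partial>(inv_vol \<Otimes>\<^sub>M ?C))"
      unfolding D_def by (subst nn_integral_density) (auto simp: case_prod_unfold)
    also have "\<dots> = (\<integral>\<^sup>+\<gamma>. (\<integral>\<^sup>+z. ennreal (indicator F z) * indicator A (act \<gamma> z) \<partial>inv_vol) \<partial>?C)"
      by (subst VC.nn_integral_snd[symmetric]) (auto simp: case_prod_unfold)
    \<comment> \<open>Invariance of the volume moves the group element from \<open>A\<close> to
      \<open>F\<close>, where the elements can be counted for fixed \<open>z\<close>.\<close>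
    also have "\<dots> = (\<integral>\<^sup>+\<gamma>. (\<integral>\<^sup>+z. indicator F (act (matrix_inv \<gamma>) z) * indicator A z \<partial>inv_vol) \<partial>?C)"
    proof (rule nn_integral_cong)
      fix \<gamma> assume "\<gamma> \<in> space ?C"
      then have \<gamma>: "\<gamma> \<in> Un1" using G(2) by simp
      have "(\<integral>\<^sup>+z. ennreal (indicator F z) * indicator A (act \<gamma> z) \<partial>inv_vol)
          = (\<integral>\<^sup>+z. indicator F (act (matrix_inv \<gamma>) (act \<gamma> z)) * indicator A (act \<gamma> z) \<partial>inv_vol)"
        by (intro nn_integral_cong_AE eventually_mono[OF AE_inv_vol_uball])
          (simp add: act_inverse[OF \<gamma>] ennreal_indicator)
      also have "\<dots> = (\<integral>\<^sup>+z. indicator F (act (matrix_inv \<gamma>) z) * indicator A z \<partial>inv_vol)"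
        by (rule nn_integral_inv_vol_act[OF \<gamma>]) measurable
      finally show "(\<integral>\<^sup>+z. ennreal (indicator F z) * indicator A (act \<gamma> z) \<partial>inv_vol)
          = (\<integral>\<^sup>+z. indicator F (act (matrix_inv \<gamma>) z) * indicator A z \<partial>inv_vol)" .
    qed
    also have "\<dots> = (\<integral>\<^sup>+z. (\<integral>\<^sup>+\<gamma>. indicator F (act (matrix_inv \<gamma>) z) * indicator A z \<partial>?C) \<partial>inv_vol)"
    proof (rule VC.Fubini')
      show "(\<lambda>(z, \<gamma>). indicator F (act (matrix_inv \<gamma>) z) * indicator A z :: ennreal) \<in> borel_measurable (inv_vol \<Otimes>\<^sub>M ?C)"
        by (rule measurable_pair_count_space[OF \<Gamma>(2)]) measurable
    qed
    also have "\<dots> = (\<integral>\<^sup>+z. ennreal (real (card ?Z)) * indicator A z \<partial>inv_vol)"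
    proof (intro nn_integral_cong_AE eventually_mono[OF card_fundamental_set_orbit[OF \<Gamma> F]])
      fix z
      assume c: "card {\<gamma>\<in>\<Gamma>. act (matrix_inv \<gamma>) z \<in> F} = card ?Z \<and> finite {\<gamma>\<in>\<Gamma>. act (matrix_inv \<gamma>) z \<in> F}"
      have "(\<integral>\<^sup>+\<gamma>. indicator F (act (matrix_inv \<gamma>) z) \<partial>?C) = (\<integral>\<^sup>+\<gamma>. indicator {\<gamma>\<in>\<Gamma>. act (matrix_inv \<gamma>) z \<in> F} \<gamma> \<partial>?C)"
        by (intro nn_integral_cong) (auto simp: indicator_def)
      also have "\<dots> = emeasure ?C {\<gamma>\<in>\<Gamma>. act (matrix_inv \<gamma>) z \<in> F}" by (rule nn_integral_indicator) auto
      also have "\<dots> = ennreal (real (card ?Z))" using c by (subst emeasure_count_space_finite) (auto simp: ennreal_of_nat_eq_real_of_nat)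
      finally show "(\<integral>\<^sup>+\<gamma>. indicator F (act (matrix_inv \<gamma>) z) * indicator A z \<partial>?C) = ennreal (real (card ?Z)) * indicator A z"
        by (simp add: nn_integral_multc)
    qed
    also have "\<dots> = emeasure (density inv_vol (\<lambda>_. ennreal (real (card ?Z)))) A"
      by (simp add: emeasure_density)
    finally show "emeasure (distr D borel (\<lambda>(z, \<gamma>). act \<gamma> z)) A = emeasure (density inv_vol (\<lambda>_. ennreal (real (card ?Z)))) A" .
  qed simp
  have "integrable (density inv_vol (\<lambda>_. ennreal (real (card ?Z)))) \<psi>"
    using int by (subst integrable_density) (auto intro: integrable_scaleR_right)
  then have "integrable D (\<lambda>x. \<psi> (case x of (z, \<gamma>) \<Rightarrow> act \<gamma> z))"
    unfolding M[symmetric] by (subst (asm) integrable_distr_eq[OF Dm]) auto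
  moreover have \<psi>m: "(\<lambda>x. \<psi> (case x of (z, \<gamma>) \<Rightarrow> act \<gamma> z)) \<in> borel_measurable (inv_vol \<Otimes>\<^sub>M ?C)"
    by measurable
  ultimately have I: "integrable (inv_vol \<Otimes>\<^sub>M ?C) (\<lambda>x. indicator F (fst x) *\<^sub>R \<psi> (case x of (z, \<gamma>) \<Rightarrow> act \<gamma> z))"
    unfolding D_def by (subst (asm) integrable_density) auto
  have "of_nat (card ?Z) * (\<integral>z. \<psi> z \<partial>inv_vol) = (\<integral>z. \<psi> z \<partial>density inv_vol (\<lambda>_. ennreal (real (card ?Z))))"
    by (subst integral_density) (auto simp: scaleR_conv_of_real)
  also have "\<dots> = (\<integral>x. \<psi> (case x of (z, \<gamma>) \<Rightarrow> act \<gamma> z) \<partial>D)"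
    unfolding M[symmetric] by (rule integral_distr[OF Dm]) measurable
  also have "\<dots> = (\<integral>x. indicator F (fst x) *\<^sub>R \<psi> (case x of (z, \<gamma>) \<Rightarrow> act \<gamma> z) \<partial>(inv_vol \<Otimes>\<^sub>M ?C))"
    unfolding D_def by (subst integral_density) (auto intro: \<psi>m)
  also have "\<dots> = (\<integral>z. (\<integral>\<gamma>. indicator F z *\<^sub>R \<psi> (act \<gamma> z) \<partial>?C) \<partial>inv_vol)"
    using VC.integral_fst'[OF I] by simp
  also have "\<dots> = (\<integral>z. indicator F z *\<^sub>R (\<Sum>\<^sub>\<infinity>\<gamma>\<in>\<Gamma>. \<psi> (act \<gamma> z)) \<partial>inv_vol)"
    by (intro Bochner_Integration.integral_cong refl) (simp add: infsum_eq_integral_count_space)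
  finally show ?thesis by (simp add: set_lebesgue_integral_def)
qed

section \<open>Cyclic subgroups and cosets\<close>

text \<open>Natural exponents only: an element of the cyclic group is treated as a quotient of two
  such powers.\<close>

primrec mpow :: "('n::finite) mtx \<Rightarrow> nat \<Rightarrow> 'n mtx"
  where "mpow g 0 = mat 1" | "mpow g (Suc k) = g ** mpow g k"

lemma mpow_add: "mpow g a ** mpow g b = mpow g (a + b)"
  by (induction a) (simp_all add: matrix_mul_assoc[symmetric])

lemma mpow_commute: "mpow g a ** mpow g b = mpow g b ** mpow g a"
  by (simp add: mpow_add add.commute)

lemma subgroup_SUn1_SUn1: "subgroup_SUn1 (SUn1 :: ('n::finite) mtx set)"
proof -
  have "matrix_inv a \<in> SUn1" if a: "a \<in> SUn1" for a :: "'n mtx"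
  proof -
    have aU: "a \<in> Un1" using a SUn1_subset_Un1 by auto
    have "det (matrix_inv a) * det a = det (matrix_inv a ** a)" by (simp add: det_mul)
    also have "\<dots> = 1" by (simp add: Un1_inverse[OF aU])
    finally have "det (matrix_inv a) = 1" using a by (simp add: SUn1_def)
    with Un1_matrix_inv[OF aU] show ?thesis by (simp add: SUn1_def Un1_def)
  qed
  moreover have "a ** b \<in> SUn1" if "a \<in> SUn1" "b \<in> SUn1" for a b :: "'n mtx"
    using that by (simp add: SUn1_def det_mul matrix_vector_mul_assoc[symmetric])
  moreover have "mat 1 \<in> (SUn1 :: 'n mtx set)" by (simp add: SUn1_def)
  ultimately show ?thesis by (simp add: subgroup_SUn1_def)
qed

lemma subgroup_cyclic:
  fixes \<gamma> :: "('n::finite) mtx"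
  assumes "\<gamma> \<in> SUn1"
  shows "subgroup_SUn1 (cyclic_SUn1 \<gamma>)" "\<gamma> \<in> cyclic_SUn1 \<gamma>"
proof -
  have m: "x \<in> cyclic_SUn1 \<gamma> \<longleftrightarrow> (\<forall>H. subgroup_SUn1 H \<and> \<gamma> \<in> H \<longrightarrow> x \<in> H)" for x
    by (auto simp: cyclic_SUn1_def hull_def)
  show "\<gamma> \<in> cyclic_SUn1 \<gamma>" by (simp add: m)
  have "cyclic_SUn1 \<gamma> \<subseteq> SUn1" using m subgroup_SUn1_SUn1 assms by blast
  then show "subgroup_SUn1 (cyclic_SUn1 \<gamma>)"
    unfolding subgroup_SUn1_def[of "cyclic_SUn1 \<gamma>"]
    by (auto simp: m) (auto simp: subgroup_SUn1_def)
qed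

lemma cyclic_minimal: "subgroup_SUn1 H \<Longrightarrow> \<gamma> \<in> H \<Longrightarrow> cyclic_SUn1 \<gamma> \<subseteq> H"
  unfolding cyclic_SUn1_def by (rule hull_minimal) auto

lemma matrix_inv_unique_right:
  assumes "g \<in> Un1" "a ** g = b ** g"
  shows "a = b"
proof -
  have "(a ** g) ** matrix_inv g = (b ** g) ** matrix_inv g" using assms by simp
  then show ?thesis by (simp add: matrix_mul_assoc[symmetric] Un1_inverse[OF assms(1)])
qed

lemma mpow_in_subgroup:
  assumes "subgroup_SUn1 H" "\<gamma> \<in> H"
  shows "mpow \<gamma> k \<in> H"
  using assms by (induction k) (auto simp: subgroup_SUn1_def)

text \<open>The elements expressible in this way form a subgroup containing \<open>\<gamma>\<close>,
  because powers of \<open>\<gamma>\<close> commute, and the cyclic group is the smallest such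
  subgroup.\<close>

lemma cyclic_element:
  fixes \<gamma> :: "('n::finite) mtx"
  assumes \<gamma>: "\<gamma> \<in> SUn1" and \<sigma>: "\<sigma> \<in> cyclic_SUn1 \<gamma>"
  shows "\<exists>a b. \<sigma> ** mpow \<gamma> a = mpow \<gamma> b"
proof -
  let ?H = "{\<sigma>\<in>SUn1. \<exists>a b. \<sigma> ** mpow \<gamma> a = mpow \<gamma> b}"
  note S = subgroup_SUn1_SUn1[unfolded subgroup_SUn1_def]
  have "subgroup_SUn1 ?H"
    unfolding subgroup_SUn1_def
  proof (intro conjI ballI)
    show "mat 1 \<in> ?H" using S by auto
    show "x ** y \<in> ?H" if xy: "x \<in> ?H" "y \<in> ?H" for x y
    proof -
      obtain a b a' b' where e: "x ** mpow \<gamma> a = mpow \<gamma> b" "y ** mpow \<gamma> a' = mpow \<gamma> b'" and "x \<in> SUn1" "y \<in> SUn1"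
        using xy by blast
      have "(x ** y) ** mpow \<gamma> (a' + a) = x ** (y ** mpow \<gamma> a') ** mpow \<gamma> a"
        by (simp add: mpow_add[symmetric] matrix_mul_assoc)
      also have "\<dots> = x ** mpow \<gamma> a ** mpow \<gamma> b'"
        by (simp add: e(2) matrix_mul_assoc[symmetric] mpow_commute[of \<gamma> b' a])
      also have "\<dots> = mpow \<gamma> (b + b')" by (simp add: e(1) mpow_add)
      finally show ?thesis using \<open>x \<in> SUn1\<close> \<open>y \<in> SUn1\<close> S by blast
    qed
    show "matrix_inv x \<in> ?H" if xH: "x \<in> ?H" for x
    proof -
      obtain a b where e: "x ** mpow \<gamma> a = mpow \<gamma> b" and x: "x \<in> SUn1" using xH by blast
      have xU: "x \<in> Un1" using x SUn1_subset_Un1 by auto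
      have "matrix_inv x ** mpow \<gamma> b = mpow \<gamma> a"
        unfolding e[symmetric] by (simp add: matrix_mul_assoc Un1_inverse[OF xU])
      with x S show ?thesis by blast
    qed
  qed auto
  moreover have "\<gamma> ** mpow \<gamma> 0 = mpow \<gamma> 1" by simp
  then have "\<gamma> \<in> ?H" using \<gamma> by blast
  ultimately have "cyclic_SUn1 \<gamma> \<subseteq> ?H" by (rule cyclic_minimal)
  with \<sigma> show ?thesis by blast
qed

text \<open>The cyclic group translates the logarithm of \<open>E\<close> by multiples of
  \<open>2 * s\<close>: a quotient of the powers with exponents \<open>b\<close> and
  \<open>a\<close> translates by \<open>b - a\<close> steps. Exactly one number of steps reaches the
  window, and it determines the group element because powers can be cancelled on the right.\<close>

lemma cyclic_window:
  fixes \<gamma> :: "('n::finite) mtx" and E :: "complex ^ 'n \<Rightarrow> real"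
  assumes \<gamma>: "\<gamma> \<in> SUn1" and s: "0 < s"
    and E: "\<And>x. x \<in> uball \<Longrightarrow> E (act \<gamma> x) = exp (2 * s) * E x" "\<And>x. x \<in> uball \<Longrightarrow> 0 < E x"
    and x: "x \<in> uball"
  shows "\<exists>!\<sigma>. \<sigma> \<in> cyclic_SUn1 \<gamma> \<and> 1 \<le> E (act \<sigma> x) \<and> E (act \<sigma> x) < exp (2 * s)"
proof -
  have \<gamma>U: "\<gamma> \<in> Un1" using \<gamma> SUn1_subset_Un1 by auto
  note C = subgroup_cyclic[OF \<gamma>]
  note G = C(1)[unfolded subgroup_SUn1_def]
  have U: "\<sigma> \<in> Un1" if "\<sigma> \<in> cyclic_SUn1 \<gamma>" for \<sigma> using that G SUn1_subset_Un1 by auto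
  have pw: "mpow \<gamma> k \<in> cyclic_SUn1 \<gamma>" for k by (rule mpow_in_subgroup[OF C])
  have Epow: "E (act (mpow \<gamma> k) y) = exp (2 * s * real k) * E y" if "y \<in> uball" for y k
  proof (induction k)
    case (Suc k)
    have "act (mpow \<gamma> (Suc k)) y = act \<gamma> (act (mpow \<gamma> k) y)"
      using act_comp[OF U[OF pw[of k]], of y \<gamma>] that by simp
    then have "E (act (mpow \<gamma> (Suc k)) y) = exp (2 * s) * exp (2 * s * real k) * E y"
      using E(1)[OF act_uball[OF U[OF pw[of k]] that]] Suc by simp
    also have "exp (2 * s) * exp (2 * s * real k) = exp (2 * s * real (Suc k))"
      unfolding exp_add[symmetric] by (simp add: algebra_simps)
    finally show ?case .
  qed simp
  have Egen: "E (act \<sigma> x) = exp (2 * s * (real b - real a)) * E x" if \<sigma>: "\<sigma> \<in> cyclic_SUn1 \<gamma>" and e: "\<sigma> ** mpow \<gamma> a = mpow \<gamma> b" for \<sigma> a b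
  proof -
    let ?p = "mpow \<gamma> a"
    define y where "y = act (matrix_inv ?p) x"
    have y: "y \<in> uball" unfolding y_def by (rule act_uball[OF Un1_matrix_inv[OF U[OF pw]] x])
    have xy: "x = act ?p y" unfolding y_def using act_inverse(2)[OF U[OF pw[of a]], of x] x by simp
    have "act \<sigma> x = act (mpow \<gamma> b) y"
      using act_comp[OF U[OF pw[of a]], of y \<sigma>] y unfolding e xy by simp
    then have "E (act \<sigma> x) = exp (2 * s * real b) * E y" by (simp add: Epow[OF y])
    moreover have "E x = exp (2 * s * real a) * E y" using Epow[OF y, of a] xy by simp
    moreover have "exp (2 * s * (real b - real a)) * exp (2 * s * real a) = exp (2 * s * real b)"
      unfolding exp_add[symmetric] by (simp add: algebra_simps)
    ultimately show ?thesis by (metis mult.assoc)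
  qed
  \<comment> \<open>The position of \<open>x\<close> in units of one step; the element wanted moves
    it by \<open>- \<lfloor>u\<rfloor>\<close> steps, into the interval from 0 to 1.\<close>
  define u where "u = ln (E x) / (2 * s)"
  have Ex: "E x = exp (2 * s * u)" using E(2)[OF x] s by (simp add: u_def)
  have win: "1 \<le> E (act \<sigma> x) \<and> E (act \<sigma> x) < exp (2 * s) \<longleftrightarrow> int b - int a = - \<lfloor>u\<rfloor>"
    if "\<sigma> \<in> cyclic_SUn1 \<gamma>" "\<sigma> ** mpow \<gamma> a = mpow \<gamma> b" for \<sigma> a b
  proof -
    have "E (act \<sigma> x) = exp (2 * s * (u + (real b - real a)))"
      unfolding Egen[OF that] Ex exp_add[symmetric] by (simp add: algebra_simps)
    then have "1 \<le> E (act \<sigma> x) \<and> E (act \<sigma> x) < exp (2 * s) \<longleftrightarrow> 0 \<le> u + (real b - real a) \<and> u + (real b - real a) < 1"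
      using s by (simp add: zero_le_mult_iff)
    also have "\<dots> \<longleftrightarrow> \<lfloor>u\<rfloor> = int a - int b" by (simp add: floor_eq_iff) linarith
    finally show ?thesis by linarith
  qed
  show ?thesis
  proof (rule ex_ex1I)
    show "\<exists>\<sigma>. \<sigma> \<in> cyclic_SUn1 \<gamma> \<and> 1 \<le> E (act \<sigma> x) \<and> E (act \<sigma> x) < exp (2 * s)"
    proof (cases "0 \<le> - \<lfloor>u\<rfloor>")
      case True
      have "mpow \<gamma> (nat (- \<lfloor>u\<rfloor>)) ** mpow \<gamma> 0 = mpow \<gamma> (nat (- \<lfloor>u\<rfloor>))" by simp
      from win[OF pw this] True show ?thesis using pw by auto
    next
      case False
      let ?p = "mpow \<gamma> (nat \<lfloor>u\<rfloor>)"
      have i: "matrix_inv ?p \<in> cyclic_SUn1 \<gamma>" using pw G by blast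
      have "matrix_inv ?p ** mpow \<gamma> (nat \<lfloor>u\<rfloor>) = mpow \<gamma> 0" by (simp add: Un1_inverse[OF U[OF pw]])
      from win[OF i this] False show ?thesis using i by auto
    qed
  next
    fix \<sigma> \<tau>
    assume "\<sigma> \<in> cyclic_SUn1 \<gamma> \<and> 1 \<le> E (act \<sigma> x) \<and> E (act \<sigma> x) < exp (2 * s)"
      "\<tau> \<in> cyclic_SUn1 \<gamma> \<and> 1 \<le> E (act \<tau> x) \<and> E (act \<tau> x) < exp (2 * s)"
    then have \<sigma>: "\<sigma> \<in> cyclic_SUn1 \<gamma>" "1 \<le> E (act \<sigma> x) \<and> E (act \<sigma> x) < exp (2 * s)"
      and \<tau>: "\<tau> \<in> cyclic_SUn1 \<gamma>" "1 \<le> E (act \<tau> x) \<and> E (act \<tau> x) < exp (2 * s)" by auto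
    obtain a b where ab: "\<sigma> ** mpow \<gamma> a = mpow \<gamma> b" using cyclic_element[OF \<gamma> \<sigma>(1)] by blast
    obtain a' b' where ab': "\<tau> ** mpow \<gamma> a' = mpow \<gamma> b'" using cyclic_element[OF \<gamma> \<tau>(1)] by blast
    have eq: "b + a' = b' + a" using win[OF \<sigma>(1) ab] win[OF \<tau>(1) ab'] \<sigma>(2) \<tau>(2) by linarith
    have "\<sigma> ** mpow \<gamma> (a + a') = mpow \<gamma> (b + a')"
      by (simp add: mpow_add[symmetric] matrix_mul_assoc ab)
    also have "\<dots> = \<tau> ** mpow \<gamma> (a + a')"
      unfolding eq add.commute[of a a'] by (simp add: mpow_add[symmetric] matrix_mul_assoc ab')
    finally show "\<sigma> = \<tau>" by (rule matrix_inv_unique_right[OF U[OF pw]])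
  qed
qed

text \<open>The predicate \<open>P\<close> selects exactly one element of each coset, so its
  solutions form a transversal; by invariance of \<open>\<phi>\<close> the representative picked by
  \<open>SOME\<close> may be exchanged for the selected one.\<close>

lemma infsum_left_quotient:
  fixes \<Gamma> H :: "('n::finite) mtx set" and \<phi> :: "'n mtx \<Rightarrow> complex"
  assumes H: "subgroup_SUn1 H" and \<Gamma>: "\<Gamma> \<subseteq> Un1" and HG: "\<And>\<sigma> \<gamma>. \<sigma> \<in> H \<Longrightarrow> \<gamma> \<in> \<Gamma> \<Longrightarrow> \<sigma> ** \<gamma> \<in> \<Gamma>"
    and inv: "\<And>\<sigma> \<gamma>. \<sigma> \<in> H \<Longrightarrow> \<gamma> \<in> \<Gamma> \<Longrightarrow> \<phi> (\<sigma> ** \<gamma>) = \<phi> \<gamma>"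
    and win: "\<And>\<gamma>. \<gamma> \<in> \<Gamma> \<Longrightarrow> \<exists>!\<sigma>. \<sigma> \<in> H \<and> P (\<sigma> ** \<gamma>)"
  shows "(\<Sum>\<^sub>\<infinity>c\<in>left_quotient H \<Gamma>. \<phi> (SOME \<gamma>. \<gamma> \<in> c)) = (\<Sum>\<^sub>\<infinity>\<gamma>\<in>\<Gamma>. if P \<gamma> then \<phi> \<gamma> else 0)"
proof -
  note G = H[unfolded subgroup_SUn1_def]
  define coset where "coset \<gamma> = (\<lambda>\<sigma>. \<sigma> ** \<gamma>) ` H" for \<gamma> :: "'n mtx"
  have self: "\<gamma> \<in> coset \<gamma>" for \<gamma>
    unfolding coset_def using G by (auto intro!: image_eqI[of _ _ "mat 1"])
  have lq: "left_quotient H \<Gamma> = coset ` \<Gamma>" by (simp add: left_quotient_def coset_def)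
  let ?T = "{\<gamma>\<in>\<Gamma>. P \<gamma>}"
  have shift: "coset (\<sigma> ** \<gamma>) = coset \<gamma>" if \<sigma>: "\<sigma> \<in> H" for \<sigma> \<gamma>
  proof (intro equalityI subsetI)
    fix x assume "x \<in> coset (\<sigma> ** \<gamma>)"
    then obtain \<tau> where "\<tau> \<in> H" "x = (\<tau> ** \<sigma>) ** \<gamma>" by (auto simp: coset_def matrix_mul_assoc)
    then show "x \<in> coset \<gamma>" using \<sigma> G by (auto simp: coset_def)
  next
    fix x assume "x \<in> coset \<gamma>"
    then obtain \<tau> where \<tau>: "\<tau> \<in> H" "x = \<tau> ** \<gamma>" by (auto simp: coset_def)
    have "\<sigma> \<in> Un1" using \<sigma> G SUn1_subset_Un1 by auto
    then have "x = (\<tau> ** matrix_inv \<sigma>) ** (\<sigma> ** \<gamma>)"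
      by (simp add: \<tau>(2) matrix_mul_assoc) (simp add: matrix_mul_assoc[symmetric] Un1_inverse)
    then show "x \<in> coset (\<sigma> ** \<gamma>)" using \<tau>(1) \<sigma> G by (auto simp: coset_def)
  qed
  have "bij_betw coset ?T (left_quotient H \<Gamma>)"
    unfolding bij_betw_def lq
  proof (intro conjI inj_onI equalityI subsetI)
    fix \<gamma> \<delta> assume \<gamma>: "\<gamma> \<in> ?T" and \<delta>: "\<delta> \<in> ?T" and e: "coset \<gamma> = coset \<delta>"
    have "\<delta> \<in> coset \<gamma>" using self[of \<delta>] e by simp
    then obtain \<sigma> where \<sigma>: "\<sigma> \<in> H" "\<delta> = \<sigma> ** \<gamma>" by (auto simp: coset_def)
    have "mat 1 \<in> H \<and> P (mat 1 ** \<gamma>)" "\<sigma> \<in> H \<and> P (\<sigma> ** \<gamma>)" using G \<gamma> \<delta> \<sigma> by auto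
    then have "mat 1 = \<sigma>" using win[of \<gamma>] \<gamma> by blast
    with \<sigma> show "\<gamma> = \<delta>" by auto
  next
    fix c assume "c \<in> coset ` \<Gamma>"
    then obtain \<gamma> where \<gamma>: "\<gamma> \<in> \<Gamma>" "c = coset \<gamma>" by blast
    then obtain \<sigma> where \<sigma>: "\<sigma> \<in> H" "P (\<sigma> ** \<gamma>)" using win by blast
    then have "\<sigma> ** \<gamma> \<in> ?T" "c = coset (\<sigma> ** \<gamma>)" using HG \<gamma> shift by auto
    then show "c \<in> coset ` ?T" by blast
  qed auto
  then have "(\<Sum>\<^sub>\<infinity>c\<in>left_quotient H \<Gamma>. \<phi> (SOME \<gamma>. \<gamma> \<in> c)) = (\<Sum>\<^sub>\<infinity>\<gamma>\<in>?T. \<phi> (SOME \<delta>. \<delta> \<in> coset \<gamma>))"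
    by (rule infsum_reindex_bij_betw[symmetric])
  also have "\<dots> = (\<Sum>\<^sub>\<infinity>\<gamma>\<in>?T. \<phi> \<gamma>)"
  proof (rule infsum_cong)
    fix \<gamma> assume \<gamma>: "\<gamma> \<in> ?T"
    have "(SOME \<delta>. \<delta> \<in> coset \<gamma>) \<in> coset \<gamma>" by (rule someI[of "\<lambda>\<delta>. \<delta> \<in> coset \<gamma>", OF self])
    then obtain \<sigma> where "\<sigma> \<in> H" "(SOME \<delta>. \<delta> \<in> coset \<gamma>) = \<sigma> ** \<gamma>" by (auto simp: coset_def)
    then show "\<phi> (SOME \<delta>. \<delta> \<in> coset \<gamma>) = \<phi> \<gamma>" using inv \<gamma> by simp
  qed
  also have "\<dots> = (\<Sum>\<^sub>\<infinity>\<gamma>\<in>\<Gamma>. if P \<gamma> then \<phi> \<gamma> else 0)"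
    by (rule infsum_cong_neutral) auto
  finally show ?thesis .
qed

text \<open>At the geodesic point \<open>tanh t\<close> the value is \<open>exp (2 * t)\<close>: the
  logarithm extends twice the arc length parameter to the whole ball.\<close>

definition stretch :: "'n::finite \<Rightarrow> complex ^ 'n \<Rightarrow> real"
  where "stretch l z = cmod (1 + z $ l) / cmod (1 - z $ l)"

lemma stretch_pos:
  fixes z :: "complex ^ 'n::finite"
  assumes "z \<in> uball" shows "0 < stretch l z"
proof -
  have "cmod (z $ l) < 1" using component_uball[OF assms, of l] by simp
  then have "1 + z $ l \<noteq> 0" "1 - z $ l \<noteq> 0" by (auto simp: add_eq_0_iff)
  then show ?thesis by (simp add: stretch_def)
qed

text \<open>The values 1 and -1 of coordinate \<open>l\<close> are the fixed points of the Moebius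
  map, and their differences to it are multiplied by \<open>exp (- t)\<close> and
  \<open>exp t\<close> over a common denominator, which cancels in the quotient.\<close>

lemma stretch_boost:
  fixes z :: "complex ^ 'n::finite"
  assumes z: "z \<in> uball"
  shows "stretch l (act (boost l t) z) = exp (2 * t) * stretch l z"
proof -
  let ?c = "complex_of_real (cosh t)" and ?s = "complex_of_real (sinh t)"
  have N: "?c + ?s * z $ l \<noteq> 0" by (rule boost_denominator[OF component_uball[OF z]])
  have "1 + act (boost l t) z $ l = (?c + ?s) * (1 + z $ l) / (?c + ?s * z $ l)"
    "1 - act (boost l t) z $ l = (?c - ?s) * (1 - z $ l) / (?c + ?s * z $ l)"
    using N by (simp_all add: act_boost field_simps)
  moreover have "?c + ?s = of_real (exp t)" "?c - ?s = of_real (exp (- t))"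
    by (simp_all add: cosh_plus_sinh cosh_minus_sinh flip: of_real_add of_real_diff)
  ultimately have "stretch l (act (boost l t) z) = exp t / exp (- t) * stretch l z"
    using N by (simp add: stretch_def norm_mult norm_divide)
  also have "exp t / exp (- t) = exp (2 * t)" by (simp add: exp_diff[symmetric])
  finally show ?thesis .
qed

section \<open>The axis in normal form\<close>

lemma continuous_on_act:
  assumes g: "g \<in> Un1"
  shows "continuous_on (cball 0 1) (act g)"
proof -
  have N: "continuous_on X (\<lambda>z. (g *v emb z) $ k)" for k X
    unfolding mult_emb_nth by (intro continuous_intros)
  show ?thesis
    unfolding act_def using Un1_None_nonzero[OF g] by (intro continuous_intros continuous_on_vec_lambda N) auto
qed

lemma act_boost_geodesic:
  "act (boost l a) (axis l (of_real (tanh t))) = axis l (of_real (tanh (a + t)))"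
  by (simp add: act_boost_0[symmetric] act_comp[OF boost_Un1, symmetric] boost_add)

lemma axis_tanh_uball: "axis l (of_real (tanh t)) \<in> (uball :: (complex ^ 'n::finite) set)"
  unfolding act_boost_0[symmetric] by (rule act_uball[OF boost_Un1]) simp

lemma axis_of_real: "(axis l (of_real x) :: complex ^ 'n::finite) = x *\<^sub>R axis l 1"
  by (auto simp: vec_eq_iff axis_def scaleR_conv_of_real[where 'a = complex])

lemma conjugate_act:
  assumes "g \<in> Un1" "h \<in> Un1" "z \<in> cball 0 1"
  shows "act (matrix_inv h ** g ** h) z = act (matrix_inv h) (act g (act h z))"
  by (simp only: act_comp[OF assms(2,3)] act_comp[OF assms(1) act_cball[OF assms(2,3)]])

text \<open>
  The conjugate \<open>h^(-1) \<gamma> h\<close> preserves the standard geodesic and moves the origin by \<open>s\<close>, so up to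
  \<open>boost l s\<close> it fixes the origin and acts as \<open>1\<close> or \<open>- 1\<close> on the geodesic. With the sign \<open>- 1\<close> its
  square would fix the origin, which contradicts the attraction to a boundary point.
\<close>

lemma axis_normal_form:
  fixes \<gamma> h :: "('n::finite) mtx"
  assumes \<gamma>: "\<gamma> \<in> Un1" and h: "h \<in> Un1" and s: "0 < s"
    and im: "act \<gamma> ` act h ` std_geodesic l = act h ` std_geodesic l"
    and base: "act h (act (boost l s) 0) = act \<gamma> (act h 0)"
    and Y: "attracting_fp \<gamma> Y" and X: "repelling_fp \<gamma> X"
  obtains k where "k \<in> Un1" "act k 0 = 0" "act k (axis l 1) = axis l 1"
    "matrix_inv h ** \<gamma> ** h = boost l s ** k" "Y = act h (axis l 1)" "X = act h (axis l (- 1))"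
proof -
  define S where "S t = (axis l (of_real (tanh t)) :: complex ^ 'n)" for t
  have Sb: "S t \<in> uball" "S t \<in> cball 0 1" for t
    using axis_tanh_uball[of l t] in_uball_cball by (auto simp: S_def)
  have S0: "S 0 = 0" by (simp add: S_def vec_eq_iff axis_def)
  have bS: "act (boost l a) (S t) = S (a + t)" for a t
    unfolding S_def by (rule act_boost_geodesic)
  have std: "std_geodesic l = range S" by (simp add: std_geodesic_eq S_def)
  have hi: "act (matrix_inv h) (act h z) = z" "act h (act (matrix_inv h) z) = z" if "z \<in> cball 0 1" for z
    using act_inverse[OF h that] by auto
  define g where "g = matrix_inv h ** \<gamma> ** h"
  have gU: "g \<in> Un1" unfolding g_def by (intro Un1_mult Un1_matrix_inv \<gamma> h)
  have gact: "act g z = act (matrix_inv h) (act \<gamma> (act h z))" if "z \<in> cball 0 1" for z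
    unfolding g_def by (rule conjugate_act[OF \<gamma> h that])
  have hg: "act h (act g z) = act \<gamma> (act h z)" if "z \<in> cball 0 1" for z
    unfolding gact[OF that] by (intro hi act_cball \<gamma> h that)
  have gS0: "act g (S 0) = S s"
    using base hi(1)[OF Sb(2)[of s]] by (simp add: gact S0 bS[of s 0, unfolded S0])
  define k where "k = boost l (- s) ** g"
  have kU: "k \<in> Un1" unfolding k_def by (intro Un1_mult boost_Un1 gU)
  have gk: "g = boost l s ** k"
    by (simp add: k_def matrix_mul_assoc boost_add boost_0)
  have kact: "act k z = act (boost l (- s)) (act g z)" if "z \<in> cball 0 1" for z
    unfolding k_def by (rule act_comp[OF gU that])
  have k0: "act k 0 = 0"
    using kact[of 0] gS0 bS[of "- s" s] by (simp add: S0)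
  have kS: "\<exists>t'. act k (S t) = S t'" for t
  proof -
    have "act \<gamma> (act h (S t)) \<in> act \<gamma> ` act h ` range S" by (intro imageI rangeI)
    then have "act \<gamma> (act h (S t)) \<in> act h ` range S" using im unfolding std by simp
    then obtain t' where "act \<gamma> (act h (S t)) = act h (S t')" by blast
    then have "act g (S t) = S t'" using gact[OF Sb(2)[of t]] hi(1)[OF Sb(2)[of t']] by simp
    then have "act k (S t) = S (- s + t')" using kact[OF Sb(2)[of t]] by (simp only: bS)
    then show ?thesis by (rule exI)
  qed
  have lin: "linear (act k)" by (rule stabilizer_linear[OF kU k0])
  obtain t' where t': "act k (S 1) = S t'" using kS by blast
  \<comment> \<open>\<open>act k\<close> is real linear and maps the point \<open>S 1\<close> of the
    geodesic to another point \<open>S t'\<close>, so it scales the endpoint by this real number;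
    preservation of the norm leaves only the two signs.\<close>
  define r where "r = tanh t' / tanh (1 :: real)"
  have ke: "act k (axis l 1) = r *\<^sub>R axis l 1"
  proof -
    have "tanh (1::real) *\<^sub>R act k (axis l 1) = tanh t' *\<^sub>R axis l 1"
      using t' unfolding S_def axis_of_real linear_scale[OF lin] .
    then have "inverse (tanh (1::real)) *\<^sub>R (tanh (1::real) *\<^sub>R act k (axis l 1)) = inverse (tanh 1) *\<^sub>R (tanh t' *\<^sub>R axis l 1)"
      by simp
    then show ?thesis by (simp add: r_def divide_inverse mult.commute)
  qed
  have "norm (act k (axis l 1)) = 1" by (simp add: stabilizer_norm[OF kU k0] norm_axis)
  then have "\<bar>r\<bar> = 1" unfolding ke by (simp add: norm_axis)
  then consider "r = 1" | "r = - 1" by linarith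
  then have r: "r = 1"
  proof cases
    case 2
    have "act g (S s) = act (boost l s) (act k (S s))"
      unfolding gk by (rule act_comp[OF kU Sb(2)])
    also have "act k (S s) = S (- s)"
      unfolding S_def axis_of_real linear_scale[OF lin] ke 2 by simp
    finally have gg: "act g (act g (S 0)) = S 0" by (simp add: gS0 bS)
    define z0 where "z0 = act h (S 0)"
    have z0: "z0 \<in> uball" unfolding z0_def by (rule act_uball[OF h Sb(1)])
    have "act \<gamma> (act \<gamma> z0) = act h (act g (act g (S 0)))"
      unfolding z0_def using hg[OF Sb(2)[of 0]] hg[OF act_cball[OF gU Sb(2)[of 0]]] by simp
    then have fix2: "act \<gamma> (act \<gamma> z0) = z0" by (simp add: gg z0_def)
    have "(act \<gamma> ^^ (2 * j)) z0 = z0" for j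
      by (induction j) (simp_all add: fix2)
    moreover have "(\<lambda>j. (act \<gamma> ^^ j) z0) \<longlonglongrightarrow> Y" using Y z0 by (simp add: attracting_fp_def)
    then have "((\<lambda>j. (act \<gamma> ^^ j) z0) \<circ> (\<lambda>j. 2 * j)) \<longlonglongrightarrow> Y"
      by (rule LIMSEQ_subseq_LIMSEQ) (simp add: strict_mono_def)
    ultimately have "(\<lambda>j :: nat. z0) \<longlonglongrightarrow> Y" by (simp add: o_def)
    then have "Y = z0" by (simp add: LIMSEQ_const_iff)
    with Y z0 show ?thesis by (simp add: attracting_fp_def)
  qed
  have ke1: "act k (axis l 1) = axis l 1" unfolding ke r by simp
  have gS: "act g (S t) = S (s + t)" for t
  proof -
    have "act k (S t) = S t" unfolding S_def by (rule stabilizer_axis(3)[OF kU k0 ke1])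
    then show ?thesis unfolding gk using act_comp[OF kU Sb(2)[of t], of "boost l s"] bS by simp
  qed
  have \<gamma>S: "act \<gamma> (act h (S t)) = act h (S (s + t))" for t
    using hg[OF Sb(2)[of t]] gS by simp
  \<comment> \<open>The map \<open>act h\<close> is continuous up to the boundary, so limits along
    the geodesic may be taken before transport; this identifies \<open>X\<close> and
    \<open>Y\<close> as images of its ends.\<close>
  have lim: "(\<lambda>j. act h (S (real j * c))) \<longlonglongrightarrow> act h (axis l (of_real e))"
    if "((\<lambda>j. tanh (real j * c)) \<longlonglongrightarrow> e)" "\<bar>e\<bar> = 1" for c e
  proof -
    have "(\<lambda>j. S (real j * c)) \<longlonglongrightarrow> axis l (of_real e)"
      unfolding S_def axis_of_real by (intro tendsto_scaleR that(1) tendsto_const)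
    moreover have "axis l (of_real e) \<in> (cball 0 1 :: (complex ^ 'n) set)" using that(2) by (simp add: norm_axis)
    ultimately show ?thesis
      using continuous_on_tendsto_compose[OF continuous_on_act[OF h], of "\<lambda>j. S (real j * c)" "axis l (of_real e)" sequentially] Sb(2)
      by (simp del: mem_cball)
  qed
  have tp: "(\<lambda>j. tanh (real j * s)) \<longlonglongrightarrow> 1"
    by (rule filterlim_compose[OF tanh_real_at_top])
      (use s in \<open>auto intro!: filterlim_tendsto_pos_mult_at_top[OF tendsto_const] filterlim_real_sequentially simp: mult.commute[of _ s]\<close>)
  have hS0: "act h (S 0) \<in> uball" by (rule act_uball[OF h Sb(1)])
  have orbit: "(act \<gamma> ^^ j) (act h (S 0)) = act h (S (real j * s))" for j
    by (induction j) (simp_all add: \<gamma>S algebra_simps)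
  have "(\<lambda>j. (act \<gamma> ^^ j) (act h (S 0))) \<longlonglongrightarrow> Y" using Y hS0 unfolding attracting_fp_def by blast
  then have "(\<lambda>j. act h (S (real j * s))) \<longlonglongrightarrow> Y" unfolding orbit .
  then have Yh: "Y = act h (axis l 1)"
    using LIMSEQ_unique lim[OF tp] by force
  have \<gamma>iS: "act (matrix_inv \<gamma>) (act h (S t)) = act h (S (t - s))" for t
    using \<gamma>S[of "t - s"] act_inverse(1)[OF \<gamma> act_cball[OF h Sb(2)[of "t - s"]]] by simp
  have orbit_inv: "(act (matrix_inv \<gamma>) ^^ j) (act h (S 0)) = act h (S (real j * (- s)))" for j
  proof (induction j)
    case (Suc j)
    have "real (Suc j) * (- s) = real j * (- s) - s" by (simp add: algebra_simps)
    with Suc show ?case by (simp only: funpow.simps o_apply \<gamma>iS)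
  qed simp
  have "(\<lambda>j. (act (matrix_inv \<gamma>) ^^ j) (act h (S 0))) \<longlonglongrightarrow> X"
    using X hS0 unfolding repelling_fp_def attracting_fp_def by blast
  then have "(\<lambda>j. act h (S (real j * (- s)))) \<longlonglongrightarrow> X" unfolding orbit_inv .
  moreover have "(\<lambda>j. tanh (real j * (- s))) \<longlonglongrightarrow> - 1"
    using tendsto_minus[OF tp] by simp
  from lim[OF this] have "(\<lambda>j. act h (S (real j * (- s)))) \<longlonglongrightarrow> act h (axis l (- 1))" by simp
  ultimately have Xh: "X = act h (axis l (- 1))" by (rule LIMSEQ_unique)
  show thesis
    by (rule that[OF kU k0 ke1 _ Yh Xh]) (use gk in \<open>simp add: g_def\<close>)
qed

section \<open>Unfolding the relative Poincare series\<close>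

lemma slash_cyclic_invariant:
  fixes \<gamma> :: "('n::finite) mtx"
  assumes \<gamma>: "\<gamma> \<in> SUn1" and inv: "\<And>x. x \<in> uball \<Longrightarrow> slash m q \<gamma> x = q x"
    and \<sigma>: "\<sigma> \<in> cyclic_SUn1 \<gamma>" and x: "x \<in> uball"
  shows "slash m q \<sigma> x = q x"
proof -
  let ?H = "{\<sigma>\<in>SUn1. \<forall>x\<in>uball. slash m q \<sigma> x = q x}"
  note S = subgroup_SUn1_SUn1[where 'n = 'n, unfolded subgroup_SUn1_def]
  have U: "a \<in> Un1" if "a \<in> SUn1" for a :: "'n mtx" using that SUn1_subset_Un1 by auto
  have cong: "slash m (slash m q a) b y = slash m q b y" if "a \<in> ?H" "b \<in> SUn1" "y \<in> uball" for a b y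
    using that act_uball[OF U[of b], of y] unfolding slash_def[of m _ b] by simp
  have "subgroup_SUn1 ?H"
    unfolding subgroup_SUn1_def
  proof (intro conjI ballI)
    show "mat 1 \<in> ?H" using S by (simp add: slash_def)
    show "a ** b \<in> ?H" if ab: "a \<in> ?H" "b \<in> ?H" for a b
    proof -
      have "slash m q (a ** b) y = q y" if y: "y \<in> uball" for y
        using slash_comp[OF U[of b], of y m q a] cong[OF ab(1), of b y] ab y by auto
      with ab S show ?thesis by blast
    qed
    show "matrix_inv a \<in> ?H" if a: "a \<in> ?H" for a
    proof -
      have ai: "matrix_inv a \<in> SUn1" using a S by blast
      have aU: "a \<in> Un1" using a U by blast
      have "slash m q (matrix_inv a) y = q y" if y: "y \<in> uball" for y
      proof -
        have "slash m q (matrix_inv a) y = slash m q (a ** matrix_inv a) y"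
          using slash_comp[OF U[OF ai], of y m q a] cong[OF a ai y] y by simp
        also have "\<dots> = q y" unfolding Un1_inverse(2)[OF aU] by (simp add: slash_def)
        finally show ?thesis .
      qed
      with ai show ?thesis by blast
    qed
  qed auto
  moreover have "\<gamma> \<in> ?H" using \<gamma> inv by blast
  ultimately have "cyclic_SUn1 \<gamma> \<subseteq> ?H" by (rule cyclic_minimal)
  with \<sigma> x show ?thesis by blast
qed

text \<open>The window on \<open>E\<close> selects a representative of each coset, which turns the
  series into a sum over all of \<open>\<Gamma>\<close>. Modularity of \<open>f\<close> and the
  transformation of the height make each summand equal to \<open>\<psi>\<close> at the translated
  point, and the order of the kernel from the unfolding cancels the divisor in
  \<open>pet_inner\<close>.\<close>

lemma pet_inner_Theta:
  fixes \<Gamma> :: "('n::finite) mtx set" and E :: "complex ^ 'n \<Rightarrow> real"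
  assumes \<Gamma>: "subgroup_SUn1 \<Gamma>" "countable \<Gamma>" and F: "fundamental_set \<Gamma> F"
    and \<gamma>: "\<gamma> \<in> \<Gamma>" and f: "f \<in> cusp_forms m \<Gamma>"
    and q: "\<And>x. x \<in> uball \<Longrightarrow> slash m (qfun m X Y) \<gamma> x = qfun m X Y x"
    and s: "0 < s"
    and E: "\<And>x. x \<in> uball \<Longrightarrow> E (act \<gamma> x) = exp (2 * s) * E x" "\<And>x. x \<in> uball \<Longrightarrow> 0 < E x"
    and \<psi>: "\<psi> = (\<lambda>x. if x \<in> uball \<and> 1 \<le> E x \<and> E x < exp (2 * s)
      then f x * cnj (qfun m X Y x) * of_real (hgt x ^ (2 * m)) else 0)"
    and int: "integrable inv_vol \<psi>"
  shows "pet_inner \<Gamma> F m f (Theta m \<Gamma> \<gamma> X Y) = (\<integral>x. \<psi> x \<partial>inv_vol)"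
proof -
  note G = subgroup_SUn1_D[OF \<Gamma>(1)]
  let ?H = "cyclic_SUn1 \<gamma>" and ?q = "qfun m X Y"
  have \<gamma>S: "\<gamma> \<in> SUn1" using G \<gamma> by auto
  have H: "subgroup_SUn1 ?H" "?H \<subseteq> \<Gamma>"
    using subgroup_cyclic[OF \<gamma>S] cyclic_minimal[OF \<Gamma>(1) \<gamma>] by auto
  have HU: "\<sigma> \<in> Un1" if "\<sigma> \<in> ?H" for \<sigma> using that H(2) G(2) by auto
  have main: "f z * cnj (Theta m \<Gamma> \<gamma> X Y z) * of_real (hgt z ^ (2 * m)) = (\<Sum>\<^sub>\<infinity>\<delta>\<in>\<Gamma>. \<psi> (act \<delta> z))"
    if z: "z \<in> uball" for z
  proof -
    have zc: "z \<in> cball 0 1" using z by simp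
    define \<Phi> where "\<Phi> \<delta> = f z * cnj (slash m ?q \<delta> z) * of_real (hgt z ^ (2 * m))" for \<delta>
    define P where "P \<delta> \<longleftrightarrow> 1 \<le> E (act \<delta> z) \<and> E (act \<delta> z) < exp (2 * s)" for \<delta>
    \<comment> \<open>Conjugation and constant factors pass through \<open>infsum\<close> also when
      the family is not summable, so this holds at every point of the ball.\<close>
    have "f z * cnj (Theta m \<Gamma> \<gamma> X Y z) * of_real (hgt z ^ (2 * m)) = (\<Sum>\<^sub>\<infinity>c\<in>left_quotient ?H \<Gamma>. \<Phi> (SOME \<delta>. \<delta> \<in> c))"
      unfolding Theta_def \<Phi>_def infsum_cnj[symmetric] infsum_cmult_right'[symmetric] infsum_cmult_left'[symmetric] ..
    also have "\<dots> = (\<Sum>\<^sub>\<infinity>\<delta>\<in>\<Gamma>. if P \<delta> then \<Phi> \<delta> else 0)"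
    proof (rule infsum_left_quotient[OF H(1)])
      show "\<Gamma> \<subseteq> Un1" using G(2) by auto
      show "\<sigma> ** \<delta> \<in> \<Gamma>" if "\<sigma> \<in> ?H" "\<delta> \<in> \<Gamma>" for \<sigma> \<delta> using that H(2) G(4) by auto
      show "\<Phi> (\<sigma> ** \<delta>) = \<Phi> \<delta>" if "\<sigma> \<in> ?H" "\<delta> \<in> \<Gamma>" for \<sigma> \<delta>
      proof -
        have "slash m ?q (\<sigma> ** \<delta>) z = slash m (slash m ?q \<sigma>) \<delta> z"
          by (rule slash_comp[OF G(2)[OF that(2)] zc])
        also have "\<dots> = slash m ?q \<delta> z"
          unfolding slash_def[of m _ \<delta>]
          using slash_cyclic_invariant[OF \<gamma>S q that(1) act_uball[OF G(2)[OF that(2)] z]] by simp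
        finally show ?thesis by (simp add: \<Phi>_def)
      qed
      show "\<exists>!\<sigma>. \<sigma> \<in> ?H \<and> P (\<sigma> ** \<delta>)" if "\<delta> \<in> \<Gamma>" for \<delta>
        using cyclic_window[where E = E, OF \<gamma>S s E act_uball[OF G(2)[OF that] z]]
        by (simp add: P_def act_comp[OF G(2)[OF that] zc])
    qed
    also have "\<dots> = (\<Sum>\<^sub>\<infinity>\<delta>\<in>\<Gamma>. \<psi> (act \<delta> z))"
    proof (rule infsum_cong)
      fix \<delta> assume \<delta>: "\<delta> \<in> \<Gamma>"
      have u: "act \<delta> z \<in> uball" by (rule act_uball[OF G(2)[OF \<delta>] z])
      \<comment> \<open>The factor \<open>jfac \<delta> z ^ (2 * m)\<close> gained here and its
        conjugate from \<open>q\<close> are exactly what the height at the translated point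
        requires.\<close>
      have fz: "f z = f (act \<delta> z) * jfac \<delta> z ^ (2 * m)"
        using f \<delta> z by (auto simp: cusp_forms_def slash_def)
      have "complex_of_real (hgt (act \<delta> z) ^ (2 * m)) = of_real (hgt z ^ (2 * m)) * (jfac \<delta> z ^ (2 * m) * cnj (jfac \<delta> z ^ (2 * m)))"
      proof -
        have "hgt (act \<delta> z) ^ (2 * m) = hgt z ^ (2 * m) * (cmod (jfac \<delta> z ^ (2 * m)))\<^sup>2"
          unfolding hgt_act[OF G(2)[OF \<delta>] zc] power_mult_distrib norm_power by (simp add: power_mult[symmetric] mult.commute)
        then show ?thesis by (simp only: of_real_mult complex_norm_square)
      qed
      then have "\<Phi> \<delta> = f (act \<delta> z) * cnj (?q (act \<delta> z)) * of_real (hgt (act \<delta> z) ^ (2 * m))"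
        unfolding \<Phi>_def fz slash_def by (simp only: complex_cnj_mult mult_ac)
      with u show "(if P \<delta> then \<Phi> \<delta> else 0) = \<psi> (act \<delta> z)" by (simp add: \<psi> P_def)
    qed
    finally show ?thesis .
  qed
  let ?Z = "{\<delta>\<in>\<Gamma>. \<forall>z\<in>uball. act \<delta> z = z}"
  have "F \<subseteq> uball" using F by (simp add: fundamental_set_def)
  then have "(LINT z:F|inv_vol. f z * cnj (Theta m \<Gamma> \<gamma> X Y z) * of_real (hgt z ^ (2 * m)))
      = (LINT z:F|inv_vol. (\<Sum>\<^sub>\<infinity>\<delta>\<in>\<Gamma>. \<psi> (act \<delta> z)))"
    unfolding set_lebesgue_integral_def
    by (intro Bochner_Integration.integral_cong refl) (use main in \<open>auto simp: indicator_def\<close>)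
  also have "\<dots> = of_nat (card ?Z) * (\<integral>x. \<psi> x \<partial>inv_vol)"
    by (rule integral_unfolding[OF \<Gamma> F int])
  finally have "pet_inner \<Gamma> F m f (Theta m \<Gamma> \<gamma> X Y) = of_nat (card ?Z) * (\<integral>x. \<psi> x \<partial>inv_vol) / of_nat (card ?Z)"
    by (simp add: pet_inner_def)
  moreover have "card ?Z \<noteq> 0"
    using finite_trivial_action[OF G(1)] G(3) by (auto simp: card_eq_0_iff)
  ultimately show ?thesis by simp
qed

section \<open>Phases and the final formula\<close>

lemma W_mtx_act:
  fixes w :: "('n::finite) mtx"
  assumes w: "w \<in> W_grp l" "w = W_mtx l u \<psi>"
  shows "w \<in> Un1" "act w (axis l x) = axis l x" "jfac w z = exp (\<i> * of_real \<psi>)"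
proof -
  show "w \<in> Un1" using w(1) SUn1_subset_Un1 by (auto simp: W_grp_def K_grp_def)
  have N: "(w *v emb z) $ None = exp (- \<i> * of_real \<psi>)" for z
    by (simp add: mult_emb_nth w(2) W_mtx_def)
  show "jfac w z = exp (\<i> * of_real \<psi>)" by (simp add: jfac_def N exp_minus)
  have "act w (axis l x) $ i = axis l x $ i" for i
    unfolding act_def by (simp add: N mult_emb_axis) (simp add: w(2) W_mtx_def axis_def)
  then show "act w (axis l x) = axis l x" by (simp add: vec_eq_iff)
qed

lemma herm_emb_axis: "herm (emb z) (emb (axis l x)) = z $ l * cnj x - 1"
proof -
  have "(\<Sum>i\<in>UNIV. z $ i * cnj (axis l x $ i)) = (\<Sum>i\<in>UNIV. if i = l then z $ l * cnj x else 0)"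
    by (intro sum.cong) (auto simp: axis_def)
  then show ?thesis by (simp add: herm_def)
qed

lemma herm_measurable [measurable (raw)]:
  assumes [measurable]: "f \<in> borel_measurable M"
  shows "(\<lambda>x. herm (f x) w) \<in> borel_measurable M"
  unfolding herm_def by measurable

lemma integral_inv_vol:
  fixes \<phi> :: "complex ^ 'n::finite \<Rightarrow> complex"
  assumes [measurable]: "\<phi> \<in> borel_measurable borel"
  shows "(\<integral>z. \<phi> z \<partial>inv_vol) = (\<integral>z. (indicator uball z * (4 ^ CARD('n) / hgt z ^ (CARD('n) + 1))) *\<^sub>R \<phi> z \<partial>lborel)"
    and "integrable inv_vol \<phi> \<longleftrightarrow> integrable lborel (\<lambda>z. (indicator uball z * (4 ^ CARD('n) / hgt z ^ (CARD('n) + 1))) *\<^sub>R \<phi> z)"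
proof -
  have 0: "0 \<le> indicator uball z * (4 ^ CARD('n) / hgt z ^ (CARD('n) + 1))" for z :: "complex ^ 'n"
    using hgt_pos[of z] by (auto simp: indicator_def)
  show "(\<integral>z. \<phi> z \<partial>inv_vol) = (\<integral>z. (indicator uball z * (4 ^ CARD('n) / hgt z ^ (CARD('n) + 1))) *\<^sub>R \<phi> z \<partial>lborel)"
    unfolding inv_vol_def by (rule integral_density) (use 0 in auto)
  show "integrable inv_vol \<phi> \<longleftrightarrow> integrable lborel (\<lambda>z. (indicator uball z * (4 ^ CARD('n) / hgt z ^ (CARD('n) + 1))) *\<^sub>R \<phi> z)"
    unfolding inv_vol_def by (rule integrable_density) (use 0 in auto)
qed

text \<open>\<open>a ^ m\<close> is a square root of a nonnegative real, hence real, so conjugation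
  affects only the phase e^(im\<psi>) and turns it into e^(-im\<psi>). The quotient of the two is
  the exponential factor of the final formula.\<close>

lemma phase_identity:
  fixes a :: complex
  assumes a: "a ^ (2 * m) \<in> \<real>\<^sub>\<ge>\<^sub>0"
  shows "cnj (exp (\<i> * of_real \<psi>) * a) ^ m = exp (- (2 * of_nat m * \<i> * of_real \<psi>)) * (exp (\<i> * of_real \<psi>) * a) ^ m"
proof -
  have "(a ^ m)\<^sup>2 \<in> \<real>\<^sub>\<ge>\<^sub>0" using a by (simp add: power_mult[symmetric] mult.commute)
  then have "Im ((a ^ m)\<^sup>2) = 0" "0 \<le> Re ((a ^ m)\<^sup>2)" by (auto simp: complex_nonneg_Reals_iff)
  then have "Re (a ^ m) * Im (a ^ m) = 0" "(Im (a ^ m))\<^sup>2 \<le> (Re (a ^ m))\<^sup>2"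
    by (auto simp: power2_eq_square)
  then have "Im (a ^ m) = 0" by (cases "Re (a ^ m) = 0") simp_all
  then have "cnj (a ^ m) = a ^ m" by (simp add: complex_eq_iff del: complex_cnj_power)
  then have "cnj a ^ m = a ^ m" by simp
  moreover have "cnj (exp (\<i> * of_real \<psi>)) ^ m = exp (- (2 * of_nat m * \<i> * of_real \<psi>)) * exp (\<i> * of_real \<psi>) ^ m"
    by (simp add: exp_cnj exp_of_nat_mult[symmetric] exp_add[symmetric] algebra_simps)
  ultimately show ?thesis by (simp add: power_mult_distrib)
qed

theorem theorem14:
  fixes \<Gamma> :: "('n::finite) mtx set"
    and l :: 'n
    and \<kappa> :: real and m :: nat
    and \<gamma>0 g w :: "'n mtx"
    and X Y z0 :: "complex ^ 'n"
    and L F :: "(complex ^ 'n) set"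
    and f :: "complex ^ 'n \<Rightarrow> complex"
    and s \<psi> :: real
    and u :: "complex ^ 'n ^ 'n"
    and \<alpha> :: complex and C :: real
  assumes "lattice_SUn1 \<Gamma>"
    and "fundamental_set \<Gamma> F"
    and "\<kappa> \<ge> 1" and "2 * \<kappa> \<in> \<int>" and "real m = (real CARD('n) + 1) * \<kappa>"
    and "\<gamma>0 \<in> \<Gamma>" and "loxodromic l \<gamma>0"
    and "repelling_fp \<gamma>0 X" and "attracting_fp \<gamma>0 Y"
    and Theta_well_defined: "\<forall>z\<in>uball. slash m (qfun m X Y) \<gamma>0 z = qfun m X Y z"
    and "f \<in> cusp_forms m \<Gamma>"
    and "is_axis l \<gamma>0 X Y L" and "base_lift l \<gamma>0 L z0 g s"
    and normalised: "phase_normalised l m g"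
    and "w \<in> W_grp l" and "w = W_mtx l u \<psi>"
    and "\<alpha> = - herm (emb X) (emb Y) / 2"
    and "C = fact (2 * m - CARD('n) - 1) / (fact (m - 1))\<^sup>2 * pi ^ CARD('n)
               * 2 powr (2 * (real CARD('n) + 1) * (1 - \<kappa>) - 1)"
  shows "pet_inner \<Gamma> F m f (Theta m \<Gamma> \<gamma>0 X Y) =
    exp (- (2 * of_nat m * \<i> * of_real \<psi>)) * \<alpha> powi (- int m) * of_real C
      * orbit_integral l m f (g ** w) s"
proof -
  have \<Gamma>: "subgroup_SUn1 \<Gamma>" "countable \<Gamma>"
    using \<open>lattice_SUn1 \<Gamma>\<close> countable_discrete by (auto simp: lattice_SUn1_def)
  note G = subgroup_SUn1_D[OF \<Gamma>(1)]
  have \<gamma>: "\<gamma>0 \<in> Un1" by (rule G(2)[OF \<open>\<gamma>0 \<in> \<Gamma>\<close>])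
  have s: "0 < s" and gU: "g \<in> Un1" and gstd: "act g ` std_geodesic l = L"
    and g0: "act g 0 = z0" and gs: "act g (act (boost l s) 0) = act \<gamma>0 z0"
    using \<open>base_lift l \<gamma>0 L z0 g s\<close> SUn1_subset_Un1 by (auto simp: base_lift_def)
  note W = W_mtx_act[OF \<open>w \<in> W_grp l\<close> \<open>w = W_mtx l u \<psi>\<close>]
  define h where "h = g ** w"
  have h: "h \<in> Un1" unfolding h_def by (rule Un1_mult[OF gU W(1)])
  \<comment> \<open>\<open>w\<close> fixes the disc along coordinate \<open>l\<close> pointwise, so
    all lifts have the same geodesic below them and differ only in their automorphy factors.\<close>
  have hax: "act h (axis l x) = act g (axis l x)" if "cmod x \<le> 1" for x
    unfolding h_def using act_comp[OF W(1), of "axis l x" g] that by (simp add: W(2) norm_axis)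
  have ax0: "axis l 0 = (0 :: complex ^ 'n)" by (simp add: vec_eq_iff axis_def)
  have h0: "act h 0 = z0" using hax[of 0] g0 by (simp add: ax0)
  have tl: "\<bar>tanh t\<bar> \<le> 1" for t :: real
    using axis_tanh_uball[of l t] by (simp add: norm_axis)
  have hstd: "act h ` std_geodesic l = L"
    unfolding gstd[symmetric] std_geodesic_eq image_image using tl by (intro image_cong refl hax) simp
  have hs: "act h (act (boost l s) 0) = act \<gamma>0 (act h 0)"
    using gs hax[of "of_real (tanh s)"] tl[of s] by (simp add: act_boost_0 h0)
  have "act \<gamma>0 ` act h ` std_geodesic l = act h ` std_geodesic l"
    unfolding hstd using \<open>is_axis l \<gamma>0 X Y L\<close> by (simp add: is_axis_def)
  then obtain k where k: "k \<in> Un1" "act k 0 = 0" "act k (axis l 1) = axis l 1"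
    and conj: "matrix_inv h ** \<gamma>0 ** h = boost l s ** k"
    and Y: "Y = act h (axis l 1)" and X: "X = act h (axis l (- 1))"
    using axis_normal_form[OF \<gamma> h s _ hs \<open>attracting_fp \<gamma>0 Y\<close> \<open>repelling_fp \<gamma>0 X\<close>] by blast
  note K = stabilizer_axis[OF k]
  define d where "d = k $ None $ None"
  have d: "d \<noteq> 0" using stabilizer_entries(3)[OF k(1,2)] by (auto simp: d_def)
  have intertwine: "h ** (boost l s ** k) = \<gamma>0 ** h"
    unfolding conj[symmetric] by (simp add: matrix_mul_assoc Un1_inverse[OF h])
  have bkU: "boost l s ** k \<in> Un1" by (rule Un1_mult[OF boost_Un1 k(1)])
  have bk_act: "act (boost l s ** k) z = act (boost l s) (act k z)" if "z \<in> cball 0 1" for z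
    by (rule act_comp[OF k(1) that])
  have bk_jfac: "jfac (boost l s ** k) z = inverse (of_real (cosh s) + of_real (sinh s) * z $ l) * inverse d" if "z \<in> cball 0 1" for z
    unfolding jfac_comp[OF k(1) that] jfac_boost K(1) K(2) d_def ..

  \<comment> \<open>The automorphy factors of \<open>h\<close> at the endpoints that it carries to
    \<open>Y\<close> and \<open>X\<close>; all phases are expressed through these two
    numbers.\<close>
  define jp jm where "jp = jfac h (axis l 1)" and "jm = jfac h (axis l (- 1))"
  have jnz: "jp \<noteq> 0" "jm \<noteq> 0"
    unfolding jp_def jm_def by (rule jfac_nonzero[OF h], simp add: norm_axis)+
  \<comment> \<open>The pairings with the two endpoints are - z - 1 and z - 1 in coordinate
    \<open>l\<close>, whose product is 1 - z^2.\<close>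
  have Q: "Qfun X Y (act h z) = (jfac h z)\<^sup>2 * cnj (jm * jp) * (1 - (z $ l)\<^sup>2)" if "z \<in> cball 0 1" for z
  proof -
    have hX: "herm (emb (act h z)) (emb X) = jfac h z * cnj jm * (- z $ l - 1)"
      unfolding X jm_def by (subst herm_act[OF h that]) (simp_all add: norm_axis herm_emb_axis)
    have hY: "herm (emb (act h z)) (emb Y) = jfac h z * cnj jp * (z $ l - 1)"
      unfolding Y jp_def by (subst herm_act[OF h that]) (simp_all add: norm_axis herm_emb_axis)
    show ?thesis unfolding Qfun_def hX hY by (simp add: power2_eq_square algebra_simps)
  qed
  have q: "qfun m X Y (act h z) = inverse (jfac h z ^ (2 * m) * cnj (jm * jp) ^ m * (1 - (z $ l)\<^sup>2) ^ m)" if "z \<in> cball 0 1" for z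
    by (simp add: qfun_def Q[OF that] power_int_minus power_mult_distrib power_mult)
  have \<alpha>: "\<alpha> = jm * cnj jp"
  proof -
    have "herm (emb X) (emb Y) = jm * cnj jp * (- 2)"
      unfolding X Y jm_def jp_def by (subst herm_act[OF h]) (simp_all add: norm_axis herm_emb_axis)
    then show ?thesis using \<open>\<alpha> = - herm (emb X) (emb Y) / 2\<close> by simp
  qed
  \<comment> \<open>After conjugation \<open>q\<close> contributes the inverse power of
    \<open>jm * jp\<close>, while \<open>\<alpha>\<close> is \<open>jm * cnj jp\<close>. Only the
    phase of \<open>jp\<close> separates them, and it is \<open>\<psi>\<close> up to the normalised
    phase of \<open>g\<close>.\<close>
  have phase: "inverse ((jm * jp) ^ m) = exp (- (2 * of_nat m * \<i> * of_real \<psi>)) * \<alpha> powi (- int m)"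
  proof -
    have "jp = jfac g (axis l 1) * exp (\<i> * of_real \<psi>)"
      unfolding jp_def h_def using jfac_comp[OF W(1), of "axis l 1" g] by (simp add: W norm_axis)
    then have "cnj jp ^ m = exp (- (2 * of_nat m * \<i> * of_real \<psi>)) * jp ^ m"
      using phase_identity[of "jfac g (axis l 1)" m \<psi>] normalised by (simp add: phase_normalised_def mult.commute)
    then have "\<alpha> ^ m = exp (- (2 * of_nat m * \<i> * of_real \<psi>)) * (jm * jp) ^ m"
      by (simp add: \<alpha> power_mult_distrib)
    then show ?thesis using jnz by (simp add: power_int_minus)
  qed

  text \<open>Evaluating the invariance of \<open>q\<close> at the base point of the axis fixes the phase of \<open>k\<close>.\<close>
  have d2m: "inverse d ^ (2 * m) = 1"
  proof -
    have 0: "(0 :: complex ^ 'n) \<in> uball" "(0 :: complex ^ 'n) \<in> cball 0 1" by auto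
    have a0: "act (boost l s ** k) 0 = axis l (of_real (tanh s))"
      using bk_act[OF 0(2)] k(2) by (simp add: act_boost_0)
    have "slash m (slash m (qfun m X Y) h) (boost l s ** k) 0 = slash m (slash m (qfun m X Y) \<gamma>0) h 0"
      by (simp only: slash_comp[OF bkU 0(2), symmetric] slash_comp[OF h 0(2), symmetric] intertwine)
    also have "\<dots> = slash m (qfun m X Y) h 0"
      unfolding slash_def[of m _ h] using Theta_well_defined act_uball[OF h 0(1)] by simp
    finally have e: "slash m (qfun m X Y) h (axis l (of_real (tanh s))) * jfac (boost l s ** k) 0 ^ (2 * m) = slash m (qfun m X Y) h 0"
      unfolding slash_def[of m _ "boost l s ** k"] a0 .
    have qh: "slash m (qfun m X Y) h z = inverse (cnj (jm * jp) ^ m) * inverse ((1 - (z $ l)\<^sup>2) ^ m)" if "z \<in> cball 0 1" for z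
      using jfac_nonzero[OF h that] unfolding slash_def q[OF that] by simp
    have cs: "1 - (complex_of_real (tanh s))\<^sup>2 = inverse ((of_real (cosh s))\<^sup>2)"
    proof -
      have "1 - (tanh s)\<^sup>2 = ((cosh s)\<^sup>2 - (sinh s)\<^sup>2) / (cosh s)\<^sup>2"
        by (simp add: tanh_def power_divide diff_divide_distrib)
      then have "1 - (tanh s)\<^sup>2 = inverse ((cosh s)\<^sup>2)" by (simp add: hyperbolic_pythagoras inverse_eq_divide)
      then show ?thesis by (metis of_real_1 of_real_diff of_real_inverse of_real_power)
    qed
    have "(axis l (complex_of_real (tanh s)) :: complex ^ 'n) \<in> cball 0 1" using tl[of s] by (simp add: norm_axis)
    from e[unfolded qh[OF this] qh[OF 0(2)] bk_jfac[OF 0(2)]] have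
      "inverse ((1 - (complex_of_real (tanh s))\<^sup>2) ^ m) * (inverse (of_real (cosh s)) * inverse d) ^ (2 * m) = 1"
      using jnz by (simp add: axis_def)
    moreover have "complex_of_real (cosh s) \<noteq> 0" by simp
    then have "complex_of_real (cosh s) ^ (2 * m) * (inverse (of_real (cosh s)) * inverse d) ^ (2 * m) = inverse d ^ (2 * m)"
      by (simp add: power_mult_distrib[symmetric] mult.assoc[symmetric])
    moreover have "inverse (inverse ((complex_of_real (cosh s))\<^sup>2) ^ m) = of_real (cosh s) ^ (2 * m)"
      by (simp add: power_inverse power_mult)
    ultimately show ?thesis unfolding cs by simp
  qed

  define FF where "FF = slash m f h"
  have holf: "holomorphic_Cn f uball" using \<open>f \<in> cusp_forms m \<Gamma>\<close> by (simp add: cusp_forms_def)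
  obtain M where M: "\<And>z. z \<in> uball \<Longrightarrow> cmod (f z) * hgt z ^ m \<le> M"
    using \<open>f \<in> cusp_forms m \<Gamma>\<close> unfolding cusp_forms_def by blast
  \<comment> \<open>Transport of the invariance of \<open>f\<close> under \<open>\<gamma>0\<close>:
    the conjugate by \<open>h\<close> leaves \<open>FF\<close> invariant in weight
    \<open>2 * m\<close>.\<close>
  have FFinv: "FF (act (boost l s ** k) z) * jfac (boost l s ** k) z ^ (2 * m) = FF z" if z: "z \<in> uball" for z
  proof -
    have zc: "z \<in> cball 0 1" using z by simp
    have "slash m FF (boost l s ** k) z = slash m (slash m f \<gamma>0) h z"
      unfolding FF_def by (simp only: slash_comp[OF bkU zc, symmetric] slash_comp[OF h zc, symmetric] intertwine)
    also have "\<dots> = FF z"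
      unfolding FF_def slash_def[of m _ h]
      using \<open>f \<in> cusp_forms m \<Gamma>\<close> \<open>\<gamma>0 \<in> \<Gamma>\<close> act_uball[OF h z] by (simp add: cusp_forms_def)
    finally show ?thesis by (simp add: slash_def)
  qed
  have m: "CARD('n) + 1 \<le> m"
  proof -
    have "real (CARD('n) + 1) * 1 \<le> (real CARD('n) + 1) * \<kappa>" using \<open>\<kappa> \<ge> 1\<close> by (intro mult_mono) auto
    then have "real (CARD('n) + 1) \<le> real m" unfolding \<open>real m = _\<close> by simp
    then show ?thesis by (simp only: of_nat_le_iff)
  qed
  define \<Psi> where "\<Psi> = (\<lambda>z. if z \<in> uball \<and> 1 \<le> cmod (1 + z $ l) / cmod (1 - z $ l) \<and> cmod (1 + z $ l) / cmod (1 - z $ l) < exp (2 * s)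
      then FF z * cnj (inverse ((1 - (z $ l)\<^sup>2) ^ m)) * of_real (4 ^ CARD('n) * hgt z ^ (2 * m - CARD('n) - 1)) else 0)"
  \<comment> \<open>On the disc the conjugate acts by translation by \<open>s\<close> in the strip
    coordinate, with automorphy factor \<open>cosh x / cosh (x + s)\<close> up to the phase of
    \<open>k\<close>, whose \<open>2 * m\<close>-th power is 1. Invariance thus becomes
    periodicity.\<close>
  have per: "FF (axis l (tanh (x + of_real s))) * inverse (cosh (x + of_real s)) ^ (2 * m)
      = FF (axis l (tanh x)) * inverse (cosh x) ^ (2 * m)" if x: "x \<in> strip" for x
  proof -
    let ?z = "axis l (tanh x) :: complex ^ 'n"
    have "tanh x \<in> ball 0 1" using tanh_strip_image x by blast
    then have z: "?z \<in> uball" "?z \<in> cball 0 1" by (simp_all add: norm_axis)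
    have xs: "x + of_real s \<in> strip" using x by (simp add: strip_def)
    have cx: "cosh x \<noteq> 0" "cosh (x + of_real s) \<noteq> 0" using cosh_strip_nonzero x xs by auto
    have c: "cosh (x + of_real s) = cosh x * (of_real (cosh s) + of_real (sinh s) * tanh x)"
      using cx by (simp add: cosh_add cosh_complex_of_real sinh_complex_of_real tanh_def field_simps)
    have "act (boost l s ** k) ?z = axis l (tanh (x + of_real s))"
    proof -
      have "(of_real (cosh s) * tanh x + of_real (sinh s)) / (of_real (cosh s) + of_real (sinh s) * tanh x) = tanh (x + of_real s)"
        using cx unfolding tanh_def[of "x + of_real s"] c
        by (simp add: sinh_add cosh_complex_of_real sinh_complex_of_real tanh_def field_simps)
      then show ?thesis by (simp add: bk_act[OF z(2)] K(3) act_boost_axis)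
    qed
    with FFinv[OF z(1)] have "FF (axis l (tanh (x + of_real s))) * jfac (boost l s ** k) ?z ^ (2 * m) = FF ?z" by simp
    moreover have "jfac (boost l s ** k) ?z ^ (2 * m) = inverse (of_real (cosh s) + of_real (sinh s) * tanh x) ^ (2 * m)"
      unfolding bk_jfac[OF z(2)] power_mult_distrib d2m by (simp add: axis_def)
    ultimately show ?thesis unfolding c by (simp add: power_mult_distrib)
  qed
  have bound: "cmod (FF z) * hgt z ^ m \<le> M" if z: "z \<in> uball" for z
  proof -
    have zc: "z \<in> cball 0 1" using z by simp
    have "cmod (f (act h z)) * hgt (act h z) ^ m \<le> M" by (rule M[OF act_uball[OF h z]])
    then show ?thesis
      unfolding hgt_act[OF h zc] by (simp add: FF_def slash_def norm_mult norm_power power_mult_distrib power_mult[symmetric] mult_ac)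
  qed
  note I = integral_geodesic_strip[OF holomorphic_slash_curve[OF holf _ h, of _ _ m, folded FF_def]
      continuous_on_slash[OF holf h, of m, folded FF_def] bound m s per \<Psi>_def]

  \<comment> \<open>The stretch measured along the axis of \<open>\<gamma>0\<close>. It gains the
    factor \<open>exp (2 * s)\<close> under \<open>\<gamma>0\<close> because \<open>k\<close> leaves
    coordinate \<open>l\<close> unchanged.\<close>
  define E where "E x = stretch l (act (matrix_inv h) x)" for x
  have Eh: "E (act h z) = stretch l z" if "z \<in> uball" for z
    using act_inverse(1)[OF h, of z] that by (simp add: E_def)
  have preimage: "\<exists>z\<in>uball. x = act h z" if "x \<in> uball" for x
    using act_inverse(2)[OF h, of x] act_uball[OF Un1_matrix_inv[OF h] that] that by (metis in_uball_cball)
  have E\<gamma>: "E (act \<gamma>0 x) = exp (2 * s) * E x" if x: "x \<in> uball" for x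
  proof -
    obtain z where z: "z \<in> uball" "x = act h z" using preimage[OF x] by blast
    then have zc: "z \<in> cball 0 1" by simp
    have "act \<gamma>0 x = act h (act (boost l s ** k) z)"
      unfolding z(2) by (simp only: act_comp[OF h zc, symmetric] act_comp[OF bkU zc, symmetric] intertwine)
    then have "E (act \<gamma>0 x) = stretch l (act (boost l s) (act k z))"
      using Eh[OF act_uball[OF bkU z(1)]] by (simp add: bk_act[OF zc])
    also have "\<dots> = exp (2 * s) * stretch l (act k z)" by (rule stretch_boost[OF act_uball[OF k(1) z(1)]])
    finally show ?thesis using Eh[OF z(1)] by (simp add: z(2) stretch_def K(1))
  qed
  have Epos: "0 < E x" if "x \<in> uball" for x
    unfolding E_def by (rule stretch_pos[OF act_uball[OF Un1_matrix_inv[OF h] that]])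
  define \<eta> where "\<eta> = (\<lambda>x. if x \<in> uball \<and> 1 \<le> E x \<and> E x < exp (2 * s)
      then f x * cnj (qfun m X Y x) * of_real (hgt x ^ (2 * m)) else 0)"
  \<comment> \<open>What is left of the constant in \<open>q\<close> after conjugation;
    \<open>phase\<close> rewrites it in terms of \<open>\<psi>\<close> and
    \<open>\<alpha>\<close>.\<close>
  define K0 where "K0 = inverse ((jm * jp) ^ m)"
  have cnj_meas [measurable (raw)]: "(\<lambda>x. cnj (v x)) \<in> borel_measurable N" if "v \<in> borel_measurable N" for v :: "'z \<Rightarrow> complex" and N
    using measurable_compose[OF that, of cnj borel] by (simp add: borel_measurable_continuous_onI continuous_on_cnj)
  have \<eta>m [measurable]: "\<eta> \<in> borel_measurable borel"
  proof -
    have "continuous_on uball f"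
      using holf unfolding holomorphic_Cn_def by (meson continuous_at_imp_continuous_on has_derivative_continuous)
    then have [measurable]: "(\<lambda>x. if x \<in> uball then f x else 0) \<in> borel_measurable borel"
      by (intro borel_measurable_continuous_on_if) auto
    have [measurable]: "E \<in> borel_measurable borel" unfolding E_def stretch_def by measurable
    have [measurable]: "qfun m X Y \<in> borel_measurable borel"
      unfolding qfun_def Qfun_def power_int_minus power_int_of_nat by measurable
    have "\<eta> = (\<lambda>x. if x \<in> uball \<and> 1 \<le> E x \<and> E x < exp (2 * s)
      then (if x \<in> uball then f x else 0) * cnj (qfun m X Y x) * of_real (hgt x ^ (2 * m)) else 0)"
      by (auto simp: \<eta>_def)
    also have "\<dots> \<in> borel_measurable borel" by measurable
    finally show ?thesis .
  qed
  \<comment> \<open>All automorphy factors disappear: the height supplies \<open>j * cnj j\<close>,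
    of which \<open>j\<close> completes \<open>f (act h z)\<close> to \<open>FF z\<close> and
    \<open>cnj j\<close> cancels against the conjugate of \<open>q\<close>.\<close>
  have pull: "(indicator uball z * (4 ^ CARD('n) / hgt z ^ (CARD('n) + 1))) *\<^sub>R \<eta> (act h z) = K0 * \<Psi> z" for z
  proof (cases "z \<in> uball \<and> 1 \<le> stretch l z \<and> stretch l z < exp (2 * s)")
    case True
    then have z: "z \<in> uball" and zc: "z \<in> cball 0 1" by auto
    define j where "j = jfac h z ^ (2 * m)"
    have jz: "j \<noteq> 0" using jfac_nonzero[OF h zc] by (simp add: j_def)
    have hz: "hgt z \<noteq> 0" using hgt_pos[OF z] by simp
    have hh: "complex_of_real (hgt (act h z) ^ (2 * m)) = of_real (hgt z ^ (2 * m)) * (j * cnj j)"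
    proof -
      have "hgt (act h z) ^ (2 * m) = hgt z ^ (2 * m) * (cmod j)\<^sup>2"
        unfolding hgt_act[OF h zc] power_mult_distrib j_def norm_power by (simp add: power_mult[symmetric] mult.commute)
      then show ?thesis by (simp only: of_real_mult complex_norm_square)
    qed
    have "\<eta> (act h z) = f (act h z) * cnj (qfun m X Y (act h z)) * of_real (hgt (act h z) ^ (2 * m))"
      using True act_uball[OF h z] by (simp add: \<eta>_def Eh)
    also have "\<dots> = f (act h z) * cnj (inverse (j * cnj (jm * jp) ^ m * (1 - (z $ l)\<^sup>2) ^ m)) * (of_real (hgt z ^ (2 * m)) * (j * cnj j))"
      unfolding q[OF zc] hh j_def[symmetric] ..
    also have "\<dots> = K0 * (FF z * cnj (inverse ((1 - (z $ l)\<^sup>2) ^ m)) * of_real (hgt z ^ (2 * m)))"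
    proof -
      have "FF z = f (act h z) * j" by (simp add: FF_def slash_def j_def)
      with jz show ?thesis by (simp add: K0_def field_simps)
    qed
    finally have c: "\<eta> (act h z) = K0 * (FF z * cnj (inverse ((1 - (z $ l)\<^sup>2) ^ m)) * of_real (hgt z ^ (2 * m)))" .
    have "hgt z ^ (2 * m) = hgt z ^ (2 * m - CARD('n) - 1) * hgt z ^ (CARD('n) + 1)"
      unfolding power_add[symmetric] using m by simp
    then have "4 ^ CARD('n) / hgt z ^ (CARD('n) + 1) * hgt z ^ (2 * m) = 4 ^ CARD('n) * hgt z ^ (2 * m - CARD('n) - 1)"
      using hz by simp
    then have "of_real (4 ^ CARD('n) / hgt z ^ (CARD('n) + 1)) * complex_of_real (hgt z ^ (2 * m)) = of_real (4 ^ CARD('n) * hgt z ^ (2 * m - CARD('n) - 1))"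
      by (simp only: of_real_mult[symmetric])
    moreover have "\<Psi> z = FF z * cnj (inverse ((1 - (z $ l)\<^sup>2) ^ m)) * of_real (4 ^ CARD('n) * hgt z ^ (2 * m - CARD('n) - 1))"
      using True by (simp only: \<Psi>_def stretch_def simp_thms if_True)
    ultimately show ?thesis
      using z unfolding c scaleR_conv_of_real by (simp add: mult_ac del: of_real_mult of_real_divide of_real_power)
  next
    case False
    then have "\<Psi> z = 0" by (auto simp: \<Psi>_def stretch_def)
    moreover have "\<eta> (act h z) = 0" if "z \<in> uball"
      using False that by (auto simp: \<eta>_def Eh[OF that])
    ultimately show ?thesis by (auto simp: indicator_def)
  qed
  have am: "act h \<in> inv_vol \<rightarrow>\<^sub>M borel" by measurable
  have \<eta>hm: "(\<lambda>z. \<eta> (act h z)) \<in> borel_measurable borel" by measurable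
  have "integrable inv_vol (\<lambda>z. \<eta> (act h z))"
    unfolding integral_inv_vol(2)[OF \<eta>hm] pull by (intro integrable_mult_right I(2))
  then have \<eta>int: "integrable inv_vol \<eta>"
    using integrable_distr_eq[OF am \<eta>m] by (simp add: distr_inv_vol_act[OF h])
  have "(\<integral>x. \<eta> x \<partial>inv_vol) = (\<integral>z. \<eta> (act h z) \<partial>inv_vol)"
    using integral_distr[OF am \<eta>m] by (simp add: distr_inv_vol_act[OF h])
  also have "\<dots> = K0 * (\<integral>z. \<Psi> z \<partial>lborel)"
    unfolding integral_inv_vol(1)[OF \<eta>hm] pull by (rule integral_mult_right_zero)
  also have "(\<integral>z. \<Psi> z \<partial>lborel) = of_real C * orbit_integral l m f h s"
  proof -
    \<comment> \<open>The boost sends the origin to \<open>axis l (tanh t)\<close> with automorphy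
      factor \<open>1 / cosh t\<close>, so the lift along the orbit is the strip function on the
      real line.\<close>
    have "group_lift m f (h ** boost l t) = FF (axis l (of_real (tanh t))) * of_real (inverse (cosh t)) ^ (2 * m)" for t
      by (simp add: group_lift_def FF_def slash_def act_comp[OF boost_Un1] jfac_comp[OF boost_Un1]
          act_boost_0 jfac_boost power_mult_distrib)
    \<comment> \<open>With m = (n + 1) \<kappa> the exponent of 2 in \<open>C\<close> is the integer
      2n + 1 - 2m.\<close>
    moreover have "C = fact (2 * m - CARD('n) - 1) / (fact (m - 1))\<^sup>2 * pi ^ CARD('n) * (2 * 4 ^ CARD('n) / 4 ^ m)"
    proof -
      have "2 * (real CARD('n) + 1) * (1 - \<kappa>) - 1 = real (2 * CARD('n) + 1) - real (2 * m)"
        using \<open>real m = _\<close> by (simp add: algebra_simps)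
      then have "2 powr (2 * (real CARD('n) + 1) * (1 - \<kappa>) - 1) = 2 powr real (2 * CARD('n) + 1) / 2 powr real (2 * m)"
        by (simp only: powr_diff)
      also have "\<dots> = 2 ^ (2 * CARD('n) + 1) / 2 ^ (2 * m)"
        by (simp only: powr_realpow[OF zero_less_numeral])
      also have "\<dots> = 2 * 4 ^ CARD('n) / 4 ^ m" by (simp add: power_mult)
      finally show ?thesis using \<open>C = _\<close> by simp
    qed
    ultimately show ?thesis using I(3) unfolding orbit_integral_def by (simp only:)
  qed
  finally have "(\<integral>x. \<eta> x \<partial>inv_vol) = K0 * (of_real C * orbit_integral l m f h s)" .
  moreover have "pet_inner \<Gamma> F m f (Theta m \<Gamma> \<gamma>0 X Y) = (\<integral>x. \<eta> x \<partial>inv_vol)"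
    using Theta_well_defined
    by (intro pet_inner_Theta[OF \<Gamma> \<open>fundamental_set \<Gamma> F\<close> \<open>\<gamma>0 \<in> \<Gamma>\<close> \<open>f \<in> cusp_forms m \<Gamma>\<close> _ s E\<gamma> Epos \<eta>_def \<eta>int]) auto
  ultimately show ?thesis by (simp add: K0_def phase h_def mult.assoc)
qed

end
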